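(* Let $\mathcal{E}=\mathcal{E}(r_0)\subset\mathscr{C}^n_{Hyp}(N)$ be a Hyperbolic conical end and let $u\in C^2(\mathcal{E})$ be a solution of $$|\Delta u|\le q_1|u|+q_2|\nabla u|$$ for some $0\le q_1,q_2\in C^0(\mathcal{E})$. Let $C_1,C_2$ be non-negative constants. Then $u\equiv 0$ in each of the following cases. (a) $q_1(r,x)\equiv C_1r^{\frac{3\beta-3}{2}}$, $q_2(r,x)\equiv C_2r^{\frac{\beta-1}{2}}$, $1\le\beta\le 2$, and $$|u(r,x)|=\mathcal{O}(e^{-\tau r^\beta})\quad\text{for all sufficiently large }\tau.$$ (b) $q_1(r,x)\equiv C_1r^{\frac{3\beta-3}{2}}$, $q_2(r,x)\equiv C_2r^{\frac{\beta-1}{2}}$, $\beta>2$, $$|u(r,x)|=\mathcal{O}(e^{-\tau r^\beta})\quad\text{for all sufficiently large }\tau,$$ and $$\int_{\mathcal{E}(r_0)\setminus\mathcal{E}(2r)}|\nabla u|^2e^{2\tau r^\beta}\,d\mu_M=o(r^2)\quad\text{for all sufficiently large }\tau.$$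
   Context: Let $(N,g_N)$ be a compact Riemannian manifold without boundary of dimension $n-1\ge 1$. The Hyperbolic cone with section $N$ is $\mathscr{C}^n_{Hyp}(N)=\big((0,+\infty)\times N,\ g=dr\otimes dr+\sinh^2(r)g_N\big)$. A Hyperbolic conical end is a subset $\mathcal{E}(r_0)=(r_0,+\infty)\times N\subset\mathscr{C}^n_{Hyp}(N)$, $r_0\ge 0$, with the induced metric; $\mathcal{E}(r)=(r,+\infty)\times N$. $\Delta=\operatorname{div}\nabla$, $\nabla$ and $\mu_M$ are the Laplacian, gradient and Riemannian measure of $g$. Points are written $(r,x)$. The symbols $\mathcal{O}$ and $o$ refer to $r\to+\infty$, uniformly in $x\in N$: $v(r,x)=\mathcal{O}(f(r))$ means $\limsup_{r\to+\infty}\sup_x|v(r,x)/f(r)|<+\infty$. In the weight $e^{2\tau r^\beta}$ under the integral, $r$ is the radial coordinate (integration variable), distinct from the parameter $r$ in $\mathcal{E}(2r)$ and $o(r^2)$. *)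

theory Defs
  imports "HOL-Analysis.Analysis"
begin

section \<open>Functions of class \<open>C\<^sup>k\<close> on open subsets of normed spaces\<close>

text \<open>The set \<open>S\<close> is meant to be open. In finite dimension, continuity of all directional derivatives
  amounts to continuity of the derivative.\<close>

primrec Ck_on :: "nat \<Rightarrow> 'b::real_normed_vector set \<Rightarrow> ('b \<Rightarrow> 'c::real_normed_vector) \<Rightarrow> bool" where
  "Ck_on 0 S f \<longleftrightarrow> continuous_on S f"
| "Ck_on (Suc k) S f \<longleftrightarrow>
     (\<forall>x\<in>S. f differentiable (at x)) \<and>
     (\<forall>v. Ck_on k S (\<lambda>x. frechet_derivative f (at x) v))"

definition smooth_on :: "'b::real_normed_vector set \<Rightarrow> ('b \<Rightarrow> 'c::real_normed_vector) \<Rightarrow> bool" where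
  "smooth_on S f \<longleftrightarrow> (\<forall>k. Ck_on k S f)"


section \<open>Riemannian manifolds\<close>

text \<open>The dimension of the manifold is \<open>DIM('b)\<close>, which is at least 1 for every type of class
  \<open>euclidean_space\<close>. Besides its coordinate map, a chart carries the local expression of the
  metric: \<open>chart_metric c y v w\<close> is \<open>g(v,w)\<close> at the point with coordinates \<open>y\<close>, for tangent
  vectors with components \<open>v\<close> and \<open>w\<close>. The maps are only meaningful on \<open>chart_dom c\<close> and
  \<open>chart_img c\<close>.\<close>

record ('a, 'b) rchart =
  chart_dom :: "'a set"
  chart_map :: "'a \<Rightarrow> 'b"
  chart_inv :: "'b \<Rightarrow> 'a"
  chart_metric :: "'b \<Rightarrow> 'b \<Rightarrow> 'b \<Rightarrow> real"

definition chart_img :: "('a, 'b) rchart \<Rightarrow> 'b set" where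
  "chart_img c = chart_map c ` chart_dom c"

definition transition :: "('a, 'b) rchart \<Rightarrow> ('a, 'b) rchart \<Rightarrow> 'b \<Rightarrow> 'b" where
  "transition c d = chart_map d \<circ> chart_inv c"

text \<open>Charts take values in open subsets of \<open>'b\<close>, so these manifolds have no boundary.
  Connectedness is not required.\<close>

locale riemannian_manifold =
  fixes M :: "'a::t2_space set" and A :: "('a, 'b::euclidean_space) rchart set"
  assumes second_countable: "second_countable (top_of_set M)"
    and cover: "(\<Union>c\<in>A. chart_dom c) = M"
    and dom_open: "c \<in> A \<Longrightarrow> openin (top_of_set M) (chart_dom c)"
    and img_open: "c \<in> A \<Longrightarrow> open (chart_img c)"
    and chart_homeo:
      "c \<in> A \<Longrightarrow> homeomorphism (chart_dom c) (chart_img c) (chart_map c) (chart_inv c)"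
    and transition_smooth:
      "c \<in> A \<Longrightarrow> d \<in> A \<Longrightarrow>
        smooth_on (chart_map c ` (chart_dom c \<inter> chart_dom d)) (transition c d)"
    and metric_bilinear: "c \<in> A \<Longrightarrow> y \<in> chart_img c \<Longrightarrow> bilinear (chart_metric c y)"
    and metric_sym:
      "c \<in> A \<Longrightarrow> y \<in> chart_img c \<Longrightarrow> chart_metric c y v w = chart_metric c y w v"
    and metric_pos: "c \<in> A \<Longrightarrow> y \<in> chart_img c \<Longrightarrow> v \<noteq> 0 \<Longrightarrow> chart_metric c y v v > 0"
    and metric_smooth: "c \<in> A \<Longrightarrow> smooth_on (chart_img c) (\<lambda>y. chart_metric c y v w)"
    and metric_transition:
      "c \<in> A \<Longrightarrow> d \<in> A \<Longrightarrow> y \<in> chart_map c ` (chart_dom c \<inter> chart_dom d) \<Longrightarrow>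
        chart_metric c y v w =
          chart_metric d (transition c d y)
            (frechet_derivative (transition c d) (at y) v)
            (frechet_derivative (transition c d) (at y) w)"

text \<open>\<open>S\<close> is meant to be an open subset of the manifold.\<close>

definition Ck_on_manifold ::
  "nat \<Rightarrow> ('a, 'b::euclidean_space) rchart set \<Rightarrow> 'a set \<Rightarrow> ('a \<Rightarrow> real) \<Rightarrow> bool" where
  "Ck_on_manifold k A S u \<longleftrightarrow>
     (\<forall>c\<in>A. Ck_on k (chart_map c ` (chart_dom c \<inter> S)) (u \<circ> chart_inv c))"


section \<open>Gradient, divergence, Laplacian and Riemannian measure\<close>

text \<open>Leibniz formula for the determinant of the Gram matrix; the library's \<open>det\<close> is only
  available for matrices indexed by a type.\<close>

definition gram_det :: "('b::euclidean_space \<Rightarrow> 'b \<Rightarrow> real) \<Rightarrow> real" where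
  "gram_det B = (\<Sum>p | p permutes Basis. of_int (sign p) * (\<Prod>i\<in>Basis. B i (p i)))"

definition vol_density :: "('a, 'b::euclidean_space) rchart \<Rightarrow> 'b \<Rightarrow> real" where
  "vol_density c y = sqrt (gram_det (chart_metric c y))"

definition chart_grad ::
  "('a, 'b::euclidean_space) rchart \<Rightarrow> ('a \<Rightarrow> real) \<Rightarrow> 'b \<Rightarrow> 'b" where
  "chart_grad c u y =
     (THE w. \<forall>v. chart_metric c y w v = frechet_derivative (u \<circ> chart_inv c) (at y) v)"

definition chart_div :: "('a, 'b::euclidean_space) rchart \<Rightarrow> ('b \<Rightarrow> 'b) \<Rightarrow> 'b \<Rightarrow> real" where
  "chart_div c X y =
     (\<Sum>i\<in>Basis. frechet_derivative (\<lambda>z. vol_density c z * (X z \<bullet> i)) (at y) i) / vol_density c y"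

text \<open>On a Riemannian manifold the values of \<open>laplacian\<close> and \<open>grad_norm\<close> do not depend on
  the chart chosen around the point.\<close>

definition chart_at :: "('a, 'b) rchart set \<Rightarrow> 'a \<Rightarrow> ('a, 'b) rchart" where
  "chart_at A p = (SOME c. c \<in> A \<and> p \<in> chart_dom c)"

definition laplacian ::
  "('a, 'b::euclidean_space) rchart set \<Rightarrow> ('a \<Rightarrow> real) \<Rightarrow> 'a \<Rightarrow> real" where
  "laplacian A u p = (let c = chart_at A p in chart_div c (chart_grad c u) (chart_map c p))"

definition grad_norm ::
  "('a, 'b::euclidean_space) rchart set \<Rightarrow> ('a \<Rightarrow> real) \<Rightarrow> 'a \<Rightarrow> real" where
  "grad_norm A u p =
     (let c = chart_at A p; y = chart_map c p; w = chart_grad c u y in sqrt (chart_metric c y w w))"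

text \<open>The Riemannian measure is the unique Borel measure on the manifold that is
  \<open>\<surd>det g dy\<close> in each chart.\<close>

definition riemannian_measure ::
  "'a::topological_space set \<Rightarrow> ('a, 'b::euclidean_space) rchart set \<Rightarrow> 'a measure" where
  "riemannian_measure M A =
     (THE \<mu>. sets \<mu> = sets (restrict_space borel M) \<and>
        (\<forall>c\<in>A. \<forall>B\<in>sets \<mu>. B \<subseteq> chart_dom c \<longrightarrow>
           emeasure \<mu> B = (\<integral>\<^sup>+y\<in>chart_map c ` B. ennreal (vol_density c y) \<partial>lborel)))"


section \<open>Hyperbolic cones and conical ends\<close>

text \<open>The cone over \<open>N\<close> has dimension \<open>DIM(real \<times> 'b) = DIM('b) + 1\<close> and metric
  \<open>dr \<otimes> dr + sinh\<^sup>2(r) g\<^sub>N\<close>.\<close>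

definition hyp_cone :: "'a set \<Rightarrow> (real \<times> 'a) set" where
  "hyp_cone N = {0<..} \<times> N"

definition hyp_cone_chart :: "('a, 'b) rchart \<Rightarrow> (real \<times> 'a, real \<times> 'b) rchart" where
  "hyp_cone_chart c =
     \<lparr>chart_dom = {0<..} \<times> chart_dom c,
      chart_map = (\<lambda>(r, x). (r, chart_map c x)),
      chart_inv = (\<lambda>(r, y). (r, chart_inv c y)),
      chart_metric = (\<lambda>(r, y) (a, v) (b, w). a * b + (sinh r)\<^sup>2 * chart_metric c y v w)\<rparr>"

definition hyp_cone_atlas ::
  "('a, 'b) rchart set \<Rightarrow> (real \<times> 'a, real \<times> 'b) rchart set" where
  "hyp_cone_atlas A = hyp_cone_chart ` A"

definition conical_end :: "'a set \<Rightarrow> real \<Rightarrow> (real \<times> 'a) set" where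
  "conical_end N r = {r<..} \<times> N"

text \<open>\<open>v(r,x) = O(f(r))\<close> as \<open>r \<rightarrow> \<infinity>\<close>, uniformly in \<open>x \<in> N\<close>.\<close>

definition bigo_end :: "'a set \<Rightarrow> (real \<times> 'a \<Rightarrow> real) \<Rightarrow> (real \<Rightarrow> real) \<Rightarrow> bool" where
  "bigo_end N v f \<longleftrightarrow> Limsup at_top (\<lambda>r. SUP x\<in>N. ereal \<bar>v (r, x) / f r\<bar>) < \<infinity>"

end

theory Submission
  imports Defs
begin

text \<open>Everything is reduced to inequalities in the radial variable for integrals over the compact
  section, where Green's formula is available. Put \<open>\<phi> r = (r + 2 \<beta>) powr \<beta>\<close>, \<open>s = sinh r\<close> and let
  \<open>w = s powr (m / 2) exp (\<tau> \<phi>) u\<close>, with \<open>m\<close> the dimension of the section \<open>N\<close>. The conjugated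
  Laplacian splits as \<open>P1 + P2\<close>, with \<open>P1 w = w'' + (\<tau> \<phi>')\<^sup>2 w + L w / s\<^sup>2\<close>, \<open>L\<close> the Laplacian
  of the section, and \<open>P2 w = - 2 \<tau> \<phi>' w' + \<tau> \<phi>' w\<close>, up to terms of lower order. The
  integral of \<open>2 P1 P2\<close> over \<open>N\<close> is the radial derivative of a quadratic expression \<open>B\<close> plus a
  quadratic form whose angular part is positive because the slices of the cone are strictly
  convex. For \<open>\<tau>\<close> large it absorbs the right-hand side of the differential inequality, and
  \<open>B' \<le> - \<integral> w\<^sup>2\<close>. The decay of \<open>u\<close> forces \<open>B \<ge> 0\<close>: otherwise \<open>\<integral> u u\<^sub>r\<close> would be positive from some
  radius on, and \<open>\<integral> u\<^sup>2\<close> would increase instead of tending to \<open>0\<close>. Hence \<open>B\<close> at a radius \<open>R1\<close>,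
  which is of order \<open>\<tau>\<^sup>2 exp (2 \<tau> \<phi>(R1))\<close>, dominates integrals of \<open>w\<^sup>2\<close> over \<open>r > R > R1\<close>, and
  \<open>\<tau> \<rightarrow> \<infinity>\<close> gives \<open>u = 0\<close> there.\<close>

section \<open>Determinants of Gram matrices\<close>

text \<open>The decisive choice is the term \<open>\<tau> \<phi>' w\<close> in \<open>P2\<close>.
  For linear \<open>\<phi>\<close> the natural coefficient
  \<open>6 \<tau>^3 \<phi>'^2 \<phi>''\<close> of \<open>w^2\<close> vanishes; the added term
  supplies \<open>2 \<tau>^3 \<phi>'^3\<close>. It costs \<open>2 \<tau> \<phi>'\<close> in the
  coefficient of \<open>w'^2\<close>, which the square of \<open>P2\<close> repays, and as much in
  the angular coefficient, which stays positive because \<open>2 coth r - 1 \<ge> 1\<close>. The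
  orders of the surviving terms fix the admissible growth: \<open>q1^2\<close> may be of size
  \<open>\<phi>'^3\<close>, and \<open>q2^2\<close> of size \<open>\<phi>'\<close>. The boundary
  terms at infinity contain \<open>u_r\<close>, for which no pointwise decay is assumed. Hence no
  cut-off is used: \<open>B\<close> is decreasing, and only its sign has to be found. Integrals over
  \<open>N\<close> are finite sums of chart integrals weighted by a partition of unity. Bump
  functions of class C1 suffice, since Green's formula differentiates the test function only
  once.\<close>

lemma permutes_sum_reindex:
  fixes B :: "'c \<Rightarrow> 'c \<Rightarrow> real"
  assumes "finite A" "inj_on f A"
  shows "(\<Sum>p | p permutes f ` A. of_int (sign p) * (\<Prod>i\<in>f ` A. B i (p i))) =
         (\<Sum>p | p permutes A. of_int (sign p) * (\<Prod>i\<in>A. B (f i) (f (p i))))"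
proof -
  have bij: "bij_betw f A (f ` A)" using assms by (simp add: inj_on_imp_bij_betw)
  have bij': "bij_betw (inv_into A f) (f ` A) A"
    using bij by (rule bij_betw_inv_into)
  have fin: "finite (f ` A)" using assms by simp
  show ?thesis
  \<comment> \<open>Conjugation by \<open>f\<close> is a sign-preserving bijection between the
    permutations of \<open>A\<close> and those of its image.\<close>
  proof (rule sum.reindex_bij_witness[where i = "map_permutation A f" and j = "map_permutation (f ` A) (inv_into A f)"])
    fix p assume p: "p \<in> {p. p permutes f ` A}"
    then have pp: "p permutes f ` A" by simp
    show "map_permutation A f (map_permutation (f ` A) (inv_into A f) p) = p"
      by (rule map_permutation_compose_inv[OF bij' pp]) (auto simp: f_inv_into_f)
    show "map_permutation (f ` A) (inv_into A f) p \<in> {p. p permutes A}"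
      using map_permutation_permutes[OF bij' pp] by simp
    have s: "sign (map_permutation (f ` A) (inv_into A f) p) = sign p"
      by (rule sign_map_permutation) (use pp fin bij' in \<open>auto simp: bij_betw_def\<close>)
    have ap: "f (map_permutation (f ` A) (inv_into A f) p i) = p (f i)" if "i \<in> A" for i
    proof -
      have "map_permutation (f ` A) (inv_into A f) p (inv_into A f (f i)) = inv_into A f (p (f i))"
        by (rule map_permutation_apply) (use that bij' in \<open>auto simp: bij_betw_def\<close>)
      then have "map_permutation (f ` A) (inv_into A f) p i = inv_into A f (p (f i))"
        using that assms by simp
      moreover have "p (f i) \<in> f ` A" using pp that by (simp add: permutes_in_image)
      ultimately show ?thesis by (simp add: f_inv_into_f)
    qed
    show "of_int (sign (map_permutation (f ` A) (inv_into A f) p)) *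
        (\<Prod>i\<in>A. B (f i) (f (map_permutation (f ` A) (inv_into A f) p i))) =
        of_int (sign p) * (\<Prod>i\<in>f ` A. B i (p i))"
      unfolding s by (subst prod.reindex[OF assms(2)]) (simp add: ap)
  next
    fix p assume p: "p \<in> {p. p permutes A}"
    then have pp: "p permutes A" by simp
    show "map_permutation (f ` A) (inv_into A f) (map_permutation A f p) = p"
      by (rule map_permutation_compose_inv[OF bij pp]) (use assms in auto)
    show "map_permutation A f p \<in> {p. p permutes f ` A}"
      using map_permutation_permutes[OF bij pp] by simp
  qed
qed

text \<open>The Gram matrix is block diagonal: \<open>(1, 0)\<close> is a unit vector orthogonal to
  the angular directions. The factor \<open>s\<close>, later \<open>(sinh r)\<^sup>2\<close>, comes
  out of each of the \<open>DIM('b)\<close> remaining rows.\<close>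

lemma gram_det_prod:
  fixes B :: "real \<times> 'b::euclidean_space \<Rightarrow> real \<times> 'b \<Rightarrow> real"
  assumes "\<And>a v b w. B (a, v) (b, w) = a * b + s * G v w"
  assumes G0: "\<And>v. G 0 v = 0" "\<And>v. G v 0 = 0"
  shows "gram_det B = s ^ DIM('b) * gram_det G"
proof -
  define R where "R = Pair (0::real) ` (Basis :: 'b set)"
  have Bas: "(Basis :: (real \<times> 'b) set) = insert (1, 0) R"
    by (auto simp: Basis_prod_def R_def)
  have notin: "(1, 0) \<notin> R" and fin: "finite R" by (auto simp: R_def)
  \<comment> \<open>A permutation that moves \<open>(1, 0)\<close> sends it to an angular basis
    vector, so the product contains a factor 0.\<close>
  have zero: "of_int (sign p) * (\<Prod>i\<in>Basis. B i (p i)) = 0"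
    if "p permutes Basis" "\<not> p permutes R" for p
  proof -
    have "p (1, 0) \<noteq> (1, 0)"
    proof
      assume "p (1, 0) = (1, 0)"
      then have "p permutes R"
        using that(1) unfolding Bas by (intro permutes_superset[OF that(1)]) (auto simp: Bas)
      with that show False by simp
    qed
    moreover have "p (1, 0) \<in> Basis" using permutes_in_image[OF that(1), of "(1, 0)"] by (simp add: Bas)
    ultimately have "p (1, 0) \<in> R" by (auto simp: Bas)
    then have "B (1, 0) (p (1, 0)) = 0" by (auto simp: R_def assms)
    then have "(\<Prod>i\<in>Basis. B i (p i)) = 0"
      by (intro prod_zero bexI[of _ "(1, 0)"]) (auto simp: Bas fin)
    then show ?thesis by simp
  qed
  have "gram_det B = (\<Sum>p | p permutes R. of_int (sign p) * (\<Prod>i\<in>Basis. B i (p i)))"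
    unfolding gram_det_def
  proof (rule sum.mono_neutral_right)
    show "finite {p. p permutes (Basis :: (real \<times> 'b) set)}" by (simp add: finite_permutations)
    show "{p. p permutes R} \<subseteq> {p. p permutes Basis}"
      unfolding Bas by (auto intro: permutes_subset)
  qed (use zero in auto)
  also have "\<dots> = (\<Sum>p | p permutes R. of_int (sign p) * (\<Prod>i\<in>R. B i (p i)))"
  proof (rule sum.cong)
    fix p assume "p \<in> {p. p permutes R}"
    then have "p (1, 0) = (1, 0)" using notin by (simp add: permutes_not_in)
    then have "B (1, 0) (p (1, 0)) = 1" by (simp add: assms)
    then show "of_int (sign p) * (\<Prod>i\<in>Basis. B i (p i)) = of_int (sign p) * (\<Prod>i\<in>R. B i (p i))"
      unfolding Bas using notin fin by simp
  qed simp
  also have "\<dots> = (\<Sum>p | p permutes (Basis :: 'b set). of_int (sign p) *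
      (\<Prod>i\<in>Basis. B (0, i) (0, p i)))"
    unfolding R_def by (rule permutes_sum_reindex) (auto simp: inj_on_def)
  also have "\<dots> = s ^ DIM('b) * gram_det G"
    unfolding gram_det_def sum_distrib_left
    by (rule sum.cong) (auto simp: assms prod.distrib)
  finally show ?thesis .
qed

text \<open>The change of variables theorem of the library needs a well-ordered index type; indexing by the
  basis vectors transports it to an arbitrary Euclidean space.\<close>

typedef (overloaded) ('b::euclidean_space) basis_index = "Basis :: 'b set"
  using nonempty_Basis by blast

instance basis_index :: (euclidean_space) finite
proof
  have "finite (Rep_basis_index ` (UNIV :: 'a basis_index set))"
    by (rule finite_subset[of _ Basis]) (use Rep_basis_index in auto)
  then show "finite (UNIV :: 'a basis_index set)"
    by (rule finite_imageD) (auto simp: inj_on_def Rep_basis_index_inject)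
qed

instantiation basis_index :: (euclidean_space) wellorder
begin

definition less_eq_basis_index :: "'a basis_index \<Rightarrow> 'a basis_index \<Rightarrow> bool" where
  "less_eq_basis_index x y \<longleftrightarrow> to_nat_on UNIV x \<le> to_nat_on UNIV y"

definition less_basis_index :: "'a basis_index \<Rightarrow> 'a basis_index \<Rightarrow> bool" where
  "less_basis_index x y \<longleftrightarrow> to_nat_on UNIV x < to_nat_on UNIV y"

instance
proof
  fix x y z :: "'a basis_index"
  show "x < y \<longleftrightarrow> x \<le> y \<and> \<not> y \<le> x" "x \<le> x" "x \<le> y \<Longrightarrow> y \<le> z \<Longrightarrow> x \<le> z" "x \<le> y \<or> y \<le> x"
    by (auto simp: less_eq_basis_index_def less_basis_index_def)
  show "x = y" if "x \<le> y" "y \<le> x"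
  proof -
    have "countable (UNIV :: 'a basis_index set)" by (rule countable_finite) simp
    then have "inj_on (to_nat_on UNIV) (UNIV :: 'a basis_index set)" by (rule inj_on_to_nat_on)
    then show ?thesis using that by (simp add: less_eq_basis_index_def inj_on_def)
  qed
next
  fix P :: "'a basis_index \<Rightarrow> bool" and a
  assume *: "\<And>x. (\<And>y. y < x \<Longrightarrow> P y) \<Longrightarrow> P x"
  show "P a"
  proof (induction a rule: measure_induct_rule[where f = "to_nat_on UNIV"])
    case (less x)
    show ?case by (rule *) (rule less, simp add: less_basis_index_def)
  qed
qed

end

section \<open>Coordinates of a Euclidean space indexed by its basis vectors\<close>

abbreviation bvec :: "'b::euclidean_space basis_index \<Rightarrow> 'b" where
  "bvec \<equiv> Rep_basis_index"

lemma bvec_Basis [simp]: "bvec i \<in> Basis"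
  by (rule Rep_basis_index)

lemma range_bvec: "range bvec = Basis"
  using type_definition.Rep_range[OF type_definition_basis_index] .

lemma inj_bvec: "inj bvec"
  by (auto simp: inj_on_def Rep_basis_index_inject)

lemma bvec_inner: "bvec i \<bullet> bvec j = (if i = j then 1 else 0)"
  by (auto simp: inner_Basis Rep_basis_index_inject)

lemma sum_bvec: "(\<Sum>i\<in>UNIV. f (bvec i)) = (\<Sum>i\<in>Basis. f i)"
  by (simp add: sum.reindex[OF inj_bvec, simplified o_def, symmetric] range_bvec)

definition of_vec :: "real ^ ('b::euclidean_space basis_index) \<Rightarrow> 'b" where
  "of_vec x = (\<Sum>i\<in>UNIV. (x $ i) *\<^sub>R bvec i)"

definition to_vec :: "'b::euclidean_space \<Rightarrow> real ^ 'b basis_index" where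
  "to_vec y = (\<chi> i. y \<bullet> bvec i)"

lemma of_vec_inner: "of_vec x \<bullet> bvec i = x $ i"
  by (simp add: of_vec_def inner_sum_left bvec_inner if_distrib cong: if_cong)

lemma to_of_vec [simp]: "to_vec (of_vec x) = x"
  by (simp add: to_vec_def of_vec_inner)

lemma of_to_vec [simp]: "of_vec (to_vec y) = y"
  unfolding of_vec_def to_vec_def
  using sum_bvec[of "\<lambda>i. (y \<bullet> i) *\<^sub>R i"] by (simp add: euclidean_representation)

lemma linear_of_vec: "linear of_vec"
  by (rule linearI) (simp_all add: of_vec_def scaleR_left_distrib sum.distrib scaleR_right.sum)

lemma linear_to_vec: "linear to_vec"
  by (rule linearI) (simp_all add: to_vec_def vec_eq_iff inner_add_left)

section \<open>Gram determinants under linear maps and their positivity\<close>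

definition linear_det :: "('b::euclidean_space \<Rightarrow> 'b) \<Rightarrow> real" where
  "linear_det L = det (matrix (to_vec \<circ> L \<circ> of_vec))"

lemma of_vec_axis: "of_vec (axis i 1) = bvec i"
proof -
  have "(\<Sum>k\<in>UNIV. (axis i 1 $ k) *\<^sub>R bvec k) = (\<Sum>k\<in>UNIV. if k = i then bvec k else 0)"
    by (rule sum.cong) (auto simp: axis_def)
  then show ?thesis by (simp add: of_vec_def)
qed

lemma gram_det_eq_det: "gram_det B = det (\<chi> i j. B (bvec i) (bvec j))"
proof -
  have "gram_det B = (\<Sum>p | p permutes range bvec. of_int (sign p) * (\<Prod>i\<in>range bvec. B i (p i)))"
    by (simp add: gram_det_def range_bvec)
  also have "\<dots> = (\<Sum>p | p permutes UNIV. of_int (sign p) * (\<Prod>i\<in>UNIV. B (bvec i) (bvec (p i))))"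
    by (rule permutes_sum_reindex) (auto simp: inj_bvec)
  finally show ?thesis by (simp add: det_def)
qed

lemma bilinear_expand:
  assumes "bilinear B"
  shows "B v w = (\<Sum>i\<in>Basis. \<Sum>j\<in>Basis. (v \<bullet> i) * (w \<bullet> j) * B i j)"
proof -
  have "B v w = B (\<Sum>i\<in>Basis. (v \<bullet> i) *\<^sub>R i) (\<Sum>j\<in>Basis. (w \<bullet> j) *\<^sub>R j)"
    by (simp add: euclidean_representation)
  also have "\<dots> = (\<Sum>(i,j)\<in>Basis \<times> Basis. B ((v \<bullet> i) *\<^sub>R i) ((w \<bullet> j) *\<^sub>R j))"
    by (rule bilinear_sum[OF assms])
  also have "\<dots> = (\<Sum>i\<in>Basis. \<Sum>j\<in>Basis. (v \<bullet> i) * (w \<bullet> j) * B i j)"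
    by (simp add: sum.cartesian_product bilinear_lmul[OF assms] bilinear_rmul[OF assms] mult_ac)
  finally show ?thesis .
qed

text \<open>The Gram matrix of the pulled-back form is \<open>transpose M ** G ** M\<close>, with
  \<open>M\<close> the matrix of \<open>L\<close>. This is the transformation law behind the
  invariance of the Riemannian volume.\<close>

lemma gram_det_linear:
  assumes B: "bilinear B"
  shows "gram_det (\<lambda>v w. B (L v) (L w)) = (linear_det L)\<^sup>2 * gram_det B"
proof -
  define M where "M = matrix (to_vec \<circ> L \<circ> of_vec)"
  define G where "G = (\<chi> i j. B (bvec i) (bvec j))"
  have M: "M $ k $ i = L (bvec i) \<bullet> bvec k" for k i
    by (simp add: M_def matrix_def to_vec_def of_vec_axis)
  have "(\<chi> i j. B (L (bvec i)) (L (bvec j))) = transpose M ** G ** M"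
  proof (simp add: vec_eq_iff, intro allI)
    fix i j
    have "B (L (bvec i)) (L (bvec j)) =
       (\<Sum>k\<in>Basis. \<Sum>l\<in>Basis. (L (bvec i) \<bullet> k) * (L (bvec j) \<bullet> l) * B k l)"
      by (rule bilinear_expand[OF B])
    also have "\<dots> = (\<Sum>k\<in>UNIV. \<Sum>l\<in>UNIV. M $ k $ i * M $ l $ j * G $ k $ l)"
      by (simp add: sum_bvec[symmetric] M G_def)
    also have "\<dots> = (transpose M ** G ** M) $ i $ j"
      by (simp add: matrix_matrix_mult_def transpose_def sum_distrib_left sum_distrib_right)
        (subst sum.swap, simp add: mult_ac)
    finally show "B (L (bvec i)) (L (bvec j)) = (transpose M ** G ** M) $ i $ j" .
  qed
  then have "gram_det (\<lambda>v w. B (L v) (L w)) = det (transpose M ** G ** M)"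
    by (simp add: gram_det_eq_det)
  also have "\<dots> = (det M)\<^sup>2 * det G" by (simp add: det_mul det_transpose power2_eq_square)
  finally show ?thesis by (simp add: linear_det_def M_def G_def gram_det_eq_det)
qed

text \<open>The segment from the identity to the Gram matrix consists of positive definite, hence
  invertible, matrices. The determinant is 1 at the start and has no zero along the way.\<close>

lemma gram_det_pos:
  assumes B: "bilinear B" and pos: "\<And>v. v \<noteq> 0 \<Longrightarrow> B v v > 0"
  shows "gram_det B > 0"
proof -
  define G where "G = (\<chi> i j. B (bvec i) (bvec j))"
  define H where "H t = t *\<^sub>R G + (1 - t) *\<^sub>R mat 1" for t :: real
  have "det (H t) \<noteq> 0" if "t \<in> {0..1}" for t
  proof -
    have "x = 0" if x: "H t *v x = 0" for x
    proof (rule ccontr)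
      assume "x \<noteq> 0"
      then have "of_vec x \<noteq> 0" by (metis to_of_vec linear_0 linear_to_vec)
      have "x \<bullet> (G *v x) = (\<Sum>i\<in>UNIV. \<Sum>j\<in>UNIV. (of_vec x \<bullet> bvec i) * (of_vec x \<bullet> bvec j) * B (bvec i) (bvec j))"
        by (simp add: inner_vec_def matrix_vector_mult_def G_def of_vec_inner sum_distrib_left mult_ac)
      also have "\<dots> = B (of_vec x) (of_vec x)"
        unfolding bilinear_expand[OF B, of "of_vec x" "of_vec x"] by (simp add: sum_bvec[symmetric])
      finally have 1: "x \<bullet> (G *v x) > 0" using pos \<open>of_vec x \<noteq> 0\<close> by simp
      have "x \<bullet> (H t *v x) = t * (x \<bullet> (G *v x)) + (1 - t) * (x \<bullet> x)"
        by (simp add: H_def matrix_vector_mult_add_rdistrib scaleR_matrix_vector_assoc[symmetric] inner_add_right)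
      also have "\<dots> > 0"
      proof (cases "t = 0")
        case True
        then show ?thesis using \<open>x \<noteq> 0\<close> by simp
      next
        case False
        then have "t * (x \<bullet> (G *v x)) > 0" "(1 - t) * (x \<bullet> x) \<ge> 0"
          using 1 \<open>t \<in> {0..1}\<close> by auto
        then show ?thesis by linarith
      qed
      finally show False using x by simp
    qed
    then show ?thesis
      by (simp add: invertible_det_nz[symmetric] invertible_left_inverse matrix_left_invertible_ker)
  qed
  moreover have "continuous_on {0..1} (\<lambda>t. det (H t))"
    unfolding det_def H_def by (intro continuous_intros) 
  moreover have "det (H 0) = 1" by (simp add: H_def)
  ultimately have "det (H 1) > 0"
    using IVT2'[of "\<lambda>t. det (H t)" 1 0 0] by (force simp: not_less)
  then show ?thesis by (simp add: H_def G_def gram_det_eq_det)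
qed

section \<open>Change of variables and integration by parts\<close>

text \<open>The function is already extended by zero and continuous on the whole space. Every chart
  integral thus becomes an integral over \<open>UNIV\<close>, and its existence reduces to this
  predicate.\<close>

definition compact_supp :: "'b::euclidean_space set \<Rightarrow> ('b \<Rightarrow> real) \<Rightarrow> bool" where
  "compact_supp V G \<longleftrightarrow>
     continuous_on UNIV G \<and> (\<exists>K. compact K \<and> K \<subseteq> V \<and> (\<forall>y. y \<notin> K \<longrightarrow> G y = 0))"

lemma compact_supp_integrable:
  assumes "compact_supp V G"
  shows "integrable lborel G"
proof -
  obtain K where K: "compact K" "\<And>y. y \<notin> K \<Longrightarrow> G y = 0" and c: "continuous_on UNIV G"
    using assms by (auto simp: compact_supp_def)
  have "integrable lborel (\<lambda>x. indicator K x *\<^sub>R G x)"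
    by (rule borel_integrable_compact) (use K c in \<open>auto intro: continuous_on_subset\<close>)
  moreover have "(\<lambda>x. indicator K x *\<^sub>R G x) = G"
    using K(2) by (auto simp: fun_eq_iff split: split_indicator)
  ultimately show ?thesis by simp
qed

lemma compact_supp_integral:
  "compact_supp V G \<Longrightarrow> integral UNIV G = (\<integral>y. G y \<partial>lborel)"
  by (rule integral_lborel) (rule compact_supp_integrable)

lemma compact_supp_integrable_on: "compact_supp V G \<Longrightarrow> G integrable_on UNIV"
  by (rule integrable_on_lborel) (rule compact_supp_integrable)

lemma compact_supp_absolutely_integrable:
  assumes "compact_supp V G"
  shows "G absolutely_integrable_on UNIV"
proof -
  have "integrable lborel G" by (rule compact_supp_integrable[OF assms])
  then have "integrable lebesgue G" by (simp add: integrable_completion borel_measurable_integrable)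
  then show ?thesis by (simp add: set_integrable_def)
qed

text \<open>\<open>V\<close> and the complement of \<open>K\<close> are open and cover the space;
  the extension is continuous on each of them.\<close>

lemma compact_supp_extend:
  assumes "open V" "continuous_on V G" "compact K" "K \<subseteq> V" "\<And>y. y \<in> V \<Longrightarrow> y \<notin> K \<Longrightarrow> G y = 0"
  shows "compact_supp V (\<lambda>y. if y \<in> V then G y else 0)"
  unfolding compact_supp_def
proof (intro conjI exI[of _ K] allI impI)
  have "continuous_on (V \<union> - K) (\<lambda>y. if y \<in> V then G y else 0)"
  proof (rule continuous_on_open_Un)
    show "continuous_on V (\<lambda>y. if y \<in> V then G y else 0)"
      using assms(2) by (simp cong: continuous_on_cong)
    have "continuous_on (- K) (\<lambda>y. 0 :: real)" by simp
    then show "continuous_on (- K) (\<lambda>y. if y \<in> V then G y else 0)"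
      by (rule continuous_on_eq) (use assms in auto)
  qed (use assms in \<open>auto simp: open_Compl compact_imp_closed\<close>)
  moreover have "V \<union> - K = UNIV" using assms by auto
  ultimately show "continuous_on UNIV (\<lambda>y. if y \<in> V then G y else 0)" by simp
qed (use assms in auto)

lemma continuous_of_vec: "continuous_on S of_vec"
  by (rule linear_continuous_on) (simp add: linear_of_vec linear_conv_bounded_linear[symmetric])

lemma continuous_to_vec: "continuous_on S to_vec"
  by (rule linear_continuous_on) (simp add: linear_to_vec linear_conv_bounded_linear[symmetric])

lemma prod_bvec: "(\<Prod>i\<in>UNIV. f (bvec i)) = (\<Prod>i\<in>Basis. f i)"
  by (simp add: prod.reindex[OF inj_bvec, simplified o_def, symmetric] range_bvec)

text \<open>Preimages of boxes under \<open>of_vec\<close> are boxes with the same side lengths, and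
  the volumes of boxes determine Lebesgue measure.\<close>

lemma distr_of_vec: "distr lborel borel of_vec = (lborel :: 'b::euclidean_space measure)"
proof (rule lborel_eqI[symmetric])
  fix l u :: 'b assume lu: "\<And>b. b \<in> Basis \<Longrightarrow> l \<bullet> b \<le> u \<bullet> b"
  have m: "of_vec \<in> borel_measurable borel"
    by (rule borel_measurable_continuous_onI) (rule continuous_of_vec)
  have "y \<in> box l u \<longleftrightarrow> to_vec y \<in> box (to_vec l) (to_vec u)" for y
    by (auto simp: mem_box_cart mem_box to_vec_def range_bvec[symmetric])
  then have "of_vec -` box l u = box (to_vec l) (to_vec u)" by auto
  then have "emeasure (distr lborel borel of_vec) (box l u) = emeasure lborel (box (to_vec l) (to_vec u))"
    using m by (subst emeasure_distr) auto
  also have "\<dots> = (\<Prod>b\<in>Basis. (to_vec u - to_vec l) \<bullet> b)"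
    by (rule emeasure_lborel_box) (use lu in \<open>auto simp: Basis_vec_def to_vec_def inner_axis\<close>)
  also have "(\<Prod>b\<in>Basis. (to_vec u - to_vec l) \<bullet> b) = (\<Prod>b\<in>(\<lambda>i. axis i 1) ` UNIV. (to_vec u - to_vec l) \<bullet> b)"
    by (rule prod.cong) (auto simp: Basis_vec_def)
  also have "\<dots> = (\<Prod>i\<in>UNIV. (to_vec u - to_vec l) $ i)"
    by (subst prod.reindex) (auto simp: inj_on_def axis_eq_axis inner_axis)
  also have "\<dots> = (\<Prod>i\<in>UNIV. (u - l) \<bullet> bvec i)"
    by (simp add: to_vec_def inner_diff_left)
  also have "\<dots> = (\<Prod>b\<in>Basis. (u - l) \<bullet> b)" by (rule prod_bvec)
  finally show "emeasure (distr lborel borel of_vec) (box l u) = (\<Prod>b\<in>Basis. (u - l) \<bullet> b)" .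
qed simp

lemma compact_supp_of_vec:
  assumes "compact_supp V G"
  shows "compact_supp (of_vec -` V) (G \<circ> of_vec)"
proof -
  obtain K where K: "compact K" "K \<subseteq> V" "\<And>y. y \<notin> K \<Longrightarrow> G y = 0" and c: "continuous_on UNIV G"
    using assms by (auto simp: compact_supp_def)
  have "compact (to_vec ` K)"
    by (rule compact_continuous_image[OF continuous_to_vec K(1)])
  moreover have "to_vec ` K \<subseteq> of_vec -` V" using K by auto
  moreover have "G (of_vec x) = 0" if "x \<notin> to_vec ` K" for x
    using that K(3)[of "of_vec x"] by (metis imageI to_of_vec)
  moreover have "continuous_on UNIV (G \<circ> of_vec)"
    using c continuous_of_vec by (rule continuous_on_compose2[THEN continuous_on_eq]) auto
  ultimately show ?thesis unfolding compact_supp_def by (metis comp_apply)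
qed

lemma integral_of_vec:
  assumes "compact_supp V G"
  shows "integral UNIV (G \<circ> of_vec) = integral UNIV G"
proof -
  have m: "of_vec \<in> borel_measurable borel"
    by (rule borel_measurable_continuous_onI) (rule continuous_of_vec)
  have "integral UNIV (G \<circ> of_vec) = (\<integral>x. G (of_vec x) \<partial>lborel)"
    using compact_supp_integral[OF compact_supp_of_vec[OF assms]] by simp
  also have "\<dots> = (\<integral>y. G y \<partial>distr lborel borel of_vec)"
    using m compact_supp_integrable[OF assms] by (subst integral_distr) auto
  also have "\<dots> = integral UNIV G"
    by (simp add: distr_of_vec compact_supp_integral[OF assms])
  finally show ?thesis .
qed

lemma change_of_variables_vec:
  fixes T :: "real ^ 'm::{finite,wellorder} \<Rightarrow> real ^ 'm::_"
  assumes U: "open U" and T: "\<And>y. y \<in> U \<Longrightarrow> (T has_derivative T' y) (at y)"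
    and inj: "inj_on T U"
    and H: "compact_supp (T ` U) H" and G: "compact_supp U G"
    and eq: "\<And>y. y \<in> U \<Longrightarrow> G y = \<bar>det (matrix (T' y))\<bar> * H (T y)"
  shows "integral UNIV G = integral UNIV H"
proof -
  \<comment> \<open>The theorem on absolutely integrable functions concerns vector-valued
    integrands, so the scalar one is packed into \<open>real ^ 1\<close>.\<close>
  define f where "f z = (vec (H z) :: real ^ 1)" for z
  have bl: "bounded_linear (vec :: real \<Rightarrow> real ^ 1)"
    by (simp add: linear_conv_bounded_linear[symmetric] linear_iff vec_eq_iff)
  have "H absolutely_integrable_on T ` U"
  proof (rule set_integrable_subset[OF compact_supp_absolutely_integrable[OF H]])
    have "open (T ` U)"
    proof (rule invariance_of_domain[OF _ U inj])
      show "continuous_on U T"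
        using T by (meson continuous_at_imp_continuous_on has_derivative_continuous)
    qed
    then show "T ` U \<in> sets lebesgue" by simp
  qed auto
  then have "f absolutely_integrable_on (T ` U)"
    using absolutely_integrable_linear[OF _ bl] by (simp add: f_def[abs_def] o_def)
  then have "f absolutely_integrable_on (T ` U) \<and> integral (T ` U) f = integral (T ` U) f" by simp
  then have "integral U (\<lambda>x. \<bar>det (matrix (T' x))\<bar> *\<^sub>R f (T x)) = integral (T ` U) f"
    using has_absolute_integral_change_of_variables[of U T T' f "integral (T ` U) f"] U inj
      has_derivative_at_withinI[OF T] by auto
  moreover have "integral U (\<lambda>x. \<bar>det (matrix (T' x))\<bar> *\<^sub>R f (T x)) = integral U (\<lambda>x. vec (G x))"
    by (rule integral_cong) (simp add: f_def eq vec_eq_iff)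
  moreover have z: "integral W F = integral UNIV F" if "compact_supp W F" for W and F :: "real ^ 'm::_ \<Rightarrow> real"
  proof -
    have "(\<lambda>y. if y \<in> W then F y else 0) = F" using that by (fastforce simp: compact_supp_def fun_eq_iff)
    then show ?thesis using integral_restrict_UNIV[of W F] by metis
  qed
  moreover have on: "F integrable_on W" if "compact_supp W F" for W and F :: "real ^ 'm::_ \<Rightarrow> real"
  proof -
    have "(\<lambda>y. if y \<in> W then F y else 0) = F" using that by (fastforce simp: compact_supp_def fun_eq_iff)
    then show ?thesis using integrable_restrict_UNIV[of W F] compact_supp_integrable_on[OF that] by metis
  qed
  moreover have "integral U (\<lambda>x. vec (G x)) = (vec (integral U G) :: real ^ 1)"
    using integral_linear[OF on[OF G] bl] by (simp add: o_def)
  moreover have "integral (T ` U) f = (vec (integral (T ` U) H) :: real ^ 1)"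
    using integral_linear[OF on[OF H] bl] by (simp add: o_def f_def[abs_def])
  ultimately have "(vec (integral UNIV G) :: real ^ 1) = vec (integral UNIV H)"
    using z[OF G] z[OF H] by simp
  then show ?thesis by (simp add: vec_eq_iff)
qed

lemma change_of_variables:
  fixes T :: "'b::euclidean_space \<Rightarrow> 'b"
  assumes U: "open U" and T: "\<And>y. y \<in> U \<Longrightarrow> (T has_derivative T' y) (at y)"
    and inj: "inj_on T U"
    and H: "compact_supp (T ` U) H" and G: "compact_supp U G"
    and eq: "\<And>y. y \<in> U \<Longrightarrow> G y = \<bar>linear_det (T' y)\<bar> * H (T y)"
  shows "integral UNIV G = integral UNIV H"
proof -
  have img: "(to_vec \<circ> T \<circ> of_vec) ` (of_vec -` U) = of_vec -` (T ` U)"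
    by (auto simp: image_iff) (metis of_to_vec to_of_vec vimageI)
  have "integral UNIV (G \<circ> of_vec) = integral UNIV (H \<circ> of_vec)"
  proof (rule change_of_variables_vec[where T = "to_vec \<circ> T \<circ> of_vec" and U = "of_vec -` U"
        and T' = "\<lambda>x. to_vec \<circ> T' (of_vec x) \<circ> of_vec"])
    show "open (of_vec -` U)"
      by (rule open_vimage[OF U]) (rule continuous_of_vec)
    show "((to_vec \<circ> T \<circ> of_vec) has_derivative to_vec \<circ> T' (of_vec y) \<circ> of_vec) (at y)"
      if "y \<in> of_vec -` U" for y
    proof -
      have "(of_vec has_derivative of_vec) (at y)"
        by (rule linear_imp_has_derivative[OF linear_of_vec])
      moreover have "(T has_derivative T' (of_vec y)) (at (of_vec y))" using that T by simp
      moreover have "(to_vec has_derivative to_vec) (at (T (of_vec y)))"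
        by (rule linear_imp_has_derivative[OF linear_to_vec])
      ultimately show ?thesis by (metis (no_types, lifting) diff_chain_at comp_apply comp_assoc)
    qed
    show "inj_on (to_vec \<circ> T \<circ> of_vec) (of_vec -` U)"
      using inj unfolding inj_on_def by (metis comp_apply of_to_vec to_of_vec vimageE)
    show "compact_supp ((to_vec \<circ> T \<circ> of_vec) ` (of_vec -` U)) (H \<circ> of_vec)"
      unfolding img by (rule compact_supp_of_vec[OF H])
    show "compact_supp (of_vec -` U) (G \<circ> of_vec)" by (rule compact_supp_of_vec[OF G])
    show "(G \<circ> of_vec) y = \<bar>det (matrix (to_vec \<circ> T' (of_vec y) \<circ> of_vec))\<bar> * (H \<circ> of_vec) ((to_vec \<circ> T \<circ> of_vec) y)"
      if "y \<in> of_vec -` U" for y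
      using that eq by (simp add: linear_det_def)
  qed
  then show ?thesis using integral_of_vec[OF G] integral_of_vec[OF H] by simp
qed

text \<open>The integral of \<open>Z (y + t e)\<close> does not depend on \<open>t\<close>; differentiate under the integral.\<close>

lemma integral_derivative_eq_0:
  fixes Z :: "'b::euclidean_space \<Rightarrow> real"
  assumes K: "compact K" and Z0: "\<And>y. y \<notin> K \<Longrightarrow> Z y = 0"
    and Z: "\<And>y. (Z has_derivative Z' y) (at y)"
    and c: "continuous_on UNIV (\<lambda>y. Z' y e)"
  shows "integral UNIV (\<lambda>y. Z' y e) = 0"
proof -
  have cZ: "continuous_on UNIV Z"
    using Z by (meson continuous_at_imp_continuous_on has_derivative_continuous)
  have Z'0: "Z' y e = 0" if "y \<notin> K" for y
  proof -
    have "((\<lambda>x. 0 :: real) has_derivative (\<lambda>h. 0)) (at y)" by simp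
    then have "(Z has_derivative (\<lambda>h. 0)) (at y)"
      by (rule has_derivative_transform_within_open[of _ _ _ _ "- K"])
        (use K that Z0 in \<open>auto simp: open_Compl compact_imp_closed\<close>)
    then have "Z' y = (\<lambda>h. 0)" using Z has_derivative_unique by blast
    then show ?thesis by simp
  qed
  have csZ: "compact_supp UNIV Z" using K Z0 cZ by (auto simp: compact_supp_def)
  have csZ': "compact_supp UNIV (\<lambda>y. Z' y e)" using K Z'0 c by (auto simp: compact_supp_def)
  \<comment> \<open>All points that a translation by \<open>t *\<^sub>R e\<close> with
    \<open>t\<close> in \<open>{-1..1}\<close> can bring into \<open>K\<close>. One box around
    \<open>K2\<close> therefore carries every translated integrand.\<close>
  define K2 where "K2 = (\<lambda>(y, t). y - t *\<^sub>R e) ` (K \<times> {-1..1})"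
  have "compact K2" unfolding K2_def
    by (rule compact_continuous_image) (auto intro!: continuous_intros compact_Times K simp: case_prod_beta)
  then obtain a b where ab: "K2 \<subseteq> cbox a b"
    by (meson bounded_subset_cbox_symmetric compact_imp_bounded)
  have inK2: "y \<in> cbox a b" if "y + t *\<^sub>R e \<in> K" "t \<in> {-1..1}" for y t
  proof -
    have "y = (\<lambda>(y, t). y - t *\<^sub>R e) (y + t *\<^sub>R e, t)" by simp
    then show ?thesis using that ab unfolding K2_def by blast
  qed
  have cb: "integral (cbox a b) F = integral UNIV F" if "\<And>y. y \<notin> cbox a b \<Longrightarrow> F y = 0" for F :: "'b \<Rightarrow> real"
  proof -
    have "(\<lambda>y. if y \<in> cbox a b then F y else 0) = F" using that by auto
    then show ?thesis using integral_restrict_UNIV[of "cbox a b" F] by metis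
  qed
  have const: "integral (cbox a b) (\<lambda>y. Z (y + t *\<^sub>R e)) = integral UNIV Z" if t: "t \<in> {-1..1}" for t
  proof -
    have cs: "compact_supp UNIV (\<lambda>y. Z (y + t *\<^sub>R e))"
      unfolding compact_supp_def
      using \<open>compact K2\<close> cZ
      by (intro conjI exI[of _ "cbox a b"])
        (auto intro!: continuous_intros continuous_on_compose2[OF cZ] Z0 dest: inK2[OF _ t])
    have "integral (cbox a b) (\<lambda>y. Z (y + t *\<^sub>R e)) = integral UNIV (\<lambda>y. Z (y + t *\<^sub>R e))"
      by (rule cb) (metis Z0 inK2 t)
    also have "\<dots> = (\<integral>y. Z (y + t *\<^sub>R e) \<partial>lborel)" by (rule compact_supp_integral[OF cs])
    also have "\<dots> = (\<integral>y. Z y \<partial>distr lborel borel ((+) (t *\<^sub>R e)))"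
      using compact_supp_integrable[OF csZ] by (subst integral_distr) (auto simp: add.commute)
    also have "\<dots> = integral UNIV Z"
      by (simp add: lborel_distr_plus compact_supp_integral[OF csZ])
    finally show ?thesis .
  qed
  have "((\<lambda>t. integral (cbox a b) (\<lambda>y. Z (y + t *\<^sub>R e))) has_field_derivative
      integral (cbox a b) (\<lambda>y. Z' (y + 0 *\<^sub>R e) e)) (at 0 within {-1..1})"
  proof (rule leibniz_rule_field_derivative)
    fix t :: real and y assume "t \<in> {-1..1}"
    have "((\<lambda>t. Z (y + t *\<^sub>R e)) has_derivative (\<lambda>h. Z' (y + t *\<^sub>R e) (h *\<^sub>R e))) (at t within {-1..1})"
      by (rule has_derivative_compose[OF _ Z]) (auto intro!: derivative_eq_intros)
    moreover have "(\<lambda>h. Z' (y + t *\<^sub>R e) (h *\<^sub>R e)) = (\<lambda>h. Z' (y + t *\<^sub>R e) e * h)"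
      using linear_cmul[OF has_derivative_linear[OF Z]] by (auto simp: mult.commute)
    ultimately show "((\<lambda>t. Z (y + t *\<^sub>R e)) has_field_derivative Z' (y + t *\<^sub>R e) e) (at t within {-1..1})"
      by (simp add: has_field_derivative_def)
  next
    fix t :: real
    show "(\<lambda>y. Z (y + t *\<^sub>R e)) integrable_on cbox a b"
      by (rule integrable_continuous) (auto intro!: continuous_intros continuous_on_compose2[OF cZ])
  next
    show "continuous_on ({-1..1} \<times> cbox a b) (\<lambda>(t, y). Z' (y + t *\<^sub>R e) e)"
      unfolding case_prod_beta by (auto intro!: continuous_intros continuous_on_compose2[OF c])
  qed auto
  then have "((\<lambda>t. integral UNIV Z) has_field_derivative integral (cbox a b) (\<lambda>y. Z' y e)) (at 0 within {-1..1})"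
    unfolding scaleR_zero_left add_0_right
    by (rule has_field_derivative_transform_within[where d = 1]) (auto simp: const)
  then have "((\<lambda>t. integral UNIV Z) has_field_derivative integral (cbox a b) (\<lambda>y. Z' y e)) (at 0)"
    using at_within_interior[of "0 :: real" "{-1..1}"] by (simp add: interior_atLeastAtMost_real)
  then have "integral (cbox a b) (\<lambda>y. Z' y e) = 0"
    using DERIV_const DERIV_unique by blast
  moreover have "integral (cbox a b) (\<lambda>y. Z' y e) = integral UNIV (\<lambda>y. Z' y e)"
  proof (rule cb)
    fix y assume "y \<notin> cbox a b"
    then have "y \<notin> K" using inK2[of y 0] by auto
    then show "Z' y e = 0" by (rule Z'0)
  qed
  ultimately show ?thesis by simp
qed

section \<open>Functions of class \<open>C\<^sup>1\<close>\<close>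

abbreviation pd :: "('b::real_normed_vector \<Rightarrow> 'c::real_normed_vector) \<Rightarrow> 'b \<Rightarrow> 'b \<Rightarrow> 'c" where
  "pd f v y \<equiv> frechet_derivative f (at y) v"

abbreviation C1_on :: "'b::real_normed_vector set \<Rightarrow> ('b \<Rightarrow> 'c::real_normed_vector) \<Rightarrow> bool" where
  "C1_on \<equiv> Ck_on (Suc 0)"

abbreviation C2_on :: "'b::real_normed_vector set \<Rightarrow> ('b \<Rightarrow> 'c::real_normed_vector) \<Rightarrow> bool" where
  "C2_on \<equiv> Ck_on (Suc (Suc 0))"

text \<open>On an open set both functions have the same germ at every point, hence the same
  derivative there; induct on the order.\<close>

lemma Ck_on_cong_open:
  assumes "open S" "\<And>x. x \<in> S \<Longrightarrow> f x = g x" "Ck_on k S f"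
  shows "Ck_on k S g"
  using assms(2,3)
proof (induction k arbitrary: f g)
  case 0
  then show ?case by (auto cong: continuous_on_cong)
next
  case (Suc k)
  have d: "(g has_derivative frechet_derivative f (at x)) (at x)" if "x \<in> S" for x
  proof (rule has_derivative_transform_within_open[OF _ assms(1) that])
    show "(f has_derivative frechet_derivative f (at x)) (at x)"
      using Suc.prems that by (auto simp: frechet_derivative_works[symmetric])
  qed (use Suc.prems in auto)
  have e: "frechet_derivative f (at x) = frechet_derivative g (at x)" if "x \<in> S" for x
    using frechet_derivative_at[OF d[OF that]] .
  have "Ck_on k S (pd g v)" for v
    by (rule Suc.IH[of "pd f v"]) (use Suc.prems e in auto)
  then show ?case using d by (auto simp: differentiable_def)
qed

lemma Ck_on_Suc_D:
  assumes "Ck_on (Suc k) S f"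
  shows "Ck_on k S f"
  using assms
proof (induction k arbitrary: f)
  case 0
  then have "\<forall>x\<in>S. f differentiable (at x)" by simp
  then have "continuous_on S f"
    by (meson continuous_at_imp_continuous_on differentiable_imp_continuous_within)
  then show ?case by simp
next
  case (Suc k)
  then show ?case by simp
qed

lemma C1_onI:
  assumes "\<And>x. x \<in> S \<Longrightarrow> (f has_derivative f' x) (at x)" "\<And>v. continuous_on S (\<lambda>x. f' x v)"
  shows "C1_on S f"
proof -
  have "frechet_derivative f (at x) = f' x" if "x \<in> S" for x
    using frechet_derivative_at[OF assms(1)[OF that]] by simp
  then have "continuous_on S (pd f v)" for v
    using assms(2)[of v] by (simp cong: continuous_on_cong)
  then show ?thesis using assms(1) by (auto simp: differentiable_def)
qed

lemma C1_on_has_derivative: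
  "Ck_on (Suc k) S f \<Longrightarrow> x \<in> S \<Longrightarrow> (f has_derivative frechet_derivative f (at x)) (at x)"
  by (auto simp: frechet_derivative_works[symmetric])

lemma C1_on_continuous_pd: "C1_on S f \<Longrightarrow> continuous_on S (pd f v)"
  by auto

lemma C1_on_continuous: "C1_on S f \<Longrightarrow> continuous_on S f"
  using Ck_on_Suc_D[of 0] by simp

lemma C1_on_const: "C1_on S (\<lambda>x. c)"
  by (rule C1_onI[where f' = "\<lambda>x v. 0"]) auto

lemma C1_on_add:
  assumes "C1_on S f" "C1_on S g"
  shows "C1_on S (\<lambda>x. f x + g x)"
  by (rule C1_onI[where f' = "\<lambda>x v. pd f v x + pd g v x"])
    (intro has_derivative_add C1_on_has_derivative[OF assms(1)] C1_on_has_derivative[OF assms(2)]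
      continuous_on_add C1_on_continuous_pd assms | assumption)+

lemma C1_on_mult:
  fixes f g :: "'b::real_normed_vector \<Rightarrow> real"
  assumes "C1_on S f" "C1_on S g"
  shows "C1_on S (\<lambda>x. f x * g x)"
  by (rule C1_onI[where f' = "\<lambda>x v. f x * pd g v x + pd f v x * g x"])
    (intro has_derivative_mult C1_on_has_derivative[OF assms(1)] C1_on_has_derivative[OF assms(2)]
      continuous_on_add continuous_on_mult C1_on_continuous_pd C1_on_continuous assms | assumption)+

lemma C1_on_sum:
  "(\<And>i. i \<in> I \<Longrightarrow> C1_on S (f i)) \<Longrightarrow> C1_on S (\<lambda>x. \<Sum>i\<in>I. f i x)"
  by (induction I rule: infinite_finite_induct)
    (simp_all add: C1_on_const C1_on_add del: Ck_on.simps)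

lemma C1_on_prod:
  fixes f :: "'i \<Rightarrow> 'b::real_normed_vector \<Rightarrow> real"
  shows "(\<And>i. i \<in> I \<Longrightarrow> C1_on S (f i)) \<Longrightarrow> C1_on S (\<lambda>x. \<Prod>i\<in>I. f i x)"
  by (induction I rule: infinite_finite_induct)
    (simp_all add: C1_on_const C1_on_mult del: Ck_on.simps)

lemma C1_on_real_compose:
  fixes f :: "'b::real_normed_vector \<Rightarrow> real"
  assumes f: "C1_on S f" and h: "\<And>x. x \<in> S \<Longrightarrow> (h has_real_derivative h' (f x)) (at (f x))"
    and c: "continuous_on S (\<lambda>x. h' (f x))"
  shows "C1_on S (\<lambda>x. h (f x))"
proof (rule C1_onI[where f' = "\<lambda>x v. h' (f x) * pd f v x"])
  show "((\<lambda>x. h (f x)) has_derivative (\<lambda>v. h' (f x) * pd f v x)) (at x)" if "x \<in> S" for x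
    using has_derivative_compose[OF C1_on_has_derivative[OF f that], of h "\<lambda>v. h' (f x) * v"]
      h[OF that] by (simp add: has_field_derivative_def)
qed (intro continuous_intros c C1_on_continuous_pd f)

lemma linear_component_sum:
  fixes L :: "'b::euclidean_space \<Rightarrow> 'c::real_vector"
  assumes "linear L"
  shows "L v = (\<Sum>i\<in>Basis. (v \<bullet> i) *\<^sub>R L i)"
proof -
  have "L v = L (\<Sum>i\<in>Basis. (v \<bullet> i) *\<^sub>R i)" by (simp add: euclidean_representation)
  then show ?thesis by (simp only: linear_sum[OF assms] linear_cmul[OF assms])
qed

lemma C1_on_compose:
  fixes f :: "'c::euclidean_space \<Rightarrow> real" and T :: "'b::real_normed_vector \<Rightarrow> 'c"
  assumes f: "C1_on V f" and T: "C1_on U T" and UV: "T ` U \<subseteq> V"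
  shows "C1_on U (\<lambda>x. f (T x))"
proof (rule C1_onI[where f' = "\<lambda>x v. pd f (pd T v x) (T x)"])
  show "((\<lambda>x. f (T x)) has_derivative (\<lambda>v. pd f (pd T v x) (T x))) (at x)" if "x \<in> U" for x
    by (rule has_derivative_compose[OF C1_on_has_derivative[OF T that]])
      (rule C1_on_has_derivative[OF f], use UV that in auto)
  have "continuous_on U (\<lambda>x. \<Sum>i\<in>Basis. (pd T v x \<bullet> i) *\<^sub>R pd f i (T x))" for v
    by (intro continuous_intros C1_on_continuous_pd[OF T]
        continuous_on_compose2[OF C1_on_continuous_pd[OF f] C1_on_continuous[OF T] UV])
  moreover have "pd f w (T x) = (\<Sum>i\<in>Basis. (w \<bullet> i) *\<^sub>R pd f i (T x))" if "x \<in> U" for x w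
    by (rule linear_component_sum)
      (rule has_derivative_linear[OF C1_on_has_derivative[OF f]], use UV that in auto)
  ultimately show "continuous_on U (\<lambda>x. pd f (pd T v x) (T x))" for v
    by (simp cong: continuous_on_cong)
qed

text \<open>At a zero of \<open>h\<close> the product rule loses the term with the derivative of
  \<open>f\<close>, so continuity of \<open>f\<close> is enough. In \<open>dual_vector_C1\<close>
  the role of \<open>f\<close> falls to a component of a vector not yet known to be
  differentiable.\<close>

lemma has_derivative_mult_vanishing:
  fixes f h :: "'b::real_normed_vector \<Rightarrow> real"
  assumes f: "isCont f a" and h: "(h has_derivative h') (at a)" and h0: "h a = 0"
  shows "((\<lambda>y. f y * h y) has_derivative (\<lambda>v. f a * h' v)) (at a)"
proof -
  have bl: "bounded_linear h'" using h by (rule has_derivative_bounded_linear)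
  have bl2: "bounded_linear (\<lambda>v. f a * h' v)" using bl by (rule bounded_linear_const_mult)
  have lim: "((\<lambda>y. norm (h y - h a - h' (y - a)) / norm (y - a)) \<longlongrightarrow> 0) (at a)"
    using h by (simp add: has_derivative_iff_norm)
  have fl: "(f \<longlongrightarrow> f a) (at a)" using f by (simp add: isCont_def)
  have "((\<lambda>y. norm (f y * h y - f a * h a - f a * h' (y - a)) / norm (y - a)) \<longlongrightarrow> 0) (at a)"
  proof (rule tendsto_sandwich[where f = "\<lambda>_. 0"
        and h = "\<lambda>y. \<bar>f y\<bar> * (norm (h y - h a - h' (y - a)) / norm (y - a)) + \<bar>f y - f a\<bar> * onorm h'"])
    show "\<forall>\<^sub>F y in at a. norm (f y * h y - f a * h a - f a * h' (y - a)) / norm (y - a)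
        \<le> \<bar>f y\<bar> * (norm (h y - h a - h' (y - a)) / norm (y - a)) + \<bar>f y - f a\<bar> * onorm h'"
      unfolding eventually_at_filter
    proof (rule always_eventually, intro allI impI)
      fix y assume "y \<noteq> a"
      then have p: "norm (y - a) > 0" by simp
      have "\<bar>f y * h y - f a * h' (y - a)\<bar> = \<bar>f y * (h y - h' (y - a)) + (f y - f a) * h' (y - a)\<bar>"
        by (simp add: algebra_simps)
      also have "\<dots> \<le> \<bar>f y\<bar> * \<bar>h y - h' (y - a)\<bar> + \<bar>f y - f a\<bar> * \<bar>h' (y - a)\<bar>"
        by (metis abs_mult abs_triangle_ineq)
      also have "\<dots> \<le> \<bar>f y\<bar> * \<bar>h y - h' (y - a)\<bar> + \<bar>f y - f a\<bar> * (onorm h' * norm (y - a))"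
        using onorm[OF bl, of "y - a"] by (intro add_left_mono mult_left_mono) auto
      finally show "norm (f y * h y - f a * h a - f a * h' (y - a)) / norm (y - a)
        \<le> \<bar>f y\<bar> * (norm (h y - h a - h' (y - a)) / norm (y - a)) + \<bar>f y - f a\<bar> * onorm h'"
        using p h0 by (simp add: field_simps)
    qed
    have "((\<lambda>y. \<bar>f y\<bar> * (norm (h y - h a - h' (y - a)) / norm (y - a)) + \<bar>f y - f a\<bar> * onorm h')
        \<longlongrightarrow> \<bar>f a\<bar> * 0 + \<bar>f a - f a\<bar> * onorm h') (at a)"
      by (intro tendsto_intros lim fl)
    then show "((\<lambda>y. \<bar>f y\<bar> * (norm (h y - h a - h' (y - a)) / norm (y - a)) + \<bar>f y - f a\<bar> * onorm h')
        \<longlongrightarrow> 0) (at a)" by simp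
  qed auto
  then show ?thesis using bl2 by (simp add: has_derivative_iff_norm)
qed

text \<open>Riesz representation. The map \<open>F\<close>, which collects the values of
  \<open>B w\<close> on the basis, is injective by positivity and hence onto by dimension.\<close>

lemma posdef_solve:
  fixes B :: "'b::euclidean_space \<Rightarrow> 'b \<Rightarrow> real"
  assumes B: "bilinear B" and pos: "\<And>v. v \<noteq> 0 \<Longrightarrow> B v v > 0" and l: "linear l"
  shows "\<exists>!w. \<forall>v. B w v = l v"
proof -
  define F where "F w = (\<Sum>i\<in>Basis. B w i *\<^sub>R i)" for w
  have lin: "linear (B w)" "linear (\<lambda>w. B w v)" for v w
    using B by (auto simp: bilinear_def)
  have "linear F"
    by (rule linearI)
      (simp_all add: F_def bilinear_ladd[OF B] bilinear_lmul[OF B] scaleR_left_distrib sum.distrib scaleR_right.sum)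
  have Fi: "F w \<bullet> i = B w i" if "i \<in> Basis" for w i
    using that by (simp add: F_def)
  have eq: "B w v = (\<Sum>i\<in>Basis. (v \<bullet> i) *\<^sub>R B w i)" for v w
    by (rule linear_component_sum[OF lin(1)])
  have inj: "inj F"
  proof (subst linear_injective_0[OF \<open>linear F\<close>], intro allI impI)
    fix w assume "F w = 0"
    then have "B w w = 0" using eq[of w w] Fi[symmetric, of _ w] by simp
    then show "w = 0" using pos by force
  qed
  then have "surj F" using \<open>linear F\<close> by (simp add: linear_injective_imp_surjective)
  then obtain w where w: "F w = (\<Sum>i\<in>Basis. l i *\<^sub>R i)" by (metis surjD)
  have "B w i = l i" if "i \<in> Basis" for i
    using Fi[OF that, of w] that by (simp add: w)
  then have "B w v = l v" for v
    using eq[of w v] linear_component_sum[OF l, of v] by simp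
  moreover have "w' = w" if "\<forall>v. B w' v = l v" for w'
  proof -
    have "F w' = F w" unfolding F_def using that \<open>\<And>v. B w v = l v\<close> by simp
    then show ?thesis using inj by (simp add: inj_eq)
  qed
  ultimately show ?thesis by blast
qed

text \<open>\<open>l\<close> is the minimum of the quadratic form on the compact unit sphere;
  homogeneity does the rest.\<close>

lemma posdef_coercive:
  fixes B :: "'b::euclidean_space \<Rightarrow> 'b \<Rightarrow> real"
  assumes B: "bilinear B" and pos: "\<And>v. v \<noteq> 0 \<Longrightarrow> B v v > 0"
  obtains l where "l > 0" "\<And>v. B v v \<ge> l * (norm v)\<^sup>2"
proof -
  have "(\<lambda>v. B v v) = (\<lambda>v. \<Sum>i\<in>Basis. \<Sum>j\<in>Basis. (v \<bullet> i) * (v \<bullet> j) * B i j)"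
    by (rule ext) (rule bilinear_expand[OF B])
  moreover have "continuous_on (sphere 0 1) (\<lambda>v. \<Sum>i\<in>Basis. \<Sum>j\<in>Basis. (v \<bullet> i) * (v \<bullet> j) * B i j)"
    by (intro continuous_intros)
  ultimately have "continuous_on (sphere 0 1) (\<lambda>v. B v v)" by metis
  moreover have "sphere (0::'b) 1 \<noteq> {}" by (simp add: sphere_eq_empty)
  ultimately have "\<exists>x\<in>sphere 0 1. \<forall>y\<in>sphere 0 1. B x x \<le> B y y"
    using continuous_attains_inf[OF compact_sphere, of 0 1 "\<lambda>v. B v v"] by blast
  then obtain v0 where v0: "v0 \<in> sphere 0 1" "\<And>v. v \<in> sphere 0 1 \<Longrightarrow> B v0 v0 \<le> B v v"
    by blast
  have "B v v \<ge> B v0 v0 * (norm v)\<^sup>2" for v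
  proof (cases "v = 0")
    case True
    then show ?thesis by (simp add: bilinear_lzero[OF B])
  next
    case False
    have "B v v = B (norm v *\<^sub>R (v /\<^sub>R norm v)) (norm v *\<^sub>R (v /\<^sub>R norm v))"
      using False by simp
    also have "\<dots> = (norm v)\<^sup>2 * B (v /\<^sub>R norm v) (v /\<^sub>R norm v)"
      unfolding bilinear_lmul[OF B] bilinear_rmul[OF B] by (simp add: power2_eq_square)
    also have "\<dots> \<ge> (norm v)\<^sup>2 * B v0 v0"
      by (intro mult_left_mono v0) (use False in auto)
    finally show ?thesis by (simp add: mult.commute)
  qed
  moreover have "B v0 v0 > 0" using v0(1) by (intro pos) auto
  ultimately show ?thesis using that by blast
qed

text \<open>The difference \<open>w y - w a\<close> is linear in \<open>G y - G a\<close> with coefficients built from \<open>w y\<close> and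
  \<open>w a\<close>, so continuity of \<open>w\<close> already gives its differentiability.\<close>

lemma dual_vector_C1:
  fixes G :: "'b::euclidean_space \<Rightarrow> 'b \<Rightarrow> 'b \<Rightarrow> real" and w :: "'b \<Rightarrow> 'b \<Rightarrow> 'b"
  assumes S: "open S" and B: "\<And>y. y \<in> S \<Longrightarrow> bilinear (G y)"
    and sym: "\<And>y v v'. y \<in> S \<Longrightarrow> G y v v' = G y v' v"
    and pos: "\<And>y v. y \<in> S \<Longrightarrow> v \<noteq> 0 \<Longrightarrow> G y v v > 0"
    and C1: "\<And>v v'. C1_on S (\<lambda>y. G y v v')"
    and w: "\<And>y i v. y \<in> S \<Longrightarrow> G y (w y i) v = v \<bullet> i"
  shows "C1_on S (\<lambda>y. w y i \<bullet> j)"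
proof -
  have cont: "isCont (\<lambda>y. w y i) a" if a: "a \<in> S" for a i
  proof -
    obtain l where l: "l > 0" "\<And>v. G a v v \<ge> l * (norm v)\<^sup>2"
      using posdef_coercive[OF B[OF a] pos[OF a]] by blast
    \<comment> \<open>The entrywise distance between the forms at \<open>y\<close> and
      \<open>a\<close>; it dominates their difference on \<open>v\<close> and \<open>v'\<close> up
      to the factor \<open>norm v * norm v'\<close>.\<close>
    define e where "e y = (\<Sum>p\<in>Basis. \<Sum>q\<in>Basis. \<bar>G y p q - G a p q\<bar>)" for y
    have e0: "(e \<longlongrightarrow> 0) (at a)"
    proof -
      have "isCont (\<lambda>y. G y p q) a" for p q
        using C1_on_continuous[OF C1, of p q] S a by (simp add: continuous_on_eq_continuous_at)
      then have "((\<lambda>y. G y p q) \<longlongrightarrow> G a p q) (at a)" for p q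
        unfolding isCont_def .
      then have "(e \<longlongrightarrow> (\<Sum>p\<in>(Basis::'b set). \<Sum>q\<in>(Basis::'b set). \<bar>G a p q - G a p q\<bar>)) (at a)"
        unfolding e_def[abs_def] by (intro tendsto_intros)
      then show ?thesis by simp
    qed
    have diff: "\<bar>G y v v' - G a v v'\<bar> \<le> e y * norm v * norm v'" if "y \<in> S" for y v v'
    proof -
      have "\<bar>G y v v' - G a v v'\<bar> = \<bar>\<Sum>p\<in>Basis. \<Sum>q\<in>Basis. (v \<bullet> p) * (v' \<bullet> q) * (G y p q - G a p q)\<bar>"
        by (simp only: bilinear_expand[OF B[OF that], of v v'] bilinear_expand[OF B[OF a], of v v'])
          (simp add: sum_subtractf right_diff_distrib)
      also have "\<dots> \<le> (\<Sum>p\<in>Basis. \<Sum>q\<in>Basis. \<bar>(v \<bullet> p) * (v' \<bullet> q) * (G y p q - G a p q)\<bar>)"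
        by (rule order.trans[OF sum_abs]) (intro sum_mono sum_abs)
      also have "\<dots> \<le> (\<Sum>p\<in>Basis. \<Sum>q\<in>Basis. norm v * norm v' * \<bar>G y p q - G a p q\<bar>)"
        unfolding abs_mult
        by (intro sum_mono mult_right_mono mult_mono) (auto intro: Basis_le_norm)
      also have "\<dots> = e y * norm v * norm v'"
        by (simp add: e_def sum_distrib_left[symmetric] mult_ac)
      finally show ?thesis .
    qed
    \<comment> \<open>Once \<open>e y < l / 2\<close>, the form \<open>G y\<close> is coercive with
      constant \<open>l / 2\<close>. This bounds \<open>w y i\<close> uniformly near
      \<open>a\<close>, before any continuity is known.\<close>
    have ev: "\<forall>\<^sub>F y in at a. y \<in> S \<and> e y < l / 2"
      using order_tendstoD(2)[OF e0, of "l / 2"] l(1) eventually_at_topological[of "\<lambda>y. y \<in> S" a UNIV] S a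
      by (auto simp: eventually_conj_iff)
    have "\<forall>\<^sub>F y in at a. norm (w y i - w a i) \<le> e y * (2 * norm i / l / l)"
      using ev
    proof eventually_elim
      case (elim y)
      then have y: "y \<in> S" and ey: "e y < l / 2" by auto
      have ege: "e y \<ge> 0" unfolding e_def by (intro sum_nonneg) auto
      have "l * (norm (w y i))\<^sup>2 \<le> G y (w y i) (w y i) + e y * norm (w y i) * norm (w y i)"
        using l(2)[of "w y i"] diff[OF y, of "w y i" "w y i"] by linarith
      also have "\<dots> \<le> norm (w y i) * norm i + l / 2 * (norm (w y i) * norm (w y i))"
        unfolding w[OF y] mult.assoc using ey
        by (intro add_mono mult_right_mono norm_cauchy_schwarz) auto
      finally have "l / 2 * (norm (w y i))\<^sup>2 \<le> norm i * norm (w y i)"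
        by (simp add: power2_eq_square algebra_simps)
      then have wb: "norm (w y i) \<le> 2 * norm i / l"
        using l(1) by (cases "norm (w y i) = 0") (auto simp: power2_eq_square field_simps)
      define d where "d = w y i - w a i"
      have "l * (norm d)\<^sup>2 \<le> G a d d" by (rule l)
      also have "\<dots> = G a (w y i) d - G y (w y i) d"
        unfolding w[OF y] by (simp add: d_def bilinear_lsub[OF B[OF a]] w[OF a] inner_diff_left)
      also have "\<dots> \<le> e y * norm (w y i) * norm d"
        using diff[OF y, of "w y i" d] by linarith
      also have "\<dots> \<le> e y * (2 * norm i / l) * norm d"
        using wb ege by (intro mult_right_mono mult_left_mono) auto
      finally have "l * norm d \<le> e y * (2 * norm i / l)"
        using ege l(1) by (cases "norm d = 0") (auto simp: power2_eq_square field_simps)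
      then show "norm (w y i - w a i) \<le> e y * (2 * norm i / l / l)"
        using l(1) by (simp add: d_def field_simps)
    qed
    moreover have "((\<lambda>y. e y * (2 * norm i / l / l)) \<longlongrightarrow> 0) (at a)"
      by (rule tendsto_mult_left_zero[OF e0])
    ultimately have "((\<lambda>y. w y i - w a i) \<longlongrightarrow> 0) (at a)"
      by (rule Lim_null_comparison)
    then show ?thesis
      unfolding isCont_def by (rule LIM_zero_cancel)
  qed
  have contS: "continuous_on S (\<lambda>y. w y i)" for i
    using cont by (simp add: continuous_at_imp_continuous_on)
  show ?thesis
  proof (rule C1_onI[where f' = "\<lambda>a v. - (\<Sum>p\<in>Basis. \<Sum>q\<in>Basis.
        (w a i \<bullet> p) * ((w a j \<bullet> q) * pd (\<lambda>y. G y p q) v a))"])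
    fix a assume a: "a \<in> S"
    \<comment> \<open>The resolvent identity for the two inverse matrices in bilinear form. Symmetry
      of \<open>G a\<close> allows \<open>j\<close> to be represented by
      \<open>w a j\<close>.\<close>
    have eq: "w a i \<bullet> j - (\<Sum>p\<in>Basis. \<Sum>q\<in>Basis. (w y i \<bullet> p) * ((w a j \<bullet> q) * (G y p q - G a p q))) = w y i \<bullet> j"
      if y: "y \<in> S" for y
    proof -
      have "w y i \<bullet> j = G a (w y i) (w a j)" using w[OF a, of j "w y i"] sym[OF a] by metis
      moreover have "G y (w y i) (w a j) = G a (w a i) (w a j)" by (simp add: w[OF y] w[OF a])
      moreover have "G a (w a i) (w a j) = w a i \<bullet> j"
        using w[OF a, of j "w a i"] sym[OF a] by metis
      moreover have "G y (w y i) (w a j) - G a (w y i) (w a j) =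
          (\<Sum>p\<in>Basis. \<Sum>q\<in>Basis. (w y i \<bullet> p) * ((w a j \<bullet> q) * (G y p q - G a p q)))"
        by (simp only: bilinear_expand[OF B[OF y], of "w y i" "w a j"] bilinear_expand[OF B[OF a], of "w y i" "w a j"])
          (simp add: sum_subtractf right_diff_distrib mult.assoc)
      ultimately show ?thesis by linarith
    qed
    have d: "((\<lambda>y. (w y i \<bullet> p) * ((w a j \<bullet> q) * (G y p q - G a p q))) has_derivative
        (\<lambda>v. (w a i \<bullet> p) * ((w a j \<bullet> q) * pd (\<lambda>y. G y p q) v a))) (at a)" for p q
    proof (rule has_derivative_mult_vanishing)
      show "isCont (\<lambda>y. w y i \<bullet> p) a" using cont[OF a, of i] by (intro continuous_intros)
      have "((\<lambda>y. (w a j \<bullet> q) * (G y p q - G a p q)) has_derivative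
        (\<lambda>v. (w a j \<bullet> q) * (pd (\<lambda>y. G y p q) v a - 0))) (at a)"
        by (intro has_derivative_mult_right has_derivative_diff C1_on_has_derivative[OF C1 a] has_derivative_const)
      then show "((\<lambda>y. (w a j \<bullet> q) * (G y p q - G a p q)) has_derivative
        (\<lambda>v. (w a j \<bullet> q) * pd (\<lambda>y. G y p q) v a)) (at a)" by simp
    qed simp
    have "((\<lambda>y. w a i \<bullet> j - (\<Sum>p\<in>Basis. \<Sum>q\<in>Basis. (w y i \<bullet> p) * ((w a j \<bullet> q) * (G y p q - G a p q))))
        has_derivative (\<lambda>v. 0 - (\<Sum>p\<in>Basis. \<Sum>q\<in>Basis.
        (w a i \<bullet> p) * ((w a j \<bullet> q) * pd (\<lambda>y. G y p q) v a)))) (at a)"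
      by (intro has_derivative_diff has_derivative_const has_derivative_sum d)
    then have "((\<lambda>y. w y i \<bullet> j) has_derivative (\<lambda>v. 0 - (\<Sum>p\<in>Basis. \<Sum>q\<in>Basis.
        (w a i \<bullet> p) * ((w a j \<bullet> q) * pd (\<lambda>y. G y p q) v a)))) (at a)"
      by (rule has_derivative_transform_within_open[OF _ S a]) (rule eq)
    then show "((\<lambda>y. w y i \<bullet> j) has_derivative (\<lambda>v. - (\<Sum>p\<in>Basis. \<Sum>q\<in>Basis.
        (w a i \<bullet> p) * ((w a j \<bullet> q) * pd (\<lambda>y. G y p q) v a)))) (at a)" by simp
  qed (intro continuous_intros contS C1_on_continuous_pd C1)
qed

section \<open>Gradient and Laplacian in charts\<close>

declare Ck_on.simps(2) [simp del]

text \<open>For basis vectors, \<open>chart_dual c y i \<bullet> j\<close> is the entry g^{ij} of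
  the inverse metric.\<close>

definition chart_dual :: "('a, 'b::euclidean_space) rchart \<Rightarrow> 'b \<Rightarrow> 'b \<Rightarrow> 'b" where
  "chart_dual c y i = (THE w. \<forall>v. chart_metric c y w v = v \<bullet> i)"

text \<open>The metric product of the two gradients, in the form dg(grad f), in which only one
  gradient has to be computed.\<close>

definition chart_inner ::
  "('a, 'b::euclidean_space) rchart \<Rightarrow> ('a \<Rightarrow> real) \<Rightarrow> ('a \<Rightarrow> real) \<Rightarrow> 'b \<Rightarrow> real" where
  "chart_inner c f g y = pd (g \<circ> chart_inv c) (chart_grad c f y) y"

abbreviation chart_integrand :: "('a, 'b::euclidean_space) rchart \<Rightarrow> ('a \<Rightarrow> real) \<Rightarrow> 'b \<Rightarrow> real" where
  "chart_integrand c F \<equiv> (\<lambda>y. if y \<in> chart_img c then F (chart_inv c y) * vol_density c y else 0)"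

definition chart_integral :: "('a, 'b::euclidean_space) rchart \<Rightarrow> ('a \<Rightarrow> real) \<Rightarrow> real" where
  "chart_integral c F = integral UNIV (chart_integrand c F)"

context riemannian_manifold
begin

lemma chart_inv_map: "c \<in> A \<Longrightarrow> x \<in> chart_dom c \<Longrightarrow> chart_inv c (chart_map c x) = x"
  and chart_map_inv: "c \<in> A \<Longrightarrow> y \<in> chart_img c \<Longrightarrow> chart_map c (chart_inv c y) = y"
  and chart_map_img: "c \<in> A \<Longrightarrow> x \<in> chart_dom c \<Longrightarrow> chart_map c x \<in> chart_img c"
  and chart_inv_dom: "c \<in> A \<Longrightarrow> y \<in> chart_img c \<Longrightarrow> chart_inv c y \<in> chart_dom c"
  using chart_homeo[of c] by (auto simp: homeomorphism_def chart_img_def)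

lemma chart_map_continuous: "c \<in> A \<Longrightarrow> continuous_on (chart_dom c) (chart_map c)"
  and chart_inv_continuous: "c \<in> A \<Longrightarrow> continuous_on (chart_img c) (chart_inv c)"
  using chart_homeo[of c] by (auto simp: homeomorphism_def)

lemma dom_subset: "c \<in> A \<Longrightarrow> chart_dom c \<subseteq> M"
  using cover by auto

lemma chart_img_M: "c \<in> A \<Longrightarrow> chart_map c ` (chart_dom c \<inter> M) = chart_img c"
  using dom_subset[of c] by (simp add: chart_img_def Int_absorb2)

lemma chart_grad_metric:
  assumes c: "c \<in> A" "y \<in> chart_img c" and f: "(f \<circ> chart_inv c) differentiable (at y)"
  shows "chart_metric c y (chart_grad c f y) v = pd (f \<circ> chart_inv c) v y"
proof -
  have "linear (frechet_derivative (f \<circ> chart_inv c) (at y))"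
    using f by (simp add: frechet_derivative_works has_derivative_linear)
  from theI'[OF posdef_solve[OF metric_bilinear[OF c] metric_pos[OF c] this]]
  show ?thesis by (simp add: chart_grad_def)
qed

lemma chart_grad_unique:
  assumes c: "c \<in> A" "y \<in> chart_img c" and f: "(f \<circ> chart_inv c) differentiable (at y)"
    and w: "\<And>v. chart_metric c y w v = pd (f \<circ> chart_inv c) v y"
  shows "chart_grad c f y = w"
proof -
  have "linear (frechet_derivative (f \<circ> chart_inv c) (at y))"
    using f by (simp add: frechet_derivative_works has_derivative_linear)
  from posdef_solve[OF metric_bilinear[OF c] metric_pos[OF c] this]
  show ?thesis using chart_grad_metric[OF c f] w by blast
qed

lemma chart_dual_metric:
  assumes c: "c \<in> A" "y \<in> chart_img c"
  shows "chart_metric c y (chart_dual c y i) v = v \<bullet> i"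
proof -
  have "linear (\<lambda>v. v \<bullet> i)" by (rule linearI) (auto simp: inner_add_left)
  from theI'[OF posdef_solve[OF metric_bilinear[OF c] metric_pos[OF c] this]]
  show ?thesis by (simp add: chart_dual_def)
qed

lemma metric_C1: "c \<in> A \<Longrightarrow> C1_on (chart_img c) (\<lambda>y. chart_metric c y v w)"
  using metric_smooth[of c v w] by (simp add: smooth_on_def)

lemma chart_dual_C1: "c \<in> A \<Longrightarrow> C1_on (chart_img c) (\<lambda>y. chart_dual c y i \<bullet> j)"
  by (rule dual_vector_C1[where G = "chart_metric c"])
    (assumption | rule img_open metric_bilinear metric_sym metric_pos metric_C1 chart_dual_metric)+

text \<open>Raising the index with the inverse metric; the gradient inherits its regularity from
  \<open>chart_dual\<close> through this formula.\<close>

lemma chart_grad_eq: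
  assumes c: "c \<in> A" "y \<in> chart_img c" and f: "(f \<circ> chart_inv c) differentiable (at y)"
  shows "chart_grad c f y = (\<Sum>i\<in>Basis. pd (f \<circ> chart_inv c) i y *\<^sub>R chart_dual c y i)"
proof (rule chart_grad_unique[OF c f])
  fix v
  have "linear (\<lambda>w. chart_metric c y w v)" using metric_bilinear[OF c] by (simp add: bilinear_def)
  then have "chart_metric c y (\<Sum>i\<in>Basis. pd (f \<circ> chart_inv c) i y *\<^sub>R chart_dual c y i) v =
      (\<Sum>i\<in>Basis. pd (f \<circ> chart_inv c) i y * (v \<bullet> i))"
    using linear_sum[of "\<lambda>w. chart_metric c y w v" _ "Basis :: 'b set"] linear_cmul[of "\<lambda>w. chart_metric c y w v"]
    by (simp add: chart_dual_metric[OF c])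
  also have "\<dots> = (\<Sum>i\<in>Basis. (v \<bullet> i) *\<^sub>R pd (f \<circ> chart_inv c) i y)"
    by (simp add: mult.commute)
  also have "\<dots> = pd (f \<circ> chart_inv c) v y"
    by (rule linear_component_sum[symmetric])
      (use f in \<open>simp add: frechet_derivative_works has_derivative_linear\<close>)
  finally show "chart_metric c y (\<Sum>i\<in>Basis. pd (f \<circ> chart_inv c) i y *\<^sub>R chart_dual c y i) v =
      pd (f \<circ> chart_inv c) v y" .
qed

lemma chart_inner_eq:
  assumes c: "c \<in> A" "y \<in> chart_img c" and f: "(f \<circ> chart_inv c) differentiable (at y)"
    and g: "(g \<circ> chart_inv c) differentiable (at y)"
  shows "chart_inner c f g y = (\<Sum>i\<in>Basis. \<Sum>j\<in>Basis.
    pd (f \<circ> chart_inv c) i y * pd (g \<circ> chart_inv c) j y * (chart_dual c y i \<bullet> j))"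
proof -
  have "chart_inner c f g y = (\<Sum>j\<in>Basis. (chart_grad c f y \<bullet> j) *\<^sub>R pd (g \<circ> chart_inv c) j y)"
    unfolding chart_inner_def
    by (rule linear_component_sum) (use g in \<open>simp add: frechet_derivative_works has_derivative_linear\<close>)
  also have "\<dots> = (\<Sum>j\<in>Basis. \<Sum>i\<in>Basis.
    pd (f \<circ> chart_inv c) i y * pd (g \<circ> chart_inv c) j y * (chart_dual c y i \<bullet> j))"
    by (simp add: chart_grad_eq[OF c f] inner_sum_left sum_distrib_right sum_distrib_left mult_ac)
  finally show ?thesis by (subst sum.swap)
qed

lemma chart_inner_metric:
  assumes c: "c \<in> A" "y \<in> chart_img c" and f: "(f \<circ> chart_inv c) differentiable (at y)"
    and g: "(g \<circ> chart_inv c) differentiable (at y)"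
  shows "chart_inner c f g y = chart_metric c y (chart_grad c f y) (chart_grad c g y)"
  unfolding chart_inner_def chart_grad_metric[OF c g, symmetric] by (rule metric_sym[OF c])

lemma vol_density_pos:
  assumes "c \<in> A" "y \<in> chart_img c"
  shows "vol_density c y > 0"
  using gram_det_pos[OF metric_bilinear[OF assms] metric_pos[OF assms]] by (simp add: vol_density_def)

lemma vol_density_C1:
  assumes c: "c \<in> A"
  shows "C1_on (chart_img c) (vol_density c)"
  unfolding vol_density_def[abs_def]
proof (rule C1_on_real_compose[where h = sqrt and f = "\<lambda>y. gram_det (chart_metric c y)"
      and h' = "\<lambda>x. inverse (sqrt x) / 2"])
  show C1: "C1_on (chart_img c) (\<lambda>y. gram_det (chart_metric c y))"
    unfolding gram_det_def
    by (intro C1_on_sum C1_on_mult C1_on_const C1_on_prod metric_C1 c)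
  have pos: "gram_det (chart_metric c y) > 0" if "y \<in> chart_img c" for y
    using gram_det_pos[OF metric_bilinear[OF c that] metric_pos[OF c that]] .
  show "(sqrt has_real_derivative inverse (sqrt (gram_det (chart_metric c y))) / 2)
      (at (gram_det (chart_metric c y)))" if "y \<in> chart_img c" for y
    by (rule DERIV_real_sqrt) (rule pos[OF that])
  show "continuous_on (chart_img c) (\<lambda>y. inverse (sqrt (gram_det (chart_metric c y))) / 2)"
    using pos by (intro continuous_intros C1_on_continuous[OF C1]) (auto simp: less_imp_neq[symmetric])
qed

lemma chart_grad_C1:
  assumes c: "c \<in> A" and f: "C2_on (chart_img c) (f \<circ> chart_inv c)"
  shows "C1_on (chart_img c) (\<lambda>y. chart_grad c f y \<bullet> j)"
proof (rule Ck_on_cong_open[OF img_open[OF c]])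
  show "(\<Sum>i\<in>Basis. pd (f \<circ> chart_inv c) i y * (chart_dual c y i \<bullet> j)) = chart_grad c f y \<bullet> j"
    if "y \<in> chart_img c" for y
    using f that by (subst chart_grad_eq[OF c that]) (auto simp: Ck_on.simps(2) inner_sum_left)
  show "C1_on (chart_img c) (\<lambda>y. \<Sum>i\<in>Basis. pd (f \<circ> chart_inv c) i y * (chart_dual c y i \<bullet> j))"
    using f by (intro C1_on_sum C1_on_mult chart_dual_C1 c) (simp add: Ck_on.simps(2)[of "Suc 0"])
qed

lemma C2_vol_grad_C1:
  assumes c: "c \<in> A" and f: "C2_on (chart_img c) (f \<circ> chart_inv c)"
  shows "C1_on (chart_img c) (\<lambda>y. vol_density c y * (chart_grad c f y \<bullet> j))"
  by (intro C1_on_mult vol_density_C1 chart_grad_C1 assms)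

lemma chart_laplacian_continuous:
  assumes c: "c \<in> A" and f: "C2_on (chart_img c) (f \<circ> chart_inv c)"
  shows "continuous_on (chart_img c) (chart_div c (chart_grad c f))"
  unfolding chart_div_def
  by (intro continuous_intros C1_on_continuous_pd C2_vol_grad_C1 C1_on_continuous[OF vol_density_C1] assms)
    (use vol_density_pos[OF c] in \<open>auto simp: less_imp_neq[symmetric]\<close>)

lemma chart_inner_continuous:
  assumes c: "c \<in> A" and f: "C1_on (chart_img c) (f \<circ> chart_inv c)"
    and g: "C1_on (chart_img c) (g \<circ> chart_inv c)"
  shows "continuous_on (chart_img c) (chart_inner c f g)"
proof (rule continuous_on_eq)
  show "continuous_on (chart_img c) (\<lambda>y. \<Sum>i\<in>Basis. \<Sum>j\<in>Basis.
    pd (f \<circ> chart_inv c) i y * pd (g \<circ> chart_inv c) j y * (chart_dual c y i \<bullet> j))"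
    by (intro continuous_intros C1_on_continuous_pd f g C1_on_continuous[OF chart_dual_C1] c)
qed (use f g in \<open>auto simp: Ck_on.simps(2) chart_inner_eq[OF c]\<close>)

text \<open>The vector field \<open>\<phi>\<close> times density times gradient, extended by zero,
  has C1 components \<open>Z j\<close> of compact support, so each derivative
  \<open>Z' j y j\<close> integrates to 0. The product rule splits their sum into the divergence
  term and the gradient term.\<close>

lemma chart_green:
  assumes c: "c \<in> A" and f: "C2_on (chart_img c) (f \<circ> chart_inv c)"
    and \<phi>: "C1_on (chart_img c) (\<phi> \<circ> chart_inv c)"
    and K: "compact K" "K \<subseteq> chart_img c" "\<And>y. y \<in> chart_img c \<Longrightarrow> y \<notin> K \<Longrightarrow> \<phi> (chart_inv c y) = 0"
  shows "integral UNIV (\<lambda>y. if y \<in> chart_img c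
      then \<phi> (chart_inv c y) * chart_div c (chart_grad c f) y * vol_density c y else 0) =
    - integral UNIV (\<lambda>y. if y \<in> chart_img c then chart_inner c f \<phi> y * vol_density c y else 0)"
    (is "integral UNIV ?L = - integral UNIV ?R")
proof -
  let ?S = "chart_img c" and ?p = "\<phi> \<circ> chart_inv c"
  let ?W = "\<lambda>j y. vol_density c y * (chart_grad c f y \<bullet> j)"
  note S = img_open[OF c]
  have W: "C1_on ?S (?W j)" for j by (rule C2_vol_grad_C1[OF c f])
  \<comment> \<open>Off \<open>K\<close> the test function is 0 near each point, so its derivative
    vanishes too and the gradient integrand is also supported in \<open>K\<close>.\<close>
  have pd0: "pd ?p v y = 0" if "y \<in> ?S" "y \<notin> K" for v y
  proof -
    have "(?p has_derivative (\<lambda>h. 0)) (at y)"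
      by (rule has_derivative_transform_within_open[of "\<lambda>_. 0" _ _ _ "?S - K"])
        (use that K S in \<open>auto simp: open_Diff compact_imp_closed\<close>)
    from frechet_derivative_at[OF this] show ?thesis by metis
  qed
  define Z where "Z j y = (if y \<in> ?S then ?p y * ?W j y else 0)" for j y
  define Z' where "Z' j y v = (if y \<in> ?S then ?p y * pd (?W j) v y + pd ?p v y * ?W j y else 0)" for j y v
  have Z: "(Z j has_derivative Z' j y) (at y)" for j y
  proof (cases "y \<in> ?S")
    case True
    have "((\<lambda>y. ?p y * ?W j y) has_derivative (\<lambda>v. ?p y * pd (?W j) v y + pd ?p v y * ?W j y)) (at y)"
      by (intro has_derivative_mult C1_on_has_derivative[OF \<phi> True] C1_on_has_derivative[OF W True])
    then have "(Z j has_derivative (\<lambda>v. ?p y * pd (?W j) v y + pd ?p v y * ?W j y)) (at y)"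
      by (rule has_derivative_transform_within_open[OF _ S True]) (simp add: Z_def)
    then show ?thesis using True by (simp add: Z'_def[abs_def])
  next
    case False
    have "(Z j has_derivative (\<lambda>h. 0)) (at y)"
      by (rule has_derivative_transform_within_open[of "\<lambda>_. 0" _ _ _ "- K"])
        (use False K in \<open>auto simp: open_Compl compact_imp_closed Z_def\<close>)
    then show ?thesis using False by (simp add: Z'_def[abs_def])
  qed
  have cs: "compact_supp ?S (\<lambda>y. if y \<in> ?S then ?p y * pd (?W j) v y + pd ?p v y * ?W j y else 0)" for j v
    using K pd0
    by (intro compact_supp_extend[OF S _ K(1,2)] continuous_intros C1_on_continuous_pd
        C1_on_continuous[OF W] W \<phi> C1_on_continuous[OF \<phi>]) auto
  have int0: "integral UNIV (\<lambda>y. Z' j y j) = 0" for j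
  proof (rule integral_derivative_eq_0[OF K(1) _ Z])
    show "Z j y = 0" if "y \<notin> K" for y using that K by (auto simp: Z_def)
    show "continuous_on UNIV (\<lambda>y. Z' j y j)" using cs[of j j] by (simp add: Z'_def compact_supp_def)
  qed
  have csL: "compact_supp ?S ?L"
    using K by (intro compact_supp_extend[OF S _ K(1,2)] continuous_intros
        C1_on_continuous[OF \<phi>, unfolded o_def] C1_on_continuous[OF vol_density_C1[OF c]]
        chart_laplacian_continuous[OF c f]) auto
  have csR: "compact_supp ?S ?R"
  proof (intro compact_supp_extend[OF S _ K(1,2)] continuous_intros C1_on_continuous[OF vol_density_C1[OF c]]
      chart_inner_continuous[OF c] \<phi> Ck_on_Suc_D[OF f])
    show "chart_inner c f \<phi> y * vol_density c y = 0" if "y \<in> ?S" "y \<notin> K" for y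
      using pd0[OF that] by (simp add: chart_inner_def)
  qed
  have "(\<Sum>j\<in>Basis. Z' j y j) = ?L y + ?R y" for y
  proof (cases "y \<in> ?S")
    case True
    have dp: "?p differentiable (at y)" using \<phi> True by (simp add: Ck_on.simps(2))
    have "chart_inner c f \<phi> y = (\<Sum>j\<in>Basis. (chart_grad c f y \<bullet> j) *\<^sub>R pd ?p j y)"
      unfolding chart_inner_def
      by (rule linear_component_sum) (use dp in \<open>simp add: frechet_derivative_works has_derivative_linear\<close>)
    moreover have "chart_div c (chart_grad c f) y * vol_density c y = (\<Sum>j\<in>Basis. pd (?W j) j y)"
      using vol_density_pos[OF c True] by (simp add: chart_div_def)
    moreover have "(\<Sum>j\<in>Basis. Z' j y j) =
        ?p y * (\<Sum>j\<in>Basis. pd (?W j) j y) + (\<Sum>j\<in>Basis. (chart_grad c f y \<bullet> j) *\<^sub>R pd ?p j y) * vol_density c y"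
      using True by (simp add: Z'_def sum.distrib sum_distrib_left sum_distrib_right mult_ac)
    ultimately show ?thesis using True by simp
  qed (simp add: Z'_def)
  then have "integral UNIV (\<lambda>y. ?L y + ?R y) = integral UNIV (\<lambda>y. \<Sum>j\<in>Basis. Z' j y j)" by simp
  also have "\<dots> = (\<Sum>j\<in>Basis. integral UNIV (\<lambda>y. Z' j y j))"
    by (rule integral_sum) (use compact_supp_integrable_on[OF cs] in \<open>auto simp: Z'_def\<close>)
  also have "\<dots> = 0" by (simp add: int0)
  finally have "integral UNIV (\<lambda>y. ?L y + ?R y) = 0" .
  moreover have "integral UNIV (\<lambda>y. ?L y + ?R y) = integral UNIV ?L + integral UNIV ?R"
    by (rule Henstock_Kurzweil_Integration.integral_add[OF compact_supp_integrable_on[OF csL] compact_supp_integrable_on[OF csR]])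
  ultimately show ?thesis by linarith
qed

end

section \<open>Bump functions and overlaps of charts\<close>

lemma Ck_on_Un:
  assumes "open S" "open T" "Ck_on k S f" "Ck_on k T f"
  shows "Ck_on k (S \<union> T) f"
  using assms(3,4)
proof (induction k arbitrary: f)
  case 0
  then show ?case using assms(1,2) by (simp add: continuous_on_open_Un)
next
  case (Suc k)
  then show ?case by (auto simp: Ck_on.simps(2))
qed

lemma Ck_on_subset:
  assumes "Ck_on k S f" "T \<subseteq> S"
  shows "Ck_on k T f"
  using assms(1)
proof (induction k arbitrary: f)
  case 0
  then show ?case using assms(2) by (auto intro: continuous_on_subset)
next
  case (Suc k)
  then show ?case using assms(2) by (auto simp: Ck_on.simps(2))
qed

text \<open>Squaring removes the corner of the positive part at 0; this makes the bump function
  below of class C1.\<close>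

lemma DERIV_max_0_square: "((\<lambda>t. (max 0 t)\<^sup>2) has_real_derivative 2 * max 0 t) (at t)"
proof -
  consider "t > 0" | "t < 0" | "t = 0" by linarith
  then show ?thesis
  proof cases
    case 1
    have "((\<lambda>t. t\<^sup>2) has_real_derivative 2 * max 0 t) (at t)"
      using 1 by (auto intro!: derivative_eq_intros)
    then show ?thesis
      by (rule has_field_derivative_transform_within_open[of _ _ _ "{0<..}"]) (use 1 in auto)
  next
    case 2
    have "((\<lambda>t. 0) has_real_derivative 2 * max 0 t) (at t)"
      using 2 by (auto intro!: derivative_eq_intros)
    then show ?thesis
      by (rule has_field_derivative_transform_within_open[of _ _ _ "{..<0}"]) (use 2 in auto)
  next
    case 3
    have "((\<lambda>h. ((max 0 (0 + h))\<^sup>2 - (max 0 0)\<^sup>2) / h) \<longlongrightarrow> 0) (at (0::real))"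
    proof (rule Lim_null_comparison[where g = "\<lambda>h. \<bar>h\<bar>"])
      show "\<forall>\<^sub>F h in at 0. norm (((max 0 (0 + h))\<^sup>2 - (max 0 0)\<^sup>2) / h) \<le> \<bar>h\<bar>" for h :: real
        by (rule always_eventually) (auto simp: max_def power2_eq_square)
      show "((\<lambda>h. \<bar>h\<bar>) \<longlongrightarrow> 0) (at (0::real))" by (rule tendsto_rabs_zero) simp
    qed
    then show ?thesis using 3 by (simp add: DERIV_def)
  qed
qed

lemma bump_C1: "C1_on S (\<lambda>y :: 'b::euclidean_space. (max 0 (r\<^sup>2 - (y - a) \<bullet> (y - a)))\<^sup>2)"
proof (rule C1_on_real_compose[where h = "\<lambda>t. (max 0 t)\<^sup>2" and h' = "\<lambda>t. 2 * max 0 t"])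
  show "C1_on S (\<lambda>y. r\<^sup>2 - (y - a) \<bullet> (y - a))"
    by (rule C1_onI[where f' = "\<lambda>y v. - (2 * ((y - a) \<bullet> v))"])
      (auto intro!: derivative_eq_intros continuous_intros simp: inner_commute)
  show "continuous_on S (\<lambda>x. 2 * max 0 (r\<^sup>2 - (x - a) \<bullet> (x - a)))"
    by (intro continuous_intros)
qed (rule DERIV_max_0_square)

context riemannian_manifold
begin

abbreviation "C1_M \<equiv> Ck_on_manifold (Suc 0) A M"

abbreviation "C2_M \<equiv> Ck_on_manifold (Suc (Suc 0)) A M"

definition overlap :: "('a, 'b) rchart \<Rightarrow> ('a, 'b) rchart \<Rightarrow> 'b set" where
  "overlap c d = chart_map c ` (chart_dom c \<inter> chart_dom d)"

lemma overlap_img: "overlap c d \<subseteq> chart_img c"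
  by (auto simp: overlap_def chart_img_def)

lemma mem_overlap:
  assumes c: "c \<in> A"
  shows "y \<in> overlap c d \<longleftrightarrow> y \<in> chart_img c \<and> chart_inv c y \<in> chart_dom d"
proof
  assume "y \<in> overlap c d"
  then show "y \<in> chart_img c \<and> chart_inv c y \<in> chart_dom d"
    using chart_map_img[OF c] chart_inv_map[OF c] by (auto simp: overlap_def)
next
  assume y: "y \<in> chart_img c \<and> chart_inv c y \<in> chart_dom d"
  then have "y = chart_map c (chart_inv c y)" "chart_inv c y \<in> chart_dom c \<inter> chart_dom d"
    using chart_map_inv[OF c] chart_inv_dom[OF c] by auto
  then show "y \<in> overlap c d" unfolding overlap_def by blast
qed

lemma overlap_open:
  assumes "c \<in> A" "d \<in> A"
  shows "open (overlap c d)"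
proof -
  obtain T where "open T" "chart_dom d = M \<inter> T"
    using dom_open[OF assms(2)] by (auto simp: openin_open)
  then have "chart_dom c \<inter> chart_dom d = chart_dom c \<inter> T"
    using dom_subset[OF assms(1)] by auto
  then have "openin (top_of_set (chart_dom c)) (chart_dom c \<inter> chart_dom d)"
    using \<open>open T\<close> by (auto simp: openin_open)
  from homeomorphism_imp_open_map[OF chart_homeo[OF assms(1)] this]
  show ?thesis
    using img_open[OF assms(1)] by (simp add: openin_open_eq overlap_def)
qed

text \<open>\<open>M\<close> is a subset of an ambient space and chart domains are only relatively
  open, so limits are taken within \<open>M\<close> and then localised to a chart.\<close>

lemma at_within_dom:
  assumes "c \<in> A" "x \<in> chart_dom c"
  shows "at x within M = at x within chart_dom c"
proof -
  obtain T where "open T" "chart_dom c = M \<inter> T"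
    using dom_open[OF assms(1)] by (auto simp: openin_open)
  then show ?thesis using assms(2) by (intro at_within_nhd[of x T]) auto
qed

lemma continuous_on_M:
  assumes "\<And>c. c \<in> A \<Longrightarrow> continuous_on (chart_img c) (\<lambda>y. F (chart_inv c y))"
  shows "continuous_on M F"
  unfolding continuous_on_def
proof
  fix x assume "x \<in> M"
  then obtain c where c: "c \<in> A" "x \<in> chart_dom c" using cover by auto
  have "continuous_on (chart_dom c) (\<lambda>x. F (chart_inv c (chart_map c x)))"
    by (rule continuous_on_compose2[OF assms[OF c(1)] chart_map_continuous[OF c(1)]])
      (auto simp: chart_img_def)
  then have "continuous_on (chart_dom c) F"
    by (rule continuous_on_eq) (simp add: chart_inv_map[OF c(1)])
  then show "(F \<longlongrightarrow> F x) (at x within M)"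
    using c(2) by (simp add: at_within_dom[OF c] continuous_on_def)
qed

lemma continuous_on_chart:
  assumes "continuous_on M F" "c \<in> A"
  shows "continuous_on (chart_img c) (\<lambda>y. F (chart_inv c y))"
  by (rule continuous_on_compose2[OF assms(1) chart_inv_continuous[OF assms(2)]])
    (use chart_inv_dom dom_subset assms(2) in auto)

lemma transition_overlap:
  assumes "c \<in> A" "d \<in> A" "y \<in> overlap c d"
  shows "transition c d y \<in> overlap d c" "chart_inv d (transition c d y) = chart_inv c y"
    "(transition c d has_derivative frechet_derivative (transition c d) (at y)) (at y)"
proof -
  have y: "y \<in> chart_img c" "chart_inv c y \<in> chart_dom d"
    using mem_overlap[OF assms(1)] assms(3) by auto
  show "transition c d y \<in> overlap d c"
    using y chart_inv_dom[OF assms(1)] by (auto simp: transition_def overlap_def)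
  show "chart_inv d (transition c d y) = chart_inv c y"
    using y chart_inv_map[OF assms(2)] by (simp add: transition_def)
  have "C1_on (overlap c d) (transition c d)"
    using transition_smooth[OF assms(1,2)] by (simp add: smooth_on_def overlap_def)
  then show "(transition c d has_derivative frechet_derivative (transition c d) (at y)) (at y)"
    using assms(3) by (rule C1_on_has_derivative)
qed

lemma transition_C1: "c \<in> A \<Longrightarrow> d \<in> A \<Longrightarrow> C1_on (overlap c d) (transition c d)"
  using transition_smooth[of c d] by (simp add: smooth_on_def overlap_def)

lemma transition_inverse:
  assumes "c \<in> A" "d \<in> A" "y \<in> overlap c d"
  shows "transition d c (transition c d y) = y"
  using transition_overlap(2)[OF assms] overlap_img[of c d] assms(3) chart_map_inv[OF assms(1)]
  by (auto simp: transition_def)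

lemma transition_image:
  assumes "c \<in> A" "d \<in> A"
  shows "transition c d ` overlap c d = overlap d c"
proof
  show "transition c d ` overlap c d \<subseteq> overlap d c"
    using transition_overlap(1)[OF assms] by auto
  show "overlap d c \<subseteq> transition c d ` overlap c d"
    using transition_overlap(1)[OF assms(2,1)] transition_inverse[OF assms(2,1)] by (metis image_eqI subsetI)
qed

text \<open>The metric transforms by pull-back, so its Gram determinant gains the square of the
  Jacobian determinant; the square root leaves the absolute value.\<close>

lemma vol_density_transition:
  assumes "c \<in> A" "d \<in> A" "y \<in> overlap c d"
  shows "vol_density c y =
    \<bar>linear_det (frechet_derivative (transition c d) (at y))\<bar> * vol_density d (transition c d y)"
proof -
  let ?T = "frechet_derivative (transition c d) (at y)"
  have "chart_metric c y = (\<lambda>v w. chart_metric d (transition c d y) (?T v) (?T w))"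
    using metric_transition[OF assms(1,2) assms(3)[unfolded overlap_def]] by (intro ext)
  moreover have "bilinear (chart_metric d (transition c d y))"
    using metric_bilinear[OF assms(2)] transition_overlap(1)[OF assms] overlap_img by auto
  ultimately have "gram_det (chart_metric c y) = (linear_det ?T)\<^sup>2 * gram_det (chart_metric d (transition c d y))"
    using gram_det_linear by metis
  then show ?thesis by (simp add: vol_density_def real_sqrt_mult)
qed

lemma compact_supp_chart:
  assumes c: "c \<in> A" and F: "continuous_on M F" and K: "compact K" "K \<subseteq> chart_dom c"
    and F0: "\<And>x. x \<in> M \<Longrightarrow> x \<notin> K \<Longrightarrow> F x = 0" and V: "chart_map c ` K \<subseteq> V"
  shows "compact_supp V (chart_integrand c F)"
proof -
  have cK: "compact (chart_map c ` K)"
    using K chart_map_continuous[OF c] by (meson compact_continuous_image continuous_on_subset)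
  have K0: "F (chart_inv c y) * vol_density c y = 0" if "y \<in> chart_img c" "y \<notin> chart_map c ` K" for y
  proof -
    have "chart_inv c y \<notin> K" using that chart_map_inv[OF c] by (metis imageI)
    moreover have "chart_inv c y \<in> M" using chart_inv_dom[OF c that(1)] dom_subset[OF c] by auto
    ultimately show ?thesis using F0 by simp
  qed
  have "compact_supp (chart_img c) (chart_integrand c F)"
  proof (rule compact_supp_extend[OF img_open[OF c] _ cK])
    show "continuous_on (chart_img c) (\<lambda>y. F (chart_inv c y) * vol_density c y)"
      by (intro continuous_on_mult continuous_on_chart[OF F c] C1_on_continuous[OF vol_density_C1[OF c]])
  qed (use K K0 in \<open>auto simp: chart_img_def\<close>)
  then have "continuous_on UNIV (chart_integrand c F)"
    by (simp add: compact_supp_def)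
  then show ?thesis unfolding compact_supp_def using cK V K0 by (metis (no_types, lifting))
qed

text \<open>The densities differ by exactly the Jacobian factor of the change of variables. Support
  inside both chart domains makes the two integrands compactly supported in the two
  overlaps.\<close>

lemma chart_integral_transition:
  assumes c: "c \<in> A" and d: "d \<in> A" and F: "continuous_on M F"
    and K: "compact K" "K \<subseteq> chart_dom c \<inter> chart_dom d"
    and F0: "\<And>x. x \<in> M \<Longrightarrow> x \<notin> K \<Longrightarrow> F x = 0"
  shows "chart_integral c F = chart_integral d F"
  unfolding chart_integral_def
proof (rule change_of_variables[OF overlap_open[OF c d] transition_overlap(3)[OF c d]])
  show "inj_on (transition c d) (overlap c d)"
    using transition_inverse[OF c d] by (metis inj_on_inverseI)
  show "compact_supp (transition c d ` overlap c d)
      (chart_integrand d F)"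
    by (rule compact_supp_chart[OF d F K(1) _ F0])
      (use K in \<open>auto simp: transition_image[OF c d], auto simp: overlap_def\<close>)
  show "compact_supp (overlap c d)
      (chart_integrand c F)"
    by (rule compact_supp_chart[OF c F K(1) _ F0])
      (use K in \<open>auto simp: overlap_def\<close>)
  show "(if y \<in> chart_img c then F (chart_inv c y) * vol_density c y else 0) =
      \<bar>linear_det (frechet_derivative (transition c d) (at y))\<bar> *
      (if transition c d y \<in> chart_img d
       then F (chart_inv d (transition c d y)) * vol_density d (transition c d y) else 0)"
    if "y \<in> overlap c d" for y
    using that overlap_img[of c d] overlap_img[of d c] transition_overlap(1,2)[OF c d that]
    by (auto simp: vol_density_transition[OF c d that])
qed

lemma pd_transition:
  assumes c: "c \<in> A" and d: "d \<in> A" and y: "y \<in> overlap c d"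
    and f: "(f \<circ> chart_inv d) differentiable (at (transition c d y))"
  shows "pd (f \<circ> chart_inv c) v y = pd (f \<circ> chart_inv d) (pd (transition c d) v y) (transition c d y)"
    and "(f \<circ> chart_inv c) differentiable (at y)"
proof -
  let ?D = "\<lambda>v. pd (f \<circ> chart_inv d) (pd (transition c d) v y) (transition c d y)"
  have "((\<lambda>y. (f \<circ> chart_inv d) (transition c d y)) has_derivative ?D) (at y)"
    using transition_overlap(3)[OF c d y] f[unfolded frechet_derivative_works]
    by (rule has_derivative_compose)
  then have D: "((f \<circ> chart_inv c) has_derivative ?D) (at y)"
    by (rule has_derivative_transform_within_open[OF _ overlap_open[OF c d] y])
      (simp add: transition_overlap(2)[OF c d])
  from frechet_derivative_at[OF D] show "pd (f \<circ> chart_inv c) v y = ?D v" by metis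
  from D show "(f \<circ> chart_inv c) differentiable (at y)" by (auto simp: differentiable_def)
qed

lemma chart_inner_transition:
  assumes c: "c \<in> A" and d: "d \<in> A" and y: "y \<in> overlap c d"
    and f: "(f \<circ> chart_inv d) differentiable (at (transition c d y))"
    and g: "(g \<circ> chart_inv d) differentiable (at (transition c d y))"
  shows "chart_inner c f g y = chart_inner d f g (transition c d y)"
proof -
  let ?T = "frechet_derivative (transition c d) (at y)"
  have yc: "y \<in> chart_img c" and yd: "transition c d y \<in> chart_img d"
    using y overlap_img transition_overlap(1)[OF c d y] by auto
  have mt: "chart_metric c y v w = chart_metric d (transition c d y) (?T v) (?T w)" for v w
    using metric_transition[OF c d, of y] y by (simp add: overlap_def)
  have lin: "linear ?T" using transition_overlap(3)[OF c d y] by (rule has_derivative_linear)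
  \<comment> \<open>The pulled-back metric is positive, so the derivative of the transition has
    trivial kernel. By surjectivity the gradient can then be tested against every tangent vector in
    the chart \<open>d\<close>.\<close>
  have "inj ?T"
  proof (subst linear_injective_0[OF lin], intro allI impI)
    fix v assume "?T v = 0"
    then have "chart_metric c y v v = 0"
      using mt[of v v] bilinear_lzero[OF metric_bilinear[OF d yd]] by simp
    then show "v = 0" using metric_pos[OF c yc, of v] by force
  qed
  then have "surj ?T" using lin by (simp add: linear_injective_imp_surjective)
  have "chart_grad d f (transition c d y) = ?T (chart_grad c f y)"
  proof (rule chart_grad_unique[OF d yd f])
    fix z
    obtain v where z: "z = ?T v" using \<open>surj ?T\<close> by (metis surjD)
    show "chart_metric d (transition c d y) (?T (chart_grad c f y)) z = pd (f \<circ> chart_inv d) z (transition c d y)"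
      unfolding z mt[symmetric] pd_transition(1)[OF c d y f, symmetric]
      by (rule chart_grad_metric[OF c yc pd_transition(2)[OF c d y f]])
  qed
  then show ?thesis by (simp add: chart_inner_def pd_transition(1)[OF c d y g])
qed

lemma Ck_on_manifold_iff:
  "Ck_on_manifold k A M f \<longleftrightarrow> (\<forall>c\<in>A. Ck_on k (chart_img c) (f \<circ> chart_inv c))"
  by (auto simp: Ck_on_manifold_def chart_img_M)

lemma C1_on_manifold_continuous: "C1_M f \<Longrightarrow> continuous_on M f"
  by (rule continuous_on_M) (auto simp: Ck_on_manifold_iff dest!: bspec C1_on_continuous)

text \<open>The bump is a function of the squared coordinate distance, set to 0 outside the chart.
  In another chart its regularity is checked on two open sets: the overlap, where it is a
  composition with the transition, and the complement of \<open>K\<close>, where it is 0.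
  \<open>K\<close> is closed because the ambient space is Hausdorff.\<close>

lemma exists_bump:
  assumes c: "c \<in> A" and x: "x \<in> chart_dom c" and V: "open V" "chart_map c x \<in> V"
  obtains \<psi> K where "C1_M \<psi>" "\<And>z. \<psi> z \<ge> 0" "\<psi> x > 0"
    "compact K" "K \<subseteq> chart_dom c" "chart_map c ` K \<subseteq> V" "\<And>z. z \<notin> K \<Longrightarrow> \<psi> z = 0"
proof -
  let ?a = "chart_map c x"
  have "open (V \<inter> chart_img c)" "?a \<in> V \<inter> chart_img c"
    using V img_open[OF c] chart_map_img[OF c x] by auto
  then obtain r where r: "r > 0" "cball ?a r \<subseteq> V \<inter> chart_img c"
    using open_contains_cball by blast
  define h where "h y = (max 0 (r\<^sup>2 - (y - ?a) \<bullet> (y - ?a)))\<^sup>2" for y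
  define \<psi> where "\<psi> z = (if z \<in> chart_dom c then h (chart_map c z) else 0)" for z
  define K where "K = chart_inv c ` cball ?a r"
  have h0: "h y = 0" if "y \<notin> cball ?a r" for y
  proof -
    have "norm (y - ?a) > r" using that by (simp add: dist_norm norm_minus_commute)
    then have "(norm (y - ?a))\<^sup>2 > r\<^sup>2" using r(1) by (simp add: power_strict_mono)
    then show ?thesis by (simp add: h_def power2_norm_eq_inner)
  qed
  have K: "compact K" unfolding K_def
    using chart_inv_continuous[OF c] r(2) by (intro compact_continuous_image) (auto intro: continuous_on_subset)
  have Kd: "K \<subseteq> chart_dom c" using r(2) chart_inv_dom[OF c] by (auto simp: K_def)
  have \<psi>0: "\<psi> z = 0" if "z \<notin> K" for z
  proof (cases "z \<in> chart_dom c")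
    case True
    then have "chart_map c z \<notin> cball ?a r"
      using that chart_inv_map[OF c True] unfolding K_def by (metis imageI)
    then show ?thesis by (simp add: \<psi>_def h0)
  qed (simp add: \<psi>_def)
  have "C1_on (chart_img d) (\<psi> \<circ> chart_inv d)" if d: "d \<in> A" for d
  proof -
    define S where "S = chart_img d \<inter> chart_inv d -` (- K)"
    have "open S" unfolding S_def
      by (rule continuous_open_preimage[OF chart_inv_continuous[OF d] img_open[OF d]])
        (use K in \<open>simp add: open_Compl compact_imp_closed\<close>)
    have "C1_on S (\<psi> \<circ> chart_inv d)"
      by (rule Ck_on_cong_open[OF \<open>open S\<close> _ C1_on_const[of S 0]]) (auto simp: S_def \<psi>0)
    moreover have "C1_on (overlap d c) (\<psi> \<circ> chart_inv d)"
    proof (rule Ck_on_cong_open[OF overlap_open[OF d c]])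
      show "C1_on (overlap d c) (\<lambda>y. h (transition d c y))"
        by (rule C1_on_compose[OF _ transition_C1[OF d c] order_refl]) (simp add: h_def[abs_def] bump_C1)
      show "h (transition d c y) = (\<psi> \<circ> chart_inv d) y" if "y \<in> overlap d c" for y
        using that mem_overlap[OF d] by (auto simp: \<psi>_def transition_def)
    qed
    ultimately have "C1_on (S \<union> overlap d c) (\<psi> \<circ> chart_inv d)"
      using \<open>open S\<close> overlap_open[OF d c] by (intro Ck_on_Un)
    moreover have "chart_img d \<subseteq> S \<union> overlap d c"
      using Kd mem_overlap[OF d] by (auto simp: S_def)
    ultimately show ?thesis by (rule Ck_on_subset)
  qed
  then have "C1_M \<psi>" by (simp add: Ck_on_manifold_iff)
  moreover have "\<psi> x > 0" using x r(1) by (simp add: \<psi>_def h_def)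
  moreover have "chart_map c ` K \<subseteq> V"
  proof
    fix z assume "z \<in> chart_map c ` K"
    then obtain y where y: "y \<in> cball ?a r" "z = chart_map c (chart_inv c y)" unfolding K_def by blast
    then have "y \<in> V \<inter> chart_img c" using r(2) by blast
    then show "z \<in> V" using chart_map_inv[OF c] y(2) by simp
  qed
  moreover have "\<psi> z \<ge> 0" for z by (simp add: \<psi>_def h_def)
  ultimately show thesis using that[of \<psi> K] K Kd \<psi>0 by blast
qed

end

lemma compact_supp_integral_eq_0:
  assumes G: "compact_supp V G" and nonneg: "\<And>y. G y \<ge> 0" and 0: "integral UNIV G = 0"
  shows "G y = 0"
proof -
  obtain K where K: "compact K" "\<And>y. y \<notin> K \<Longrightarrow> G y = 0" and c: "continuous_on UNIV G"
    using G by (auto simp: compact_supp_def)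
  have "bounded (K \<union> {y})" using K(1) compact_imp_bounded by auto
  then obtain a where a: "K \<union> {y} \<subseteq> box (- a) a"
    using bounded_subset_box_symmetric by blast
  have "(\<lambda>z. if z \<in> cbox (- a) a then G z else 0) = G"
    using a K(2) box_subset_cbox[of "- a" a] by (auto simp: fun_eq_iff)
  moreover have "(G has_integral 0) UNIV"
    using compact_supp_integrable_on[OF G] 0 by (simp add: has_integral_integrable_integral)
  ultimately have "(G has_integral 0) (cbox (- a) a)"
    using has_integral_restrict_UNIV[of "cbox (- a) a" G 0] by simp
  then show ?thesis
    using has_integral_0_cbox_imp_0[of "- a" a G y] a c nonneg box_subset_cbox[of "- a" a]
    by (auto intro: continuous_on_subset)
qed

section \<open>Chart independence of gradient products and Laplacian\<close>

context riemannian_manifold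
begin

lemma chart_at_mem:
  assumes "x \<in> M"
  shows "chart_at A x \<in> A" "x \<in> chart_dom (chart_at A x)"
proof -
  have "\<exists>c. c \<in> A \<and> x \<in> chart_dom c" using assms cover by auto
  from someI_ex[OF this] show "chart_at A x \<in> A" "x \<in> chart_dom (chart_at A x)"
    by (auto simp: chart_at_def)
qed

definition grad_inner :: "('a \<Rightarrow> real) \<Rightarrow> ('a \<Rightarrow> real) \<Rightarrow> 'a \<Rightarrow> real" where
  "grad_inner f g x = chart_inner (chart_at A x) f g (chart_map (chart_at A x) x)"

lemma C1_differentiable:
  "C1_M f \<Longrightarrow> c \<in> A \<Longrightarrow> y \<in> chart_img c \<Longrightarrow> (f \<circ> chart_inv c) differentiable (at y)"
  by (auto simp: Ck_on_manifold_iff Ck_on.simps(2))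

lemma C1_on_chart: "Ck_on_manifold k A M f \<Longrightarrow> c \<in> A \<Longrightarrow> Ck_on k (chart_img c) (f \<circ> chart_inv c)"
  by (auto simp: Ck_on_manifold_iff)

lemma Ck_on_manifold_Suc_D: "Ck_on_manifold (Suc k) A M f \<Longrightarrow> Ck_on_manifold k A M f"
  by (auto simp: Ck_on_manifold_iff Ck_on_Suc_D)

lemma grad_inner_eq:
  assumes f: "C1_M f" and g: "C1_M g"
    and c: "c \<in> A" and x: "x \<in> chart_dom c"
  shows "grad_inner f g x = chart_inner c f g (chart_map c x)"
proof -
  let ?d = "chart_at A x"
  have d: "?d \<in> A" "x \<in> chart_dom ?d" using chart_at_mem dom_subset[OF c] x by auto
  have y: "chart_map c x \<in> overlap c ?d" using x d by (auto simp: overlap_def)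
  have T: "transition c ?d (chart_map c x) = chart_map ?d x"
    by (simp add: transition_def chart_inv_map[OF c x])
  show ?thesis
    unfolding grad_inner_def T[symmetric]
    by (rule chart_inner_transition[OF c d(1) y, symmetric])
      (use C1_differentiable[OF f d(1)] C1_differentiable[OF g d(1)] chart_map_img[OF d] T in auto)
qed

lemma grad_inner_continuous:
  assumes f: "C1_M f" and g: "C1_M g"
  shows "continuous_on M (grad_inner f g)"
proof (rule continuous_on_M)
  fix c assume c: "c \<in> A"
  show "continuous_on (chart_img c) (\<lambda>y. grad_inner f g (chart_inv c y))"
    by (rule continuous_on_eq[OF chart_inner_continuous[OF c C1_on_chart[OF f c] C1_on_chart[OF g c]]])
      (simp add: grad_inner_eq[OF f g c chart_inv_dom[OF c]] chart_map_inv[OF c])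
qed

text \<open>Intended for a bump function times a chart expression of the Laplacian, a factor that
  has a meaning in one chart only.\<close>

lemma continuous_on_M_extend:
  fixes F :: "'a \<Rightarrow> real"
  assumes d: "d \<in> A" and F: "continuous_on (chart_img d) (\<lambda>y. F (chart_inv d y))"
    and K: "compact K" "K \<subseteq> chart_dom d" and F0: "\<And>z. z \<notin> K \<Longrightarrow> F z = 0"
  shows "continuous_on M F"
proof (rule continuous_on_M)
  fix c assume c: "c \<in> A"
  define S where "S = chart_img c \<inter> chart_inv c -` (- K)"
  have "open S" unfolding S_def
    by (rule continuous_open_preimage[OF chart_inv_continuous[OF c] img_open[OF c]])
      (use K in \<open>simp add: open_Compl compact_imp_closed\<close>)
  have "continuous_on S (\<lambda>y. F (chart_inv c y)) \<longleftrightarrow> continuous_on S (\<lambda>y. 0 :: real)"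
    by (rule continuous_on_cong) (auto simp: S_def F0)
  then have "continuous_on S (\<lambda>y. F (chart_inv c y))" by simp
  moreover have "continuous_on (overlap c d) (\<lambda>y. F (chart_inv c y))"
  proof (rule continuous_on_eq)
    show "continuous_on (overlap c d) (\<lambda>y. F (chart_inv d (transition c d y)))"
      by (rule continuous_on_compose2[OF F C1_on_continuous[OF transition_C1[OF c d]]])
        (use transition_image[OF c d] overlap_img in auto)
  qed (simp add: transition_overlap(2)[OF c d])
  ultimately have "continuous_on (S \<union> overlap c d) (\<lambda>y. F (chart_inv c y))"
    using \<open>open S\<close> overlap_open[OF c d] by (rule continuous_on_open_Un[rotated 2])
  moreover have "chart_img c \<subseteq> S \<union> overlap c d"
    using K mem_overlap[OF c] by (auto simp: S_def)
  ultimately show "continuous_on (chart_img c) (\<lambda>y. F (chart_inv c y))"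
    by (rule continuous_on_subset)
qed

lemma chart_integral_green:
  assumes c: "c \<in> A" and f: "C2_M f"
    and \<phi>: "C1_M \<phi>"
    and K: "compact K" "K \<subseteq> chart_dom c" "\<And>z. z \<in> M \<Longrightarrow> z \<notin> K \<Longrightarrow> \<phi> z = 0"
  shows "chart_integral c (\<lambda>z. \<phi> z * chart_div c (chart_grad c f) (chart_map c z)) =
    - chart_integral c (grad_inner f \<phi>)"
proof -
  have f1: "C1_M f" using Ck_on_manifold_Suc_D[OF f] .
  have cK: "compact (chart_map c ` K)"
    using K(1,2) chart_map_continuous[OF c] by (meson compact_continuous_image continuous_on_subset)
  have "\<phi> (chart_inv c y) = 0" if "y \<in> chart_img c" "y \<notin> chart_map c ` K" for y
  proof -
    have "chart_inv c y \<notin> K" using that chart_map_inv[OF c] by (metis imageI)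
    moreover have "chart_inv c y \<in> M" using chart_inv_dom[OF c that(1)] dom_subset[OF c] by auto
    ultimately show ?thesis using K(3) by simp
  qed
  moreover have "chart_map c ` K \<subseteq> chart_img c" using K(2) by (auto simp: chart_img_def)
  ultimately have "integral UNIV (\<lambda>y. if y \<in> chart_img c
      then \<phi> (chart_inv c y) * chart_div c (chart_grad c f) y * vol_density c y else 0) =
    - integral UNIV (\<lambda>y. if y \<in> chart_img c then chart_inner c f \<phi> y * vol_density c y else 0)"
    using cK by (intro chart_green[OF c C1_on_chart[OF f c] C1_on_chart[OF \<phi> c]])
  moreover have "(\<lambda>y. if y \<in> chart_img c
      then \<phi> (chart_inv c y) * chart_div c (chart_grad c f) y * vol_density c y else 0) =
    (\<lambda>y. if y \<in> chart_img c then \<phi> (chart_inv c y) * chart_div c (chart_grad c f)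
       (chart_map c (chart_inv c y)) * vol_density c y else 0)"
    by (auto simp: fun_eq_iff chart_map_inv[OF c])
  moreover have "(\<lambda>y. if y \<in> chart_img c then chart_inner c f \<phi> y * vol_density c y else 0) =
    chart_integrand c (grad_inner f \<phi>)"
    by (auto simp: fun_eq_iff grad_inner_eq[OF f1 \<phi> c chart_inv_dom[OF c]] chart_map_inv[OF c])
  ultimately show ?thesis by (simp add: chart_integral_def)
qed

lemma grad_inner_support:
  assumes f: "C1_M f" and \<phi>: "C1_M \<phi>"
    and K: "compact K" "\<And>z. z \<in> M \<Longrightarrow> z \<notin> K \<Longrightarrow> \<phi> z = 0" and z: "z \<in> M" "z \<notin> K"
  shows "grad_inner f \<phi> z = 0"
proof -
  obtain c where c: "c \<in> A" "z \<in> chart_dom c" using z(1) cover by auto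
  define S where "S = chart_img c \<inter> chart_inv c -` (- K)"
  have "open S" unfolding S_def
    by (rule continuous_open_preimage[OF chart_inv_continuous[OF c(1)] img_open[OF c(1)]])
      (use K in \<open>simp add: open_Compl compact_imp_closed\<close>)
  have zS: "chart_map c z \<in> S" using z c by (simp add: S_def chart_map_img chart_inv_map)
  have "((\<phi> \<circ> chart_inv c) has_derivative (\<lambda>h. 0)) (at (chart_map c z))"
  proof (rule has_derivative_transform_within_open[OF _ \<open>open S\<close> zS])
    show "((\<lambda>_. 0) has_derivative (\<lambda>h. 0)) (at (chart_map c z))" by simp
    show "0 = (\<phi> \<circ> chart_inv c) y" if "y \<in> S" for y
      using that K(2) chart_inv_dom[OF c(1)] dom_subset[OF c(1)] by (auto simp: S_def)
  qed
  from frechet_derivative_at[OF this] have "pd (\<phi> \<circ> chart_inv c) v (chart_map c z) = 0" for v by metis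
  then show ?thesis by (simp add: grad_inner_eq[OF f \<phi> c] chart_inner_def)
qed

lemma chart_integral_diff:
  assumes c: "c \<in> A" and F: "continuous_on M F" and G: "continuous_on M G"
    and K: "compact K" "K \<subseteq> chart_dom c"
    and F0: "\<And>x. x \<in> M \<Longrightarrow> x \<notin> K \<Longrightarrow> F x = 0" and G0: "\<And>x. x \<in> M \<Longrightarrow> x \<notin> K \<Longrightarrow> G x = 0"
  shows "chart_integral c (\<lambda>x. F x - G x) = chart_integral c F - chart_integral c G"
proof -
  have s: "compact_supp UNIV (chart_integrand c F)"
    "compact_supp UNIV (chart_integrand c G)"
    by (rule compact_supp_chart[OF c F K F0] compact_supp_chart[OF c G K G0]; simp)+
  show ?thesis
    unfolding chart_integral_def
    by (subst Henstock_Kurzweil_Integration.integral_diff[symmetric])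
      (auto intro!: compact_supp_integrable_on[OF s(1)] compact_supp_integrable_on[OF s(2)]
        integral_cong simp: algebra_simps)
qed

lemma chart_integral_eq_0D:
  assumes c: "c \<in> A" and F: "continuous_on M F" and K: "compact K" "K \<subseteq> chart_dom c"
    and F0: "\<And>x. x \<in> M \<Longrightarrow> x \<notin> K \<Longrightarrow> F x = 0" and nonneg: "\<And>x. x \<in> M \<Longrightarrow> F x \<ge> 0"
    and 0: "chart_integral c F = 0" and x: "x \<in> chart_dom c"
  shows "F x = 0"
proof -
  have "compact_supp UNIV (chart_integrand c F)"
    by (rule compact_supp_chart[OF c F K F0]) auto
  moreover have "chart_integrand c F y \<ge> 0" for y
    using nonneg chart_inv_dom[OF c] dom_subset[OF c] less_imp_le[OF vol_density_pos[OF c]]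
    by (auto intro!: mult_nonneg_nonneg)
  ultimately have "(if chart_map c x \<in> chart_img c then F (chart_inv c (chart_map c x)) *
      vol_density c (chart_map c x) else 0) = 0"
    by (rule compact_supp_integral_eq_0[where G = "chart_integrand c F"]) (use 0 in \<open>simp add: chart_integral_def\<close>)
  then show ?thesis
    using chart_map_img[OF c x] vol_density_pos[OF c chart_map_img[OF c x]] by (simp add: chart_inv_map[OF c x])
qed

text \<open>Both local expressions of the Laplacian satisfy Green's formula against bump functions
  supported in the overlap, and the other terms of that formula do not depend on the chart.\<close>

lemma chart_laplacian_le:
  assumes c: "c \<in> A" and d: "d \<in> A" and f: "C2_M f"
    and x: "x \<in> chart_dom c" "x \<in> chart_dom d"
  shows "chart_div c (chart_grad c f) (chart_map c x) \<le> chart_div d (chart_grad d f) (chart_map d x)"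
proof (rule ccontr)
  assume neg: "\<not> ?thesis"
  let ?L = "\<lambda>c. chart_div c (chart_grad c f)"
  have f1: "C1_M f" using Ck_on_manifold_Suc_D[OF f] .
  define g where "g y = ?L c y - ?L d (transition c d y)" for y
  \<comment> \<open>The open set on which the claimed inequality fails; the bump is chosen with
    support inside it.\<close>
  define V where "V = overlap c d \<inter> g -` {0<..}"
  have Lc: "continuous_on (chart_img e) (?L e)" if "e \<in> A" for e
    by (rule chart_laplacian_continuous[OF that C1_on_chart[OF f that]])
  have "continuous_on (overlap c d) g"
    unfolding g_def
    by (intro continuous_on_diff continuous_on_subset[OF Lc[OF c] overlap_img]
        continuous_on_compose2[OF Lc[OF d] C1_on_continuous[OF transition_C1[OF c d]]])
      (use transition_image[OF c d] overlap_img in auto)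
  then have "open V" unfolding V_def
    by (rule continuous_open_preimage[OF _ overlap_open[OF c d]]) simp
  have T: "transition c d (chart_map c z) = chart_map d z" if "z \<in> chart_dom c" for z
    by (simp add: transition_def chart_inv_map[OF c that])
  have "chart_map c x \<in> V"
    using neg x by (simp add: V_def g_def T overlap_def)
  obtain \<psi> K where \<psi>: "C1_M \<psi>" "\<And>z. \<psi> z \<ge> 0" "\<psi> x > 0"
    and K: "compact K" "K \<subseteq> chart_dom c" "chart_map c ` K \<subseteq> V" and \<psi>0: "\<And>z. z \<notin> K \<Longrightarrow> \<psi> z = 0"
    using exists_bump[OF c x(1) \<open>open V\<close> \<open>chart_map c x \<in> V\<close>] by metis
  have Kd: "K \<subseteq> chart_dom d"
  proof
    fix z assume "z \<in> K"
    then have "chart_map c z \<in> overlap c d" "z \<in> chart_dom c" using K by (auto simp: V_def)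
    then show "z \<in> chart_dom d" using mem_overlap[OF c] chart_inv_map[OF c] by simp
  qed
  define F where "F e z = \<psi> z * ?L e (chart_map e z)" for e :: "('a, 'b) rchart" and z
  have contF: "continuous_on M (F e)" if e: "e \<in> A" "K \<subseteq> chart_dom e" for e
  proof (rule continuous_on_M_extend[OF e(1) _ K(1) e(2)])
    have "continuous_on (chart_img e) (\<lambda>y. \<psi> (chart_inv e y) * ?L e y)"
      by (intro continuous_on_mult continuous_on_chart[OF C1_on_manifold_continuous[OF \<psi>(1)] e(1)] Lc e)
    then show "continuous_on (chart_img e) (\<lambda>y. F e (chart_inv e y))"
      by (rule continuous_on_eq) (simp add: F_def chart_map_inv[OF e(1)])
  qed (simp add: F_def \<psi>0)
  have F0: "F e z = 0" if "z \<notin> K" for e z using that by (simp add: F_def \<psi>0)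
  have "chart_integral c (F c) = - chart_integral c (grad_inner f \<psi>)"
    unfolding F_def[abs_def] by (rule chart_integral_green[OF c f \<psi>(1) K(1,2) \<psi>0])
  also have "chart_integral c (grad_inner f \<psi>) = chart_integral d (grad_inner f \<psi>)"
    by (rule chart_integral_transition[OF c d grad_inner_continuous[OF f1 \<psi>(1)] K(1)])
      (use K Kd \<psi>0 grad_inner_support[OF f1 \<psi>(1) K(1)] in auto)
  also have "- chart_integral d (grad_inner f \<psi>) = chart_integral d (F d)"
    unfolding F_def[abs_def] by (rule chart_integral_green[OF d f \<psi>(1) K(1) Kd \<psi>0, symmetric])
  also have "\<dots> = chart_integral c (F d)"
    by (rule chart_integral_transition[OF d c contF[OF d Kd] K(1)]) (use K Kd F0 in auto)
  finally have "chart_integral c (\<lambda>z. F c z - F d z) = 0"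
    using chart_integral_diff[OF c contF[OF c K(2)] contF[OF d Kd] K(1,2)] F0 by simp
  \<comment> \<open>On the support of the bump the integrand has a sign, so a vanishing integral
    forces it to be 0 at \<open>x\<close>, where the bump is positive.\<close>
  moreover have "F c z - F d z \<ge> 0" for z
  proof (cases "z \<in> K")
    case True
    then have "g (chart_map c z) > 0" "z \<in> chart_dom c" using K by (auto simp: V_def)
    then show ?thesis
      using \<psi>(2)[of z] by (auto simp: F_def g_def T right_diff_distrib[symmetric])
  qed (simp add: F0)
  ultimately have "F c x - F d x = 0"
    using F0 by (intro chart_integral_eq_0D[where F = "\<lambda>z. F c z - F d z", OF c _ K(1,2) _ _ _ x(1)]
        continuous_on_diff contF[OF c K(2)] contF[OF d Kd]) auto
  then show False using \<psi>(3) neg by (simp add: F_def)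
qed

text \<open>Exchanging the two charts in \<open>chart_laplacian_le\<close> gives the reverse
  inequality.\<close>

lemma laplacian_eq:
  assumes c: "c \<in> A" and f: "C2_M f" and x: "x \<in> chart_dom c"
  shows "laplacian A f x = chart_div c (chart_grad c f) (chart_map c x)"
proof -
  have d: "chart_at A x \<in> A" "x \<in> chart_dom (chart_at A x)"
    using chart_at_mem dom_subset[OF c] x by auto
  show ?thesis unfolding laplacian_def Let_def
    by (rule antisym; rule chart_laplacian_le) (use c d f x in auto)
qed

lemma laplacian_continuous:
  assumes f: "C2_M f"
  shows "continuous_on M (laplacian A f)"
proof (rule continuous_on_M)
  fix c assume c: "c \<in> A"
  show "continuous_on (chart_img c) (\<lambda>y. laplacian A f (chart_inv c y))"
    by (rule continuous_on_eq[OF chart_laplacian_continuous[OF c C1_on_chart[OF f c]]])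
      (simp add: laplacian_eq[OF c f chart_inv_dom[OF c]] chart_map_inv[OF c])
qed

lemma C1_manifold_mult:
  "C1_M f \<Longrightarrow> C1_M g \<Longrightarrow> C1_M (\<lambda>z. f z * g z)"
  by (auto simp: Ck_on_manifold_iff o_def intro!: C1_on_mult)

text \<open>Finitely many bumps are positive somewhere on every part of the compact
  \<open>M\<close>; division by their positive sum normalises them. The index set consists of the
  centres of the bumps.\<close>

lemma partition_of_unity:
  assumes "compact M"
  obtains P :: "'a set" and pc :: "'a \<Rightarrow> ('a, 'b) rchart" and \<rho> K
  where "finite P" "\<And>i. i \<in> P \<Longrightarrow> pc i \<in> A" "\<And>i. i \<in> P \<Longrightarrow> C1_M (\<rho> i)"
    "\<And>i z. i \<in> P \<Longrightarrow> z \<in> M \<Longrightarrow> \<rho> i z \<ge> 0" "\<And>i. i \<in> P \<Longrightarrow> compact (K i)"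
    "\<And>i. i \<in> P \<Longrightarrow> K i \<subseteq> chart_dom (pc i)"
    "\<And>i z. i \<in> P \<Longrightarrow> z \<notin> K i \<Longrightarrow> \<rho> i z = 0" "\<And>z. z \<in> M \<Longrightarrow> (\<Sum>i\<in>P. \<rho> i z) = 1"
proof -
  let ?ok = "\<lambda>x \<psi> K. C1_M \<psi> \<and> (\<forall>z. \<psi> z \<ge> 0) \<and> \<psi> x > 0 \<and> compact K \<and>
    K \<subseteq> chart_dom (chart_at A x) \<and> (\<forall>z. z \<notin> K \<longrightarrow> \<psi> z = 0)"
  have "\<exists>p. ?ok x (fst p) (snd p)" if x: "x \<in> M" for x
  proof -
    obtain \<psi> K where
      "C1_M \<psi>" "\<And>z. \<psi> z \<ge> 0" "\<psi> x > 0"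
      "compact K" "K \<subseteq> chart_dom (chart_at A x)" "chart_map (chart_at A x) ` K \<subseteq> UNIV"
      "\<And>z. z \<notin> K \<Longrightarrow> \<psi> z = 0"
      using exists_bump[OF chart_at_mem[OF x] open_UNIV UNIV_I] by blast
    then show ?thesis by (intro exI[of _ "(\<psi>, K)"]) auto
  qed
  then obtain p where p: "\<And>x. x \<in> M \<Longrightarrow> ?ok x (fst (p x)) (snd (p x))" by metis
  define \<psi> where "\<psi> x = fst (p x)" for x
  define K where "K x = snd (p x)" for x
  note ok = p[folded \<psi>_def K_def]
  have "\<exists>T. open T \<and> M \<inter> T = {z \<in> M. \<psi> x z > 0}" if x: "x \<in> M" for x
  proof -
    have "continuous_on M (\<psi> x)" using ok[OF x] C1_on_manifold_continuous by blast
    then have "openin (top_of_set M) (M \<inter> \<psi> x -` {0<..})"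
      by (rule continuous_openin_preimage_gen) simp
    then show ?thesis unfolding openin_open by (auto simp: vimage_def Int_def)
  qed
  then obtain T where T: "\<And>x. x \<in> M \<Longrightarrow> open (T x)" "\<And>x. x \<in> M \<Longrightarrow> M \<inter> T x = {z \<in> M. \<psi> x z > 0}"
    by metis
  have cov: "M \<subseteq> (\<Union>x\<in>M. T x)" using T(2) ok by blast
  obtain P where P: "P \<subseteq> M" "finite P" "M \<subseteq> (\<Union>x\<in>P. T x)"
    by (rule compactE_image[OF assms T(1) cov])
  define S where "S z = (\<Sum>i\<in>P. \<psi> i z)" for z
  have Spos: "S z > 0" if z: "z \<in> M" for z
  proof -
    obtain i where i: "i \<in> P" "z \<in> T i" using P(3) z by auto
    then have "\<psi> i z > 0" using T(2)[of i] P(1) z by auto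
    moreover have "\<psi> j z \<ge> 0" if "j \<in> P" for j using ok[of j] P(1) that by auto
    ultimately show ?thesis unfolding S_def using i(1) P(2) by (intro sum_pos2[of P i]) auto
  qed
  have S1: "C1_M (\<lambda>z. inverse (S z))"
    unfolding Ck_on_manifold_iff
  proof
    fix c assume c: "c \<in> A"
    have "C1_on (chart_img c) (\<lambda>y. \<Sum>i\<in>P. (\<psi> i \<circ> chart_inv c) y)"
      by (intro C1_on_sum C1_on_chart c) (use ok P(1) in auto)
    then have C: "C1_on (chart_img c) (\<lambda>y. S (chart_inv c y))" by (simp add: S_def)
    have pos: "S (chart_inv c y) > 0" if "y \<in> chart_img c" for y
      using Spos chart_inv_dom[OF c that] dom_subset[OF c] by auto
    have "C1_on (chart_img c) (\<lambda>y. inverse (S (chart_inv c y)))"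
    proof (rule C1_on_real_compose[OF C, where h' = "\<lambda>t. - (inverse t * inverse t)" and h = inverse])
      show "(inverse has_real_derivative - (inverse (S (chart_inv c y)) * inverse (S (chart_inv c y)))) (at (S (chart_inv c y)))"
        if "y \<in> chart_img c" for y
        using DERIV_inverse[of "S (chart_inv c y)" UNIV] pos[OF that] by (simp add: numeral_2_eq_2)
      show "continuous_on (chart_img c) (\<lambda>y. - (inverse (S (chart_inv c y)) * inverse (S (chart_inv c y))))"
        by (intro continuous_intros C1_on_continuous[OF C]) (use pos in \<open>auto simp: less_imp_neq[symmetric]\<close>)
    qed
    then show "C1_on (chart_img c) ((\<lambda>z. inverse (S z)) \<circ> chart_inv c)" by (simp add: o_def)
  qed
  show thesis
  proof (rule that[of P "chart_at A" "\<lambda>i z. \<psi> i z * inverse (S z)" K])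
    show "(\<Sum>i\<in>P. \<psi> i z * inverse (S z)) = 1" if "z \<in> M" for z
      using Spos[OF that] by (simp add: sum_distrib_right[symmetric] S_def[symmetric])
    show "C1_M (\<lambda>z. \<psi> i z * inverse (S z))" if "i \<in> P" for i
      using ok[of i] P(1) that by (intro C1_manifold_mult S1) auto
    show "\<psi> i z * inverse (S z) \<ge> 0" if "i \<in> P" "z \<in> M" for i z
      using ok[of i] P(1) that Spos[of z] by (auto intro!: mult_nonneg_nonneg)
    show "\<psi> i z * inverse (S z) = 0" if "i \<in> P" "z \<notin> K i" for i z
      using ok[of i] P(1) that by auto
  qed (use P ok chart_at_mem in auto)
qed

end

section \<open>Integration over a compact Riemannian manifold\<close>

locale riemannian_partition = riemannian_manifold M A
  for M :: "'a::t2_space set" and A :: "('a, 'b::euclidean_space) rchart set" +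
  fixes P :: "'a set" and pc :: "'a \<Rightarrow> ('a, 'b) rchart" and \<rho> :: "'a \<Rightarrow> 'a \<Rightarrow> real" and K :: "'a \<Rightarrow> 'a set"
  assumes P: "finite P" and pc: "\<And>i. i \<in> P \<Longrightarrow> pc i \<in> A"
    and \<rho>_C1: "\<And>i. i \<in> P \<Longrightarrow> C1_M (\<rho> i)"
    and \<rho>_nonneg: "\<And>i z. i \<in> P \<Longrightarrow> z \<in> M \<Longrightarrow> \<rho> i z \<ge> 0"
    and K_compact: "\<And>i. i \<in> P \<Longrightarrow> compact (K i)"
    and K_dom: "\<And>i. i \<in> P \<Longrightarrow> K i \<subseteq> chart_dom (pc i)"
    and \<rho>_0: "\<And>i z. i \<in> P \<Longrightarrow> z \<notin> K i \<Longrightarrow> \<rho> i z = 0"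
    and \<rho>_sum: "\<And>z. z \<in> M \<Longrightarrow> (\<Sum>i\<in>P. \<rho> i z) = 1"
begin

text \<open>Plays the role of integration against the Riemannian measure of \<open>M\<close>. In
  this form linearity, Green's formula and differentiation in a parameter are inherited from
  compactly supported integrands on Euclidean space.\<close>

definition integ :: "('a \<Rightarrow> real) \<Rightarrow> real" where
  "integ F = (\<Sum>i\<in>P. chart_integral (pc i) (\<lambda>z. \<rho> i z * F z))"

lemma \<rho>_continuous: "i \<in> P \<Longrightarrow> continuous_on M (\<rho> i)"
  by (rule C1_on_manifold_continuous[OF \<rho>_C1])

lemma chart_integral_cong:
  assumes "c \<in> A" "\<And>z. z \<in> M \<Longrightarrow> F z = G z"
  shows "chart_integral c F = chart_integral c G"
proof -
  have "F (chart_inv c y) = G (chart_inv c y)" if "y \<in> chart_img c" for y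
    using assms(2) chart_inv_dom[OF assms(1) that] dom_subset[OF assms(1)] by auto
  then show ?thesis unfolding chart_integral_def by (intro integral_cong) auto
qed

lemma integ_cong: "(\<And>z. z \<in> M \<Longrightarrow> F z = G z) \<Longrightarrow> integ F = integ G"
  unfolding integ_def by (intro sum.cong chart_integral_cong) (auto simp: pc)

lemma compact_supp_part:
  assumes i: "i \<in> P" and F: "continuous_on M F"
  shows "compact_supp UNIV (chart_integrand (pc i) (\<lambda>z. \<rho> i z * F z))"
  by (rule compact_supp_chart[OF pc[OF i] _ K_compact[OF i] K_dom[OF i], of "\<lambda>z. \<rho> i z * F z"])
    (auto intro!: continuous_on_mult \<rho>_continuous i F simp: \<rho>_0[OF i])

lemma integ_linear:
  assumes F: "continuous_on M F" and G: "continuous_on M G"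
  shows "integ (\<lambda>z. a * F z + b * G z) = a * integ F + b * integ G"
proof -
  have "chart_integral (pc i) (\<lambda>z. \<rho> i z * (a * F z + b * G z)) =
      a * chart_integral (pc i) (\<lambda>z. \<rho> i z * F z) + b * chart_integral (pc i) (\<lambda>z. \<rho> i z * G z)" if i: "i \<in> P" for i
  proof -
    let ?g = "\<lambda>F. chart_integrand (pc i) (\<lambda>z. \<rho> i z * F z)"
    have I: "?g F integrable_on UNIV" "?g G integrable_on UNIV"
      by (rule compact_supp_integrable_on[OF compact_supp_part[OF i F]]
          compact_supp_integrable_on[OF compact_supp_part[OF i G]])+
    have "integral UNIV (\<lambda>y. a * ?g F y + b * ?g G y) = integral UNIV (\<lambda>y. a * ?g F y) + integral UNIV (\<lambda>y. b * ?g G y)"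
      by (rule Henstock_Kurzweil_Integration.integral_add) (intro integrable_on_mult_right I)+
    moreover have "?g (\<lambda>z. a * F z + b * G z) = (\<lambda>y. a * ?g F y + b * ?g G y)"
      by (auto simp: fun_eq_iff algebra_simps)
    ultimately show ?thesis by (simp add: chart_integral_def)
  qed
  then show ?thesis by (simp add: integ_def sum.distrib sum_distrib_left)
qed

lemma integ_add: "continuous_on M F \<Longrightarrow> continuous_on M G \<Longrightarrow> integ (\<lambda>z. F z + G z) = integ F + integ G"
  using integ_linear[of F G 1 1] by simp

lemma integ_diff: "continuous_on M F \<Longrightarrow> continuous_on M G \<Longrightarrow> integ (\<lambda>z. F z - G z) = integ F - integ G"
  using integ_linear[of F G 1 "-1"] by simp

lemma integ_cmult: "continuous_on M F \<Longrightarrow> integ (\<lambda>z. a * F z) = a * integ F"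
  using integ_linear[of F F a 0] by simp

lemma chart_integral_nonneg:
  assumes i: "i \<in> P" and F: "continuous_on M F" and nonneg: "\<And>z. z \<in> M \<Longrightarrow> F z \<ge> 0"
  shows "chart_integral (pc i) (\<lambda>z. \<rho> i z * F z) \<ge> 0"
  unfolding chart_integral_def
proof (rule Henstock_Kurzweil_Integration.integral_nonneg)
  show "(chart_integrand (pc i) (\<lambda>z. \<rho> i z * F z)) integrable_on UNIV"
    by (rule compact_supp_integrable_on[OF compact_supp_part[OF i F]])
  show "0 \<le> chart_integrand (pc i) (\<lambda>z. \<rho> i z * F z) y" for y
    using chart_inv_dom[OF pc[OF i]] dom_subset[OF pc[OF i]] nonneg \<rho>_nonneg[OF i]
      less_imp_le[OF vol_density_pos[OF pc[OF i]]]
    by (auto intro!: mult_nonneg_nonneg)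
qed

lemma integ_nonneg: "continuous_on M F \<Longrightarrow> (\<And>z. z \<in> M \<Longrightarrow> F z \<ge> 0) \<Longrightarrow> integ F \<ge> 0"
  unfolding integ_def by (intro sum_nonneg chart_integral_nonneg)

lemma integ_mono:
  assumes "continuous_on M F" "continuous_on M G" "\<And>z. z \<in> M \<Longrightarrow> F z \<le> G z"
  shows "integ F \<le> integ G"
  using integ_nonneg[of "\<lambda>z. G z - F z"] integ_diff[of G F] assms
  by (simp add: continuous_on_diff)

text \<open>All summands are nonnegative, so each \<open>\<rho> i z * F z\<close> has integral 0 and
  vanishes; summing over \<open>i\<close> recovers \<open>F\<close>.\<close>

lemma integ_eq_0D:
  assumes F: "continuous_on M F" and nonneg: "\<And>z. z \<in> M \<Longrightarrow> F z \<ge> 0"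
    and 0: "integ F = 0" and z: "z \<in> M"
  shows "F z = 0"
proof -
  have "\<rho> i z * F z = 0" if i: "i \<in> P" for i
  proof (cases "z \<in> K i")
    case True
    have "chart_integral (pc i) (\<lambda>z. \<rho> i z * F z) = 0"
      using sum_nonneg_eq_0_iff[OF P, of "\<lambda>i. chart_integral (pc i) (\<lambda>z. \<rho> i z * F z)"]
        chart_integral_nonneg[OF _ F nonneg] 0 i by (simp add: integ_def)
    moreover have "continuous_on M (\<lambda>z. \<rho> i z * F z)"
      by (intro continuous_on_mult \<rho>_continuous i F)
    ultimately show ?thesis
      using True K_dom[OF i] \<rho>_nonneg[OF i] nonneg \<rho>_0[OF i]
      by - (rule chart_integral_eq_0D[where F = "\<lambda>z. \<rho> i z * F z" and K = "K i" and c = "pc i"],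
        simp_all add: pc[OF i] K_compact[OF i] subset_iff)
  qed (simp add: \<rho>_0[OF i])
  then have "(\<Sum>i\<in>P. \<rho> i z) * F z = 0"
    by (simp only: sum_distrib_right) (rule sum.neutral, blast)
  then show ?thesis by (simp add: \<rho>_sum[OF z])
qed

lemma chart_integral_sum:
  assumes c: "c \<in> A" and F: "\<And>i. i \<in> P \<Longrightarrow> continuous_on M (F i)"
    and L: "\<And>i. i \<in> P \<Longrightarrow> compact (L i)" "\<And>i. i \<in> P \<Longrightarrow> L i \<subseteq> chart_dom c"
    and F0: "\<And>i z. i \<in> P \<Longrightarrow> z \<in> M \<Longrightarrow> z \<notin> L i \<Longrightarrow> F i z = 0"
  shows "chart_integral c (\<lambda>z. \<Sum>i\<in>P. F i z) = (\<Sum>i\<in>P. chart_integral c (F i))"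
proof -
  let ?g = "chart_integrand c"
  have "?g (F i) integrable_on UNIV" if i: "i \<in> P" for i
    by (rule compact_supp_integrable_on[OF compact_supp_chart[OF c F[OF i] L(1)[OF i] L(2)[OF i] F0[OF i] subset_UNIV]])
  then have "integral UNIV (\<lambda>y. \<Sum>i\<in>P. ?g (F i) y) = (\<Sum>i\<in>P. integral UNIV (?g (F i)))"
    by (intro integral_sum P)
  moreover have "?g (\<lambda>z. \<Sum>i\<in>P. F i z) = (\<lambda>y. \<Sum>i\<in>P. ?g (F i) y)"
    by (auto simp: fun_eq_iff sum_distrib_right)
  ultimately show ?thesis by (simp add: chart_integral_def)
qed

text \<open>Every piece \<open>\<rho> i z * F z\<close> is supported in \<open>pc i\<close> and in
  \<open>c\<close>, so it may be integrated in \<open>c\<close>, where the pieces add up to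
  \<open>F\<close>.\<close>

lemma integ_local:
  assumes c: "c \<in> A" and F: "continuous_on M F" and L: "compact L" "L \<subseteq> chart_dom c"
    and F0: "\<And>z. z \<in> M \<Longrightarrow> z \<notin> L \<Longrightarrow> F z = 0"
  shows "integ F = chart_integral c F"
proof -
  have cont: "continuous_on M (\<lambda>z. \<rho> i z * F z)" if "i \<in> P" for i
    by (intro continuous_on_mult \<rho>_continuous that F)
  have cp: "compact (K i \<inter> L)" if "i \<in> P" for i
    using K_compact[OF that] L(1) by (simp add: compact_Int)
  have "integ F = (\<Sum>i\<in>P. chart_integral c (\<lambda>z. \<rho> i z * F z))"
    unfolding integ_def
  proof (rule sum.cong[OF refl])
    fix i assume i: "i \<in> P"
    show "chart_integral (pc i) (\<lambda>z. \<rho> i z * F z) = chart_integral c (\<lambda>z. \<rho> i z * F z)"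
      by (rule chart_integral_transition[OF pc[OF i] c cont[OF i] cp[OF i]])
        (use K_dom[OF i] L \<rho>_0[OF i] F0 in auto)
  qed
  also have "\<dots> = chart_integral c (\<lambda>z. \<Sum>i\<in>P. \<rho> i z * F z)"
    by (rule chart_integral_sum[OF c cont cp, symmetric]) (use L \<rho>_0 F0 in auto)
  also have "\<dots> = chart_integral c F"
    by (rule chart_integral_cong[OF c]) (simp add: sum_distrib_right[symmetric] \<rho>_sum)
  finally show ?thesis .
qed

lemma integ_sum:
  assumes "\<And>i. i \<in> J \<Longrightarrow> continuous_on M (F i)"
  shows "integ (\<lambda>z. \<Sum>i\<in>J. F i z) = (\<Sum>i\<in>J. integ (F i))"
  using assms
proof (induction J rule: infinite_finite_induct)
  case (infinite J)
  then show ?case using integ_linear[of "\<lambda>z. 0" "\<lambda>z. 0" 0 0] by simp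
next
  case empty
  then show ?case using integ_linear[of "\<lambda>z. 0" "\<lambda>z. 0" 0 0] by simp
next
  case (insert j J)
  then show ?case by (simp add: integ_add continuous_on_sum)
qed

text \<open>Agreement of \<open>h\<close> with the sum is required on \<open>M\<close> only, because
  the partition functions are known to add up to 1 only there.\<close>

lemma grad_inner_sum:
  assumes f: "C1_M f" and g: "\<And>i. i \<in> P \<Longrightarrow> C1_M (g i)"
    and h: "C1_M h" and eq: "\<And>z. z \<in> M \<Longrightarrow> h z = (\<Sum>i\<in>P. g i z)" and z: "z \<in> M"
  shows "grad_inner f h z = (\<Sum>i\<in>P. grad_inner f (g i) z)"
proof -
  obtain c where c: "c \<in> A" "z \<in> chart_dom c" using z cover by auto
  let ?y = "chart_map c z"
  have y: "?y \<in> chart_img c" by (rule chart_map_img[OF c])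
  have "((\<lambda>y. \<Sum>i\<in>P. (g i \<circ> chart_inv c) y) has_derivative (\<lambda>v. \<Sum>i\<in>P. pd (g i \<circ> chart_inv c) v ?y)) (at ?y)"
    by (intro has_derivative_sum C1_on_has_derivative[OF C1_on_chart[OF g c(1)] y])
  then have "((h \<circ> chart_inv c) has_derivative (\<lambda>v. \<Sum>i\<in>P. pd (g i \<circ> chart_inv c) v ?y)) (at ?y)"
    by (rule has_derivative_transform_within_open[OF _ img_open[OF c(1)] y])
      (simp add: eq[OF subsetD[OF dom_subset[OF c(1)] chart_inv_dom[OF c(1)]]])
  from frechet_derivative_at[OF this]
  have "pd (h \<circ> chart_inv c) v ?y = (\<Sum>i\<in>P. pd (g i \<circ> chart_inv c) v ?y)" for v by metis
  then have "chart_inner c f h ?y = (\<Sum>i\<in>P. chart_inner c f (g i) ?y)" by (simp add: chart_inner_def)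
  then show ?thesis using grad_inner_eq[OF f g c] grad_inner_eq[OF f h c] by simp
qed

text \<open>The test functions \<open>\<rho> i z * \<phi> z\<close> are supported in one chart each.
  The gradients of the \<open>\<rho> i\<close> cancel in the sum, since the \<open>\<rho> i\<close>
  add up to 1.\<close>

lemma integ_green:
  assumes f: "C2_M f" and \<phi>: "C1_M \<phi>"
  shows "integ (\<lambda>z. \<phi> z * laplacian A f z) = - integ (grad_inner f \<phi>)"
proof -
  have f1: "C1_M f" using Ck_on_manifold_Suc_D[OF f] .
  have p: "C1_M (\<lambda>z. \<rho> i z * \<phi> z)" if "i \<in> P" for i
    by (intro C1_manifold_mult \<rho>_C1 that \<phi>)
  have "chart_integral (pc i) (\<lambda>z. \<rho> i z * (\<phi> z * laplacian A f z)) = - integ (grad_inner f (\<lambda>z. \<rho> i z * \<phi> z))"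
    if i: "i \<in> P" for i
  proof -
    have "chart_integral (pc i) (\<lambda>z. \<rho> i z * (\<phi> z * laplacian A f z)) =
      chart_integral (pc i) (\<lambda>z. \<rho> i z * \<phi> z * chart_div (pc i) (chart_grad (pc i) f) (chart_map (pc i) z))"
      unfolding chart_integral_def
      by (rule integral_cong) (simp add: laplacian_eq[OF pc[OF i] f] chart_inv_dom[OF pc[OF i]])
    also have "\<dots> = - chart_integral (pc i) (grad_inner f (\<lambda>z. \<rho> i z * \<phi> z))"
      by (rule chart_integral_green[OF pc[OF i] f p[OF i] K_compact[OF i] K_dom[OF i]]) (simp add: \<rho>_0[OF i])
    also have "chart_integral (pc i) (grad_inner f (\<lambda>z. \<rho> i z * \<phi> z)) = integ (grad_inner f (\<lambda>z. \<rho> i z * \<phi> z))"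
      by (rule integ_local[OF pc[OF i] grad_inner_continuous[OF f1 p[OF i]] K_compact[OF i] K_dom[OF i], symmetric])
        (rule grad_inner_support[OF f1 p[OF i] K_compact[OF i]], auto simp: \<rho>_0[OF i])
    finally show ?thesis .
  qed
  then have "integ (\<lambda>z. \<phi> z * laplacian A f z) = - (\<Sum>i\<in>P. integ (grad_inner f (\<lambda>z. \<rho> i z * \<phi> z)))"
    by (simp add: integ_def[of "\<lambda>z. \<phi> z * laplacian A f z"] sum_negf)
  also have "(\<Sum>i\<in>P. integ (grad_inner f (\<lambda>z. \<rho> i z * \<phi> z))) = integ (\<lambda>z. \<Sum>i\<in>P. grad_inner f (\<lambda>z. \<rho> i z * \<phi> z) z)"
    by (rule integ_sum[symmetric]) (rule grad_inner_continuous[OF f1 p])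
  also have "\<dots> = integ (grad_inner f \<phi>)"
    by (rule integ_cong, rule grad_inner_sum[OF f1 p \<phi>, symmetric])
      (simp_all add: sum_distrib_right[symmetric] \<rho>_sum)
  finally show ?thesis .
qed

text \<open>Differentiation under the integral sign in each chart, over a fixed box around the
  support of the partition function.\<close>

lemma integ_has_derivative:
  assumes d: "\<And>r z. r > r0 \<Longrightarrow> z \<in> M \<Longrightarrow> ((\<lambda>r. F r z) has_real_derivative F' r z) (at r)"
    and F: "\<And>r. r > r0 \<Longrightarrow> continuous_on M (F r)"
    and F': "\<And>c. c \<in> A \<Longrightarrow> continuous_on ({r0<..} \<times> chart_img c) (\<lambda>(r, y). F' r (chart_inv c y))"
    and r: "r > r0"
  shows "((\<lambda>r. integ (F r)) has_real_derivative integ (F' r)) (at r)"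
  unfolding integ_def
proof (rule DERIV_sum)
  fix i assume i: "i \<in> P"
  let ?c = "pc i"
  note c = pc[OF i]
  let ?g = "\<lambda>H. chart_integrand ?c (\<lambda>z. \<rho> i z * H z)"
  have cK: "compact (chart_map ?c ` K i)"
    using K_compact[OF i] K_dom[OF i] chart_map_continuous[OF c]
    by (meson compact_continuous_image continuous_on_subset)
  then obtain a where a: "chart_map ?c ` K i \<subseteq> cbox (- a) a"
    by (meson bounded_subset_cbox_symmetric compact_imp_bounded)
  have g0: "?g H y = 0" if "y \<notin> chart_map ?c ` K i" for H y
  proof (cases "y \<in> chart_img ?c")
    case True
    then have "chart_inv ?c y \<notin> K i" using that chart_map_inv[OF c] by (metis imageI)
    then show ?thesis by (simp add: \<rho>_0[OF i])
  qed simp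
  have box: "integral UNIV (?g H) = integral (cbox (- a) a) (?g H)" for H
  proof -
    have "?g H y = (if y \<in> cbox (- a) a then ?g H y else 0)" for y
      using g0[of y H] a by (cases "y \<in> cbox (- a) a") (simp_all only: if_True if_False, blast)
    then have "?g H = (\<lambda>y. if y \<in> cbox (- a) a then ?g H y else 0)" by (rule ext)
    then have "integral UNIV (?g H) = integral UNIV (\<lambda>y. if y \<in> cbox (- a) a then ?g H y else 0)"
      by (rule arg_cong)
    also have "\<dots> = integral (cbox (- a) a) (?g H)" by (rule integral_restrict_UNIV)
    finally show ?thesis .
  qed
  have "((\<lambda>r. integral (cbox (- a) a) (?g (F r))) has_field_derivative
      integral (cbox (- a) a) (?g (F' r))) (at r within {r0<..})"
  proof (rule leibniz_rule_field_derivative)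
    fix s y assume s: "s \<in> {r0<..}"
    show "((\<lambda>r. ?g (F r) y) has_field_derivative ?g (F' s) y) (at s within {r0<..})"
    proof (cases "y \<in> chart_img ?c")
      case True
      then have "chart_inv ?c y \<in> M" using chart_inv_dom[OF c] dom_subset[OF c] by auto
      then have "((\<lambda>r. F r (chart_inv ?c y)) has_field_derivative F' s (chart_inv ?c y)) (at s within {r0<..})"
        using d s by (auto intro: has_field_derivative_at_within)
      then have "((\<lambda>r. \<rho> i (chart_inv ?c y) * F r (chart_inv ?c y) * vol_density ?c y) has_field_derivative
          \<rho> i (chart_inv ?c y) * F' s (chart_inv ?c y) * vol_density ?c y) (at s within {r0<..})"
        by (intro DERIV_cmult_right DERIV_cmult)
      then show ?thesis using True by simp
    qed simp
  next
    fix s assume "s \<in> {r0<..}"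
    then show "?g (F s) integrable_on cbox (- a) a"
      using compact_supp_part[OF i F, of s]
      by (intro integrable_continuous) (auto simp: compact_supp_def intro: continuous_on_subset)
  next
    have oi: "open (chart_img ?c)" by (rule img_open[OF c])
    have "continuous_on ({r0<..} \<times> chart_img ?c) (\<lambda>p. \<rho> i (chart_inv ?c (snd p)) *
        (case p of (r, y) \<Rightarrow> F' r (chart_inv ?c y)) * vol_density ?c (snd p))"
      by (intro continuous_on_mult F'[OF c]
          continuous_on_compose2[OF continuous_on_chart[OF \<rho>_continuous[OF i] c] continuous_on_snd]
          continuous_on_compose2[OF C1_on_continuous[OF vol_density_C1[OF c]] continuous_on_snd]
          continuous_on_id) auto
    then have "continuous_on ({r0<..} \<times> chart_img ?c) (\<lambda>(s, y). ?g (F' s) y)"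
      by (rule continuous_on_eq) auto
    \<comment> \<open>Here the integrand is 0, so joint continuity extends to the part of the box
      that lies outside the chart image.\<close>
    moreover have "continuous_on ({r0<..} \<times> - (chart_map ?c ` K i)) (\<lambda>(s, y). ?g (F' s) y) \<longleftrightarrow>
        continuous_on ({r0<..} \<times> - (chart_map ?c ` K i)) (\<lambda>p. 0 :: real)"
      by (rule continuous_on_cong) (use g0 in auto)
    ultimately have "continuous_on ({r0<..} \<times> chart_img ?c \<union> {r0<..} \<times> - (chart_map ?c ` K i)) (\<lambda>(s, y). ?g (F' s) y)"
      using cK oi by (intro continuous_on_open_Un) (auto intro!: open_Times open_Compl compact_imp_closed)
    then show "continuous_on ({r0<..} \<times> cbox (- a) a) (\<lambda>(s, y). ?g (F' s) y)"
      by (rule continuous_on_subset) (use K_dom[OF i] in \<open>auto simp: chart_img_def\<close>)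
  qed (use r in auto)
  then have "((\<lambda>r. integral UNIV (?g (F r))) has_field_derivative integral UNIV (?g (F' r))) (at r within {r0<..})"
    by (simp only: box)
  moreover have "at r within {r0<..} = at r" using r by (intro at_within_open) auto
  ultimately show "((\<lambda>r. chart_integral ?c (\<lambda>z. \<rho> i z * F r z)) has_field_derivative
      chart_integral ?c (\<lambda>z. \<rho> i z * F' r z)) (at r)"
    by (simp add: chart_integral_def)
qed

end

section \<open>Functions on the conical end\<close>

text \<open>Two applications of the mean value theorem, first along \<open>v\<close> and then along
  \<open>w\<close>.\<close>

lemma second_difference:
  fixes f :: "'b::real_normed_vector \<Rightarrow> real"
  assumes S: "open S" and f: "C2_on S f" and h: "h > 0"
    and sub: "\<And>s t. 0 \<le> s \<Longrightarrow> s \<le> h \<Longrightarrow> 0 \<le> t \<Longrightarrow> t \<le> h \<Longrightarrow> x + s *\<^sub>R v + t *\<^sub>R w \<in> S"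
  obtains s t where "0 \<le> s" "s \<le> h" "0 \<le> t" "t \<le> h"
    "f (x + h *\<^sub>R v + h *\<^sub>R w) - f (x + h *\<^sub>R v) - f (x + h *\<^sub>R w) + f x =
      h * (h * pd (pd f v) w (x + s *\<^sub>R v + t *\<^sub>R w))"
proof -
  have fd: "(f has_derivative frechet_derivative f (at y)) (at y)" if "y \<in> S" for y
    by (rule C1_on_has_derivative[OF f that])
  have f1: "C1_on S (pd f v)" using f by (simp add: Ck_on.simps(2)[of "Suc 0"])
  have line: "((\<lambda>s. g (y + s *\<^sub>R e)) has_real_derivative pd g e (y + s *\<^sub>R e)) (at s)"
    if "(g has_derivative frechet_derivative g (at (y + s *\<^sub>R e))) (at (y + s *\<^sub>R e))"
    for g :: "'b \<Rightarrow> real" and y e s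
  proof -
    have "((\<lambda>s. g (y + s *\<^sub>R e)) has_derivative (\<lambda>t. pd g (t *\<^sub>R e) (y + s *\<^sub>R e))) (at s)"
      by (rule has_derivative_compose[where f = "\<lambda>s. y + s *\<^sub>R e" and g = g, OF _ that])
        (auto intro!: derivative_eq_intros)
    moreover have "pd g (t *\<^sub>R e) (y + s *\<^sub>R e) = pd g e (y + s *\<^sub>R e) * t" for t
      using linear_cmul[OF has_derivative_linear[OF that]] by simp
    ultimately show ?thesis by (simp add: has_field_derivative_def)
  qed
  have sub0: "x + s *\<^sub>R v \<in> S" if "0 \<le> s" "s \<le> h" for s using sub[of s 0] that h by simp
  have swap: "x + h *\<^sub>R w + s *\<^sub>R v = x + s *\<^sub>R v + h *\<^sub>R w" for s by simp
  have "\<exists>s>0. s < h \<and> (f (x + h *\<^sub>R w + h *\<^sub>R v) - f (x + h *\<^sub>R v)) - (f (x + h *\<^sub>R w + 0 *\<^sub>R v) - f (x + 0 *\<^sub>R v)) =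
      (h - 0) * (pd f v (x + h *\<^sub>R w + s *\<^sub>R v) - pd f v (x + s *\<^sub>R v))"
  proof (rule MVT2[OF h, where f = "\<lambda>s. f (x + h *\<^sub>R w + s *\<^sub>R v) - f (x + s *\<^sub>R v)"])
    fix s assume s: "0 \<le> s" "s \<le> h"
    show "((\<lambda>s. f (x + h *\<^sub>R w + s *\<^sub>R v) - f (x + s *\<^sub>R v)) has_real_derivative
        pd f v (x + h *\<^sub>R w + s *\<^sub>R v) - pd f v (x + s *\<^sub>R v)) (at s)"
    proof (intro DERIV_diff line fd)
      show "x + h *\<^sub>R w + s *\<^sub>R v \<in> S" using sub[of s h] s h by (simp only: swap)
      show "x + s *\<^sub>R v \<in> S" by (rule sub0[OF s])
    qed
  qed
  then obtain s where s: "0 < s" "s < h"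
    "(f (x + h *\<^sub>R w + h *\<^sub>R v) - f (x + h *\<^sub>R v)) - (f (x + h *\<^sub>R w) - f x) =
      h * (pd f v (x + s *\<^sub>R v + h *\<^sub>R w) - pd f v (x + s *\<^sub>R v))"
    unfolding swap by auto
  have "\<exists>t>0. t < h \<and> pd f v (x + s *\<^sub>R v + h *\<^sub>R w) - pd f v (x + s *\<^sub>R v + 0 *\<^sub>R w) =
      (h - 0) * pd (pd f v) w (x + s *\<^sub>R v + t *\<^sub>R w)"
  proof (rule MVT2[OF h, where f = "\<lambda>t. pd f v (x + s *\<^sub>R v + t *\<^sub>R w)"])
    fix t assume t: "0 \<le> t" "t \<le> h"
    have "x + s *\<^sub>R v + t *\<^sub>R w \<in> S" by (rule sub) (use s t in auto)
    then show "((\<lambda>t. pd f v (x + s *\<^sub>R v + t *\<^sub>R w)) has_real_derivative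
        pd (pd f v) w (x + s *\<^sub>R v + t *\<^sub>R w)) (at t)"
      by (intro line C1_on_has_derivative[OF f1])
  qed
  then obtain t where t: "0 < t" "t < h"
    "pd f v (x + s *\<^sub>R v + h *\<^sub>R w) - pd f v (x + s *\<^sub>R v) = h * pd (pd f v) w (x + s *\<^sub>R v + t *\<^sub>R w)"
    by auto
  show thesis
    by (rule that[of s t]) (use s t in \<open>auto simp: swap\<close>)
qed

text \<open>The mixed second difference is symmetric in \<open>v\<close> and \<open>w\<close>.
  Divided by \<open>h * h\<close> it is a mixed derivative at a nearby point, in either order, and
  continuity finishes the argument. The result serves to exchange radial and angular
  derivatives.\<close>

lemma pd_commute:
  fixes f :: "'b::real_normed_vector \<Rightarrow> real"
  assumes S: "open S" and f: "C2_on S f" and x: "x \<in> S"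
  shows "pd (pd f v) w x = pd (pd f w) v x"
proof (rule ccontr)
  assume neq: "\<not> ?thesis"
  define d where "d = \<bar>pd (pd f v) w x - pd (pd f w) v x\<bar> / 2"
  have d: "d > 0" using neq by (simp add: d_def)
  have cont: "isCont (pd (pd f v) w) x" for v w
    using f S x by (simp add: Ck_on.simps(2) continuous_on_eq_continuous_at)
  have "\<forall>\<^sub>F y in nhds x. dist (pd (pd f v) w y) (pd (pd f v) w x) < d" for v w
    using cont[of v w] d by (auto simp: isCont_def tendsto_iff eventually_nhds_conv_at)
  then have "\<forall>\<^sub>F y in nhds x. y \<in> S \<and> dist (pd (pd f v) w y) (pd (pd f v) w x) < d \<and>
      dist (pd (pd f w) v y) (pd (pd f w) v x) < d"
    using eventually_nhds_in_open[OF S x] by (intro eventually_conj)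
  then obtain e where e: "e > 0" and near: "\<And>y. dist y x < e \<Longrightarrow> y \<in> S \<and>
      dist (pd (pd f v) w y) (pd (pd f v) w x) < d \<and> dist (pd (pd f w) v y) (pd (pd f w) v x) < d"
    unfolding eventually_nhds_metric by blast
  \<comment> \<open>The factor 2 keeps all points \<open>x + s *\<^sub>R v + t *\<^sub>R w\<close>
    within \<open>e / 2\<close> of \<open>x\<close>; the summand 1 avoids a division by 0 when both
    directions vanish.\<close>
  define h where "h = e / (2 * (norm v + norm w + 1))"
  have nn: "norm v + norm w + 1 > 0" by (smt (verit) norm_ge_zero)
  have h: "h > 0" using e nn by (simp add: h_def)
  have close: "dist (x + s *\<^sub>R v + t *\<^sub>R w) x < e" if "0 \<le> s" "s \<le> h" "0 \<le> t" "t \<le> h" for s t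
  proof -
    have "dist (x + s *\<^sub>R v + t *\<^sub>R w) x = norm (s *\<^sub>R v + t *\<^sub>R w)" by (simp add: dist_norm)
    also have "\<dots> \<le> s * norm v + t * norm w" using norm_triangle_ineq[of "s *\<^sub>R v" "t *\<^sub>R w"] that by simp
    also have "\<dots> \<le> h * norm v + h * norm w" using that by (intro add_mono mult_right_mono) auto
    also have "\<dots> \<le> h * (norm v + norm w + 1)" using h by (simp add: algebra_simps)
    also have "\<dots> = e / 2"
    proof -
      have "e / (2 * n) * n = e / 2" if "n > 0" for n :: real using that by simp
      then show ?thesis unfolding h_def using nn by blast
    qed
    finally show ?thesis using e by simp
  qed
  obtain s t where st: "0 \<le> s" "s \<le> h" "0 \<le> t" "t \<le> h"
    "f (x + h *\<^sub>R v + h *\<^sub>R w) - f (x + h *\<^sub>R v) - f (x + h *\<^sub>R w) + f x =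
      h * (h * pd (pd f v) w (x + s *\<^sub>R v + t *\<^sub>R w))"
    by (rule second_difference[OF S f h, of x v w]) (use near close in auto)
  obtain s' t' where st': "0 \<le> s'" "s' \<le> h" "0 \<le> t'" "t' \<le> h"
    "f (x + h *\<^sub>R w + h *\<^sub>R v) - f (x + h *\<^sub>R w) - f (x + h *\<^sub>R v) + f x =
      h * (h * pd (pd f w) v (x + s' *\<^sub>R w + t' *\<^sub>R v))"
  proof (rule second_difference[OF S f h, of x w v])
    fix s t assume "0 \<le> s" "s \<le> h" "0 \<le> t" "t \<le> h"
    then show "x + s *\<^sub>R w + t *\<^sub>R v \<in> S" using near close[of t s] by (simp add: add.assoc add.commute[of "s *\<^sub>R w"])
  qed
  have "pd (pd f v) w (x + s *\<^sub>R v + t *\<^sub>R w) = pd (pd f w) v (x + s' *\<^sub>R w + t' *\<^sub>R v)"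
    using st(5) st'(5) h by (simp add: algebra_simps)
  moreover have "x + s' *\<^sub>R w + t' *\<^sub>R v = x + t' *\<^sub>R v + s' *\<^sub>R w" by simp
  ultimately show False
    using near[OF close[OF st(1-4)]] near[OF close[OF st'(3,4,1,2)]]
    by (simp add: dist_real_def d_def abs_if split: if_splits)
qed

lemma pd_fst:
  fixes h :: "real \<times> 'b::real_normed_vector \<Rightarrow> real"
  assumes "h differentiable (at (r, y))"
  shows "((\<lambda>s. h (s, y)) has_real_derivative pd h (1, 0) (r, y)) (at r)"
proof -
  have D: "(h has_derivative frechet_derivative h (at (r, y))) (at (r, y))"
    using assms by (simp add: frechet_derivative_works)
  have "((\<lambda>s. h (s, y)) has_derivative (\<lambda>t. pd h (t, 0) (r, y))) (at r)"
    by (rule has_derivative_compose[where f = "\<lambda>s. (s, y)" and g = h, OF _ D]) (auto intro!: derivative_eq_intros)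
  moreover have "(\<lambda>t. pd h (t, 0) (r, y)) = (\<lambda>t. pd h (1, 0) (r, y) * t)"
  proof
    show "pd h (t, 0) (r, y) = pd h (1, 0) (r, y) * t" for t
      using linear_cmul[OF has_derivative_linear[OF D], of t "(1, 0)"] by simp
  qed
  ultimately show ?thesis unfolding has_field_derivative_def by metis
qed

lemma pd_snd:
  fixes h :: "real \<times> 'b::real_normed_vector \<Rightarrow> 'c::real_normed_vector"
  assumes "h differentiable (at (r, y))"
  shows "((\<lambda>y. h (r, y)) has_derivative (\<lambda>v. pd h (0, v) (r, y))) (at y)"
    and "pd (\<lambda>y. h (r, y)) v y = pd h (0, v) (r, y)"
proof -
  have D: "(h has_derivative frechet_derivative h (at (r, y))) (at (r, y))"
    using assms by (simp add: frechet_derivative_works)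
  show *: "((\<lambda>y. h (r, y)) has_derivative (\<lambda>v. pd h (0, v) (r, y))) (at y)"
    by (rule has_derivative_compose[where f = "\<lambda>y. (r, y)" and g = h, OF _ D]) (auto intro!: derivative_eq_intros)
  show "pd (\<lambda>y. h (r, y)) v y = pd h (0, v) (r, y)"
    using frechet_derivative_at[OF *] by metis
qed

lemma Ck_on_slice:
  fixes h :: "real \<times> 'b::real_normed_vector \<Rightarrow> 'c::real_normed_vector"
  assumes h: "Ck_on k (U \<times> V) h" and r: "r \<in> U" and V: "open V"
  shows "Ck_on k V (\<lambda>y. h (r, y))"
  using h
proof (induction k arbitrary: h)
  case 0
  then show ?case using r by (auto intro!: continuous_intros elim!: continuous_on_compose2)
next
  case (Suc k)
  have d: "h differentiable (at (r, y))" if "y \<in> V" for y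
    using Suc.prems that r by (simp add: Ck_on.simps(2))
  have "Ck_on k V (pd (\<lambda>y. h (r, y)) v)" for v
  proof (rule Ck_on_cong_open[OF V])
    show "Ck_on k V (\<lambda>y. pd h (0, v) (r, y))"
      using Suc.IH[of "pd h (0, v)"] Suc.prems by (simp add: Ck_on.simps(2))
    show "pd h (0, v) (r, y) = pd (\<lambda>y. h (r, y)) v y" if "y \<in> V" for y
      using pd_snd(2)[OF d[OF that]] by metis
  qed
  then show ?case using pd_snd(1)[OF d] by (auto simp: Ck_on.simps(2) differentiable_def)
qed

context riemannian_manifold
begin

text \<open>Regularity is joint in radius and point, in the product charts of the cone; this is what
  exchanging mixed derivatives requires.\<close>

definition Ck_end :: "real \<Rightarrow> nat \<Rightarrow> (real \<Rightarrow> 'a \<Rightarrow> real) \<Rightarrow> bool" where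
  "Ck_end r0 k f \<longleftrightarrow>
     (\<forall>c\<in>A. Ck_on k ({r0<..} \<times> chart_img c) (\<lambda>p. f (fst p) (chart_inv c (snd p))))"

definition radial :: "(real \<Rightarrow> 'a \<Rightarrow> real) \<Rightarrow> real \<Rightarrow> 'a \<Rightarrow> real" where
  "radial f r z = deriv (\<lambda>t. f t z) r"

lemma end_open: "c \<in> A \<Longrightarrow> open ({r0 :: real<..} \<times> chart_img c)"
  by (intro open_Times img_open) auto

lemma Ck_end_Suc_D: "Ck_end r0 (Suc k) f \<Longrightarrow> Ck_end r0 k f"
  by (auto simp: Ck_end_def Ck_on_Suc_D)

lemma Ck_end_differentiable:
  "Ck_end r0 (Suc k) f \<Longrightarrow> c \<in> A \<Longrightarrow> r > r0 \<Longrightarrow> y \<in> chart_img c \<Longrightarrow>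
    (\<lambda>p. f (fst p) (chart_inv c (snd p))) differentiable (at (r, y))"
  by (auto simp: Ck_end_def Ck_on.simps(2))

lemma radial_chart:
  assumes f: "Ck_end r0 (Suc k) f" and c: "c \<in> A" and r: "r > r0" and y: "y \<in> chart_img c"
  shows "((\<lambda>t. f t (chart_inv c y)) has_real_derivative radial f r (chart_inv c y)) (at r)"
    and "radial f r (chart_inv c y) = pd (\<lambda>p. f (fst p) (chart_inv c (snd p))) (1, 0) (r, y)"
proof -
  have *: "((\<lambda>t. f t (chart_inv c y)) has_real_derivative
      pd (\<lambda>p. f (fst p) (chart_inv c (snd p))) (1, 0) (r, y)) (at r)"
    using pd_fst[OF Ck_end_differentiable[OF f c r y]] by simp
  show "radial f r (chart_inv c y) = pd (\<lambda>p. f (fst p) (chart_inv c (snd p))) (1, 0) (r, y)"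
    using DERIV_imp_deriv[OF *] by (simp add: radial_def)
  with * show "((\<lambda>t. f t (chart_inv c y)) has_real_derivative radial f r (chart_inv c y)) (at r)"
    by simp
qed

lemma radial_derivative:
  assumes f: "Ck_end r0 (Suc k) f" and r: "r > r0" and z: "z \<in> M"
  shows "((\<lambda>t. f t z) has_real_derivative radial f r z) (at r)"
proof -
  obtain c where c: "c \<in> A" "z \<in> chart_dom c" using z cover by auto
  show ?thesis
    using radial_chart(1)[OF f c(1) r chart_map_img[OF c]] by (simp add: chart_inv_map[OF c])
qed

lemma Ck_end_radial:
  assumes f: "Ck_end r0 (Suc k) f"
  shows "Ck_end r0 k (radial f)"
  unfolding Ck_end_def
proof
  fix c assume c: "c \<in> A"
  show "Ck_on k ({r0<..} \<times> chart_img c) (\<lambda>p. radial f (fst p) (chart_inv c (snd p)))"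
  proof (rule Ck_on_cong_open[OF end_open[OF c]])
    show "Ck_on k ({r0<..} \<times> chart_img c) (pd (\<lambda>p. f (fst p) (chart_inv c (snd p))) (1, 0))"
      using f c by (simp add: Ck_end_def Ck_on.simps(2))
    show "pd (\<lambda>p. f (fst p) (chart_inv c (snd p))) (1, 0) p = radial f (fst p) (chart_inv c (snd p))"
      if "p \<in> {r0<..} \<times> chart_img c" for p
      using radial_chart(2)[OF f c, of "fst p" "snd p"] that by (cases p) auto
  qed
qed

lemma Ck_end_slice:
  assumes f: "Ck_end r0 k f" and r: "r > r0"
  shows "Ck_on_manifold k A M (f r)"
  unfolding Ck_on_manifold_iff
proof
  fix c assume c: "c \<in> A"
  show "Ck_on k (chart_img c) (f r \<circ> chart_inv c)"
    using Ck_on_slice[of k "{r0<..}" "chart_img c" "\<lambda>p. f (fst p) (chart_inv c (snd p))" r] f c r img_open[OF c]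
    by (simp add: Ck_end_def o_def)
qed

lemma Ck_end_0_slice: "Ck_end r0 0 f \<Longrightarrow> r > r0 \<Longrightarrow> continuous_on M (f r)"
  by (rule continuous_on_M) (use Ck_end_slice[of r0 0 f r] in \<open>auto simp: Ck_on_manifold_iff o_def\<close>)

lemma Ck_end_continuous:
  assumes f: "Ck_end r0 k f" and c: "c \<in> A"
  shows "continuous_on ({r0<..} \<times> chart_img c) (\<lambda>p. f (fst p) (chart_inv c (snd p)))"
proof -
  have "Ck_on k ({r0<..} \<times> chart_img c) (\<lambda>p. f (fst p) (chart_inv c (snd p)))"
    using f c by (simp add: Ck_end_def)
  then show ?thesis
    by (induction k) (auto dest: Ck_on_Suc_D)
qed

lemma pd_slice:
  assumes f: "Ck_end r0 (Suc k) f" and c: "c \<in> A" and r: "r > r0" and y: "y \<in> chart_img c"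
  shows "pd (f r \<circ> chart_inv c) v y = pd (\<lambda>p. f (fst p) (chart_inv c (snd p))) (0, v) (r, y)"
  using pd_snd(2)[OF Ck_end_differentiable[OF f c r y], of v] by (simp add: o_def)

text \<open>Symmetry of the second derivatives in the directions \<open>(1, 0)\<close> and
  \<open>(0, v)\<close>.\<close>

lemma D_pd_slice:
  assumes f: "Ck_end r0 (Suc (Suc 0)) f" and c: "c \<in> A" and r: "r > r0" and y: "y \<in> chart_img c"
  shows "((\<lambda>s. pd (f s \<circ> chart_inv c) v y) has_real_derivative pd (radial f r \<circ> chart_inv c) v y) (at r)"
proof -
  let ?f = "\<lambda>p. f (fst p) (chart_inv c (snd p))"
  let ?S = "{r0<..} \<times> chart_img c"
  have C2: "C2_on ?S ?f" using f c by (simp add: Ck_end_def)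
  then have C1: "C1_on ?S (pd ?f (0, v))" by (simp add: Ck_on.simps(2)[of "Suc 0"])
  have p: "(r, y) \<in> ?S" using r y by simp
  have "pd ?f (0, v) differentiable (at (r, y))" using C1 p by (simp add: Ck_on.simps(2))
  from pd_fst[OF this]
  have "((\<lambda>s. pd ?f (0, v) (s, y)) has_real_derivative pd (pd ?f (0, v)) (1, 0) (r, y)) (at r)" .
  also have "pd (pd ?f (0, v)) (1, 0) (r, y) = pd (pd ?f (1, 0)) (0, v) (r, y)"
    by (rule pd_commute[OF end_open[OF c] C2 p])
  also have "\<dots> = pd (\<lambda>p. radial f (fst p) (chart_inv c (snd p))) (0, v) (r, y)"
  proof -
    have "frechet_derivative (pd ?f (1, 0)) (at (r, y)) =
        frechet_derivative (\<lambda>p. radial f (fst p) (chart_inv c (snd p))) (at (r, y))"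
    proof (rule frechet_derivative_transform_within_open[OF _ end_open[OF c] p])
      show "pd ?f (1, 0) differentiable (at (r, y))"
        using C2 p by (simp add: Ck_on.simps(2))
      show "pd ?f (1, 0) q = radial f (fst q) (chart_inv c (snd q))" if "q \<in> ?S" for q
        using radial_chart(2)[OF f c, of "fst q" "snd q"] that by (cases q) auto
    qed
    then show ?thesis by simp
  qed
  also have "\<dots> = pd (radial f r \<circ> chart_inv c) v y"
    by (rule pd_slice[OF Ck_end_radial[OF f] c r y, symmetric])
  finally show ?thesis
  proof (rule has_field_derivative_transform_within_open[of _ _ _ "{r0<..}"])
    show "pd ?f (0, v) (s, y) = pd (f s \<circ> chart_inv c) v y" if "s \<in> {r0<..}" for s
      using pd_slice[OF f c _ y, of s v] that by simp
  qed (use r in auto)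
qed

lemma grad_inner_commute:
  assumes f: "C1_M f" and g: "C1_M g" and z: "z \<in> M"
  shows "grad_inner f g z = grad_inner g f z"
proof -
  obtain c where c: "c \<in> A" "z \<in> chart_dom c" using z cover by auto
  have y: "chart_map c z \<in> chart_img c" by (rule chart_map_img[OF c])
  show ?thesis
    unfolding grad_inner_eq[OF f g c] grad_inner_eq[OF g f c]
      chart_inner_metric[OF c(1) y C1_differentiable[OF f c(1) y] C1_differentiable[OF g c(1) y]]
      chart_inner_metric[OF c(1) y C1_differentiable[OF g c(1) y] C1_differentiable[OF f c(1) y]]
    by (rule metric_sym[OF c(1) y])
qed

text \<open>The metric of the section does not depend on the radius, so only the two copies of
  \<open>f\<close> are differentiated; symmetry makes their contributions equal.\<close>

lemma D_grad_inner:
  assumes f: "Ck_end r0 (Suc (Suc 0)) f" and r: "r > r0" and z: "z \<in> M"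
  shows "((\<lambda>s. grad_inner (f s) (f s) z) has_real_derivative 2 * grad_inner (f r) (radial f r) z) (at r)"
proof -
  obtain c where c: "c \<in> A" "z \<in> chart_dom c" using z cover by auto
  let ?y = "chart_map c z"
  let ?g = "\<lambda>i j. chart_dual c ?y i \<bullet> j"
  have y: "?y \<in> chart_img c" by (rule chart_map_img[OF c])
  have f1: "C1_M (f s)" if "s > r0" for s
    by (rule Ck_end_slice[OF Ck_end_Suc_D[OF f] that])
  have g1: "C1_M (radial f r)"
    by (rule Ck_end_slice[OF Ck_end_radial[OF f] r])
  note fd = C1_differentiable[OF f1[OF r] c(1) y] and gd = C1_differentiable[OF g1 c(1) y]
  have "((\<lambda>s. \<Sum>i\<in>Basis. \<Sum>j\<in>Basis. pd (f s \<circ> chart_inv c) i ?y * pd (f s \<circ> chart_inv c) j ?y * ?g i j)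
      has_real_derivative (\<Sum>i\<in>Basis. \<Sum>j\<in>Basis.
        (pd (f r \<circ> chart_inv c) i ?y * pd (radial f r \<circ> chart_inv c) j ?y +
         pd (radial f r \<circ> chart_inv c) i ?y * pd (f r \<circ> chart_inv c) j ?y) * ?g i j)) (at r)"
    by (intro DERIV_sum DERIV_cmult_right DERIV_mult' D_pd_slice[OF f c(1) r y])
  also have "(\<Sum>i\<in>Basis. \<Sum>j\<in>Basis.
        (pd (f r \<circ> chart_inv c) i ?y * pd (radial f r \<circ> chart_inv c) j ?y +
         pd (radial f r \<circ> chart_inv c) i ?y * pd (f r \<circ> chart_inv c) j ?y) * ?g i j) =
      grad_inner (f r) (radial f r) z + grad_inner (radial f r) (f r) z"
    unfolding grad_inner_eq[OF f1[OF r] g1 c] grad_inner_eq[OF g1 f1[OF r] c]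
      chart_inner_eq[OF c(1) y fd gd] chart_inner_eq[OF c(1) y gd fd]
    by (simp add: distrib_right sum.distrib)
  also have "\<dots> = 2 * grad_inner (f r) (radial f r) z"
    using grad_inner_commute[OF f1[OF r] g1 z] by simp
  finally show ?thesis
  proof (rule has_field_derivative_transform_within_open[of _ _ _ "{r0<..}"])
    show "(\<Sum>i\<in>Basis. \<Sum>j\<in>Basis. pd (f s \<circ> chart_inv c) i ?y * pd (f s \<circ> chart_inv c) j ?y * ?g i j) =
        grad_inner (f s) (f s) z" if "s \<in> {r0<..}" for s
      using that f1[of s] by (simp add: grad_inner_eq[OF _ _ c] chart_inner_eq[OF c(1) y] C1_differentiable[OF _ c(1) y])
  qed (use r in auto)
qed

lemma grad_inner_end_continuous:
  assumes f: "Ck_end r0 (Suc 0) f" and g: "Ck_end r0 (Suc 0) g" and c: "c \<in> A"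
  shows "continuous_on ({r0<..} \<times> chart_img c) (\<lambda>p. grad_inner (f (fst p)) (g (fst p)) (chart_inv c (snd p)))"
proof (rule continuous_on_eq)
  let ?f = "\<lambda>p. f (fst p) (chart_inv c (snd p))" and ?g = "\<lambda>p. g (fst p) (chart_inv c (snd p))"
  have "C1_on ({r0<..} \<times> chart_img c) ?f" using f c by (simp add: Ck_end_def)
  note Cf = C1_on_continuous_pd[OF this]
  have "C1_on ({r0<..} \<times> chart_img c) ?g" using g c by (simp add: Ck_end_def)
  note Cg = C1_on_continuous_pd[OF this]
  show "continuous_on ({r0<..} \<times> chart_img c) (\<lambda>p. \<Sum>i\<in>Basis. \<Sum>j\<in>Basis.
      pd ?f (0, i) p * pd ?g (0, j) p * (chart_dual c (snd p) i \<bullet> j))"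
    by (intro continuous_intros Cf Cg
        continuous_on_compose2[OF C1_on_continuous[OF chart_dual_C1[OF c]] continuous_on_snd]) auto
  fix p assume "p \<in> {r0<..} \<times> chart_img c"
  then obtain r y where p: "p = (r, y)" "r > r0" "y \<in> chart_img c" by auto
  have f1: "C1_M (f r)" "C1_M (g r)"
    using Ck_end_slice f g p by auto
  show "(\<Sum>i\<in>Basis. \<Sum>j\<in>Basis. pd ?f (0, i) p * pd ?g (0, j) p * (chart_dual c (snd p) i \<bullet> j)) =
      grad_inner (f (fst p)) (g (fst p)) (chart_inv c (snd p))"
    using p f1 by (simp add: grad_inner_eq[OF _ _ c chart_inv_dom[OF c]] chart_map_inv[OF c]
        chart_inner_eq[OF c] C1_differentiable[OF _ c] pd_slice[OF f c] pd_slice[OF g c])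
qed

end

section \<open>Gradient, density and Laplacian of the cone\<close>

lemma C1_on_fst: "C1_on S fst"
  by (rule C1_onI[where f' = "\<lambda>x v. fst v"]) (auto intro!: derivative_eq_intros)

lemma C1_on_snd: "C1_on S snd"
  by (rule C1_onI[where f' = "\<lambda>x v. snd v"]) (auto intro!: derivative_eq_intros)

lemma sum_Basis_real_prod:
  "(\<Sum>i\<in>(Basis :: (real \<times> 'b::euclidean_space) set). F i) = F (1, 0) + (\<Sum>j\<in>Basis. F (0, j))"
proof -
  have "(Basis :: (real \<times> 'b) set) = insert (1, 0) (Pair 0 ` Basis)"
    by (auto simp: Basis_prod_def)
  moreover have "(1, 0) \<notin> Pair 0 ` (Basis :: 'b set)" by auto
  ultimately have "(\<Sum>i\<in>(Basis :: (real \<times> 'b) set). F i) = F (1, 0) + (\<Sum>i\<in>Pair 0 ` Basis. F i)"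
    by (metis finite_Basis finite_imageI sum.insert)
  then show ?thesis by (simp add: sum.reindex inj_on_def)
qed

lemma hyp_cone_chart_simps:
  "chart_dom (hyp_cone_chart c) = {0<..} \<times> chart_dom c"
  "chart_map (hyp_cone_chart c) (r, x) = (r, chart_map c x)"
  "chart_inv (hyp_cone_chart c) = (\<lambda>p. (fst p, chart_inv c (snd p)))"
  "chart_metric (hyp_cone_chart c) (r, y) (a, v) (b, w) = a * b + (sinh r)\<^sup>2 * chart_metric c y v w"
  by (auto simp: hyp_cone_chart_def fun_eq_iff)

context riemannian_manifold
begin

lemma Ck_end_of_cone:
  assumes r0: "r0 \<ge> 0" and u: "Ck_on_manifold k (hyp_cone_atlas A) (conical_end M r0) u"
  shows "Ck_end r0 k (\<lambda>r z. u (r, z))"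
  unfolding Ck_end_def
proof
  fix c assume c: "c \<in> A"
  have "chart_map (hyp_cone_chart c) ` (chart_dom (hyp_cone_chart c) \<inter> conical_end M r0) = {r0<..} \<times> chart_img c"
  proof -
    have "chart_dom (hyp_cone_chart c) \<inter> conical_end M r0 = {r0<..} \<times> chart_dom c"
      using dom_subset[OF c] r0 by (auto simp: hyp_cone_chart_simps conical_end_def)
    then show ?thesis by (force simp: hyp_cone_chart_simps chart_img_def)
  qed
  moreover have "hyp_cone_chart c \<in> hyp_cone_atlas A" using c by (simp add: hyp_cone_atlas_def)
  ultimately have "Ck_on k ({r0<..} \<times> chart_img c) (u \<circ> chart_inv (hyp_cone_chart c))"
    using u by (auto simp: Ck_on_manifold_def)
  then show "Ck_on k ({r0<..} \<times> chart_img c) (\<lambda>p. u (fst p, chart_inv c (snd p)))"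
    by (simp add: hyp_cone_chart_simps o_def)
qed

text \<open>The cone metric is block diagonal, so the radial and angular parts decouple; raising an
  angular index divides by \<open>(sinh r)\<^sup>2\<close>.\<close>

lemma cone_chart_grad:
  assumes u: "Ck_end r0 (Suc 0) (\<lambda>r z. u (r, z))" and r0: "r0 \<ge> 0" and c: "c \<in> A"
    and r: "r > r0" and y: "y \<in> chart_img c"
  shows "chart_grad (hyp_cone_chart c) u (r, y) =
    (radial (\<lambda>r z. u (r, z)) r (chart_inv c y), (1 / (sinh r)\<^sup>2) *\<^sub>R chart_grad c (\<lambda>z. u (r, z)) y)"
proof -
  let ?f = "\<lambda>p. u (fst p, chart_inv c (snd p))"
  let ?g = "chart_metric c y"
  have s: "(sinh r)\<^sup>2 > 0" using r r0 by simp
  note B = metric_bilinear[OF c y]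
  have fd: "?f differentiable (at (r, y))" using Ck_end_differentiable[OF u c r y] by simp
  then have lin: "linear (frechet_derivative ?f (at (r, y)))"
    by (simp add: frechet_derivative_works has_derivative_linear)
  have rad: "radial (\<lambda>r z. u (r, z)) r (chart_inv c y) = pd ?f (1, 0) (r, y)"
    using radial_chart(2)[OF u c r y] by simp
  have u1: "((\<lambda>z. u (r, z)) \<circ> chart_inv c) differentiable (at y)"
    by (rule C1_differentiable[OF Ck_end_slice[OF u r] c y])
  have sl: "pd ((\<lambda>z. u (r, z)) \<circ> chart_inv c) v y = pd ?f (0, v) (r, y)" for v
    using pd_slice[OF u c r y] by simp
  have split: "pd ?f (b, w) (r, y) = b * pd ?f (1, 0) (r, y) + pd ?f (0, w) (r, y)" for b w
    using linear_add[OF lin, of "(b, 0)" "(0, w)"] linear_cmul[OF lin, of b "(1, 0)"] by simp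
  show ?thesis
    unfolding chart_grad_def[of "hyp_cone_chart c"]
  proof (rule the_equality, intro allI)
    fix v :: "real \<times> 'b"
    obtain b w where v: "v = (b, w)" by (cases v)
    show "chart_metric (hyp_cone_chart c) (r, y)
        (radial (\<lambda>r z. u (r, z)) r (chart_inv c y), (1 / (sinh r)\<^sup>2) *\<^sub>R chart_grad c (\<lambda>z. u (r, z)) y) v =
        pd (u \<circ> chart_inv (hyp_cone_chart c)) v (r, y)"
      using s unfolding v hyp_cone_chart_simps o_def split[of b w] rad
      by (simp add: bilinear_lmul[OF B] chart_grad_metric[OF c y u1] sl)
  next
    fix W :: "real \<times> 'b"
    assume W: "\<forall>v. chart_metric (hyp_cone_chart c) (r, y) W v = pd (u \<circ> chart_inv (hyp_cone_chart c)) v (r, y)"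
    obtain a w where aw: "W = (a, w)" by (cases W)
    have W': "a * b + (sinh r)\<^sup>2 * ?g w v = pd ?f (b, v) (r, y)" for b v
      using W[rule_format, of "(b, v)"] by (simp add: aw hyp_cone_chart_simps o_def)
    have "a = pd ?f (1, 0) (r, y)" using W'[of 1 0] by (simp add: bilinear_rzero[OF B])
    moreover have "chart_grad c (\<lambda>z. u (r, z)) y = (sinh r)\<^sup>2 *\<^sub>R w"
      by (rule chart_grad_unique[OF c y u1]) (use W'[of 0] in \<open>simp add: bilinear_lmul[OF B] sl\<close>)
    ultimately show "W = (radial (\<lambda>r z. u (r, z)) r (chart_inv c y), (1 / (sinh r)\<^sup>2) *\<^sub>R chart_grad c (\<lambda>z. u (r, z)) y)"
      using s by (simp add: aw rad)
  qed
qed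

lemma cone_vol_density:
  assumes c: "c \<in> A" and r: "r > 0" and y: "y \<in> chart_img c"
  shows "vol_density (hyp_cone_chart c) (r, y) = sinh r ^ DIM('b) * vol_density c y"
proof -
  note B = metric_bilinear[OF c y]
  have "gram_det (chart_metric (hyp_cone_chart c) (r, y)) = ((sinh r)\<^sup>2) ^ DIM('b) * gram_det (chart_metric c y)"
    by (rule gram_det_prod)
      (simp_all add: hyp_cone_chart_simps bilinear_lzero[OF B] bilinear_rzero[OF B])
  moreover have "sqrt (((sinh r)\<^sup>2) ^ DIM('b)) = sinh r ^ DIM('b)"
    using r by (simp add: real_sqrt_power)
  ultimately show ?thesis by (simp add: vol_density_def real_sqrt_mult)
qed

lemma C1_on_product_snd:
  fixes h :: "'b \<Rightarrow> real"
  assumes "C1_on (chart_img c) h"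
  shows "C1_on ({r0<..} \<times> chart_img c) (\<lambda>p. h (snd p))"
  by (rule C1_on_compose[OF assms C1_on_snd]) auto

text \<open>The density is \<open>sinh r ^ DIM('b)\<close> times that of the section.
  Differentiating this power in the radius produces the first-order term with
  \<open>cosh r / sinh r\<close>, while in angular directions the powers of \<open>sinh r\<close>
  are constants.\<close>

lemma cone_chart_laplacian:
  assumes u: "Ck_end r0 (Suc (Suc 0)) (\<lambda>r z. u (r, z))" and r0: "r0 \<ge> 0" and c: "c \<in> A"
    and r: "r > r0" and y: "y \<in> chart_img c"
  shows "chart_div (hyp_cone_chart c) (chart_grad (hyp_cone_chart c) u) (r, y) =
    radial (radial (\<lambda>r z. u (r, z))) r (chart_inv c y)
    + real DIM('b) * (cosh r / sinh r) * radial (\<lambda>r z. u (r, z)) r (chart_inv c y)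
    + chart_div c (chart_grad c (\<lambda>z. u (r, z))) y / (sinh r)\<^sup>2"
proof -
  let ?d = "hyp_cone_chart c" and ?m = "DIM('b)"
  let ?f = "\<lambda>p. u (fst p, chart_inv c (snd p))"
  let ?S = "{r0<..} \<times> chart_img c"
  let ?ur = "radial (\<lambda>r z. u (r, z))"
  let ?h = "\<lambda>i p. vol_density ?d p * (chart_grad ?d u p \<bullet> i)"
  have u1: "Ck_end r0 (Suc 0) (\<lambda>r z. u (r, z))" using Ck_end_Suc_D[OF u] .
  have ur1: "Ck_end r0 (Suc 0) ?ur" by (rule Ck_end_radial[OF u])
  have S: "open ?S" by (rule end_open[OF c])
  have p: "(r, y) \<in> ?S" using r y by simp
  have rpos: "r > 0" using r r0 by simp
  have sh: "sinh r > 0" using rpos by simp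
  have V1: "C1_on ?S (\<lambda>p. vol_density c (snd p))"
    by (rule C1_on_product_snd[OF vol_density_C1[OF c]])
  have sinh1: "C1_on ?S (\<lambda>p. sinh (fst p) ^ ?m)"
    by (rule C1_on_real_compose[OF C1_on_fst, where h = "\<lambda>s. sinh s ^ ?m"
          and h' = "\<lambda>s. real ?m * (cosh s * sinh s ^ (?m - 1))"])
      (auto intro!: derivative_eq_intros continuous_intros)
  have inv1: "C1_on ?S (\<lambda>p. 1 / (sinh (fst p))\<^sup>2)"
    by (rule C1_on_real_compose[OF C1_on_fst, where h = "\<lambda>s. 1 / (sinh s)\<^sup>2"
          and h' = "\<lambda>s. - (2 * cosh s / (sinh s) ^ 3)"])
      (use r0 in \<open>auto intro!: derivative_eq_intros continuous_intros simp: power2_eq_square power3_eq_cube field_simps\<close>)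
  have grad: "chart_grad ?d u q = (?ur (fst q) (chart_inv c (snd q)),
      (1 / (sinh (fst q))\<^sup>2) *\<^sub>R chart_grad c (\<lambda>z. u (fst q, z)) (snd q))" if "q \<in> ?S" for q
    using that cone_chart_grad[OF u1 r0 c, of "fst q" "snd q"] by (cases q) auto
  have vol: "vol_density ?d q = sinh (fst q) ^ ?m * vol_density c (snd q)" if "q \<in> ?S" for q
    using that r0 cone_vol_density[OF c, of "fst q" "snd q"] by (cases q) auto
  have uC: "C2_on ?S ?f" using u c by (simp add: Ck_end_def)
  have gradc: "chart_grad c (\<lambda>z. u (s, z)) y' = (\<Sum>i\<in>Basis. pd ?f (0, i) (s, y') *\<^sub>R chart_dual c y' i)"
    if "s > r0" "y' \<in> chart_img c" for s y'
    using chart_grad_eq[OF c that(2) C1_differentiable[OF Ck_end_slice[OF u1 that(1)] c that(2)]]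
      pd_slice[OF u1 c that] by simp
  have h1C: "C1_on ?S (?h (1, 0))"
  proof (rule Ck_on_cong_open[OF S])
    show "C1_on ?S (\<lambda>p. sinh (fst p) ^ ?m * vol_density c (snd p) * ?ur (fst p) (chart_inv c (snd p)))"
      using ur1 c by (intro C1_on_mult sinh1 V1) (simp add: Ck_end_def)
  qed (simp add: grad vol)
  have h2C: "C1_on ?S (?h (0, j))" for j
  proof (rule Ck_on_cong_open[OF S])
    have "C1_on ?S (pd ?f (0, i))" for i
      using uC by (simp add: Ck_on.simps(2)[of "Suc 0"])
    then show "C1_on ?S (\<lambda>p. sinh (fst p) ^ ?m * vol_density c (snd p) * (1 / (sinh (fst p))\<^sup>2 *
        (\<Sum>i\<in>Basis. pd ?f (0, i) p * (chart_dual c (snd p) i \<bullet> j))))"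
      by (intro C1_on_mult sinh1 V1 inv1 C1_on_sum C1_on_product_snd chart_dual_C1 c)
    show "sinh (fst q) ^ ?m * vol_density c (snd q) * (1 / (sinh (fst q))\<^sup>2 *
        (\<Sum>i\<in>Basis. pd ?f (0, i) q * (chart_dual c (snd q) i \<bullet> j))) = ?h (0, j) q" if "q \<in> ?S" for q
      using that gradc[of "fst q" "snd q"] grad[OF that] vol[OF that] by (cases q) (simp add: inner_sum_left)
  qed
  have T1: "pd (?h (1, 0)) (1, 0) (r, y) = sinh r ^ ?m * vol_density c y *
      (radial ?ur r (chart_inv c y) + real ?m * (cosh r / sinh r) * ?ur r (chart_inv c y))"
  proof (rule DERIV_unique)
    show "((\<lambda>s. ?h (1, 0) (s, y)) has_real_derivative pd (?h (1, 0)) (1, 0) (r, y)) (at r)"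
      by (rule pd_fst) (use h1C p in \<open>simp add: Ck_on.simps(2)\<close>)
    have "((\<lambda>s. sinh s ^ ?m * vol_density c y * ?ur s (chart_inv c y)) has_real_derivative
        sinh r ^ ?m * vol_density c y *
        (radial ?ur r (chart_inv c y) + real ?m * (cosh r / sinh r) * ?ur r (chart_inv c y))) (at r)"
    proof -
      \<comment> \<open>\<open>DIM('b)\<close> is at least 1, so the subtraction in the exponent is
        not truncated.\<close>
      have m: "sinh r ^ (?m - 1) * sinh r = sinh r ^ ?m"
        by (metis DIM_positive power_minus_mult)
      have "((\<lambda>s. sinh s ^ ?m) has_real_derivative real ?m * (cosh r / sinh r) * sinh r ^ ?m) (at r)"
        using sh by (auto intro!: derivative_eq_intros simp: m[symmetric])
      from DERIV_mult[OF DERIV_cmult_right[OF this, of "vol_density c y"] radial_chart(1)[OF ur1 c r y]]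
      show ?thesis by (simp add: algebra_simps)
    qed
    then show "((\<lambda>s. ?h (1, 0) (s, y)) has_real_derivative sinh r ^ ?m * vol_density c y *
        (radial ?ur r (chart_inv c y) + real ?m * (cosh r / sinh r) * ?ur r (chart_inv c y))) (at r)"
      by (rule has_field_derivative_transform_within_open[of _ _ _ "{r0<..}"])
        (use r y in \<open>auto simp: grad vol\<close>)
  qed
  have T2: "pd (?h (0, j)) (0, j) (r, y) =
      sinh r ^ ?m / (sinh r)\<^sup>2 * pd (\<lambda>y. vol_density c y * (chart_grad c (\<lambda>z. u (r, z)) y \<bullet> j)) j y" for j
  proof -
    let ?k = "\<lambda>y. vol_density c y * (chart_grad c (\<lambda>z. u (r, z)) y \<bullet> j)"
    have "C2_on (chart_img c) ((\<lambda>z. u (r, z)) \<circ> chart_inv c)"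
      using C1_on_chart[OF Ck_end_slice[OF u r] c] .
    then have "C1_on (chart_img c) ?k" by (rule C2_vol_grad_C1[OF c])
    then have "(?k has_derivative frechet_derivative ?k (at y)) (at y)" using y by (rule C1_on_has_derivative)
    then have "((\<lambda>y. sinh r ^ ?m / (sinh r)\<^sup>2 * ?k y) has_derivative
        (\<lambda>v. sinh r ^ ?m / (sinh r)\<^sup>2 * pd ?k v y)) (at y)"
      by (rule has_derivative_mult_right)
    then have "((\<lambda>y. ?h (0, j) (r, y)) has_derivative (\<lambda>v. sinh r ^ ?m / (sinh r)\<^sup>2 * pd ?k v y)) (at y)"
      by (rule has_derivative_transform_within_open[OF _ img_open[OF c] y])
        (use r in \<open>simp add: grad vol\<close>)
    from frechet_derivative_at[OF this]
    have "pd (\<lambda>y. ?h (0, j) (r, y)) j y = sinh r ^ ?m / (sinh r)\<^sup>2 * pd ?k j y" by metis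
    moreover have "pd (\<lambda>y. ?h (0, j) (r, y)) j y = pd (?h (0, j)) (0, j) (r, y)"
      by (rule pd_snd(2)) (use h2C p in \<open>simp add: Ck_on.simps(2)\<close>)
    ultimately show ?thesis by simp
  qed
  have vp: "vol_density c y > 0" by (rule vol_density_pos[OF c y])
  have "chart_div ?d (chart_grad ?d u) (r, y) =
      (pd (?h (1, 0)) (1, 0) (r, y) + (\<Sum>j\<in>Basis. pd (?h (0, j)) (0, j) (r, y))) / vol_density ?d (r, y)"
    by (simp add: chart_div_def sum_Basis_real_prod)
  also have "\<dots> = (sinh r ^ ?m * vol_density c y *
      (radial ?ur r (chart_inv c y) + real ?m * (cosh r / sinh r) * ?ur r (chart_inv c y)) +
      sinh r ^ ?m / (sinh r)\<^sup>2 * (\<Sum>j\<in>Basis. pd (\<lambda>y. vol_density c y * (chart_grad c (\<lambda>z. u (r, z)) y \<bullet> j)) j y))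
      / (sinh r ^ ?m * vol_density c y)"
    by (simp only: T1 T2 vol[OF p] sum_distrib_left fst_conv snd_conv)
  also have "(\<Sum>j\<in>Basis. pd (\<lambda>y. vol_density c y * (chart_grad c (\<lambda>z. u (r, z)) y \<bullet> j)) j y) =
      chart_div c (chart_grad c (\<lambda>z. u (r, z))) y * vol_density c y"
    using vp by (simp add: chart_div_def)
  finally show ?thesis using vp sh by (simp add: add_divide_distrib)
qed

text \<open>Whichever chart \<open>chart_at\<close> selects, it is \<open>hyp_cone_chart c\<close>
  for some \<open>c\<close>. Independence of the chart therefore has to be known on the section
  only.\<close>

lemma cone_chart_at:
  assumes "r > 0" "z \<in> M"
  obtains c where "c \<in> A" "z \<in> chart_dom c" "chart_at (hyp_cone_atlas A) (r, z) = hyp_cone_chart c"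
proof -
  obtain c where "c \<in> A" "z \<in> chart_dom c" using assms(2) cover by auto
  then have "\<exists>d. d \<in> hyp_cone_atlas A \<and> (r, z) \<in> chart_dom d"
    using assms(1) by (intro exI[of _ "hyp_cone_chart c"]) (auto simp: hyp_cone_atlas_def hyp_cone_chart_simps)
  from someI_ex[OF this] have "chart_at (hyp_cone_atlas A) (r, z) \<in> hyp_cone_atlas A"
    "(r, z) \<in> chart_dom (chart_at (hyp_cone_atlas A) (r, z))" by (auto simp: chart_at_def)
  then show thesis using that by (auto simp: hyp_cone_atlas_def hyp_cone_chart_simps)
qed

lemma cone_laplacian:
  assumes u: "Ck_end r0 (Suc (Suc 0)) (\<lambda>r z. u (r, z))" and r0: "r0 \<ge> 0"
    and r: "r > r0" and z: "z \<in> M"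
  shows "laplacian (hyp_cone_atlas A) u (r, z) =
    radial (radial (\<lambda>r z. u (r, z))) r z
    + real DIM('b) * (cosh r / sinh r) * radial (\<lambda>r z. u (r, z)) r z
    + laplacian A (\<lambda>z. u (r, z)) z / (sinh r)\<^sup>2"
proof -
  have rpos: "r > 0" using r r0 by simp
  obtain c where c: "c \<in> A" "z \<in> chart_dom c" "chart_at (hyp_cone_atlas A) (r, z) = hyp_cone_chart c"
    by (rule cone_chart_at[OF rpos z])
  show ?thesis
    using cone_chart_laplacian[OF u r0 c(1) r chart_map_img[OF c(1,2)]]
    by (simp add: laplacian_def[of "hyp_cone_atlas A"] Let_def c(3) hyp_cone_chart_simps
        chart_inv_map[OF c(1,2)] laplacian_eq[OF c(1) Ck_end_slice[OF u r] c(2)])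
qed

lemma cone_grad_norm:
  assumes u: "Ck_end r0 (Suc 0) (\<lambda>r z. u (r, z))" and r0: "r0 \<ge> 0"
    and r: "r > r0" and z: "z \<in> M"
  shows "grad_norm (hyp_cone_atlas A) u (r, z) =
    sqrt ((radial (\<lambda>r z. u (r, z)) r z)\<^sup>2 + grad_inner (\<lambda>z. u (r, z)) (\<lambda>z. u (r, z)) z / (sinh r)\<^sup>2)"
proof -
  have rpos: "r > 0" using r r0 by simp
  obtain c where c: "c \<in> A" "z \<in> chart_dom c" "chart_at (hyp_cone_atlas A) (r, z) = hyp_cone_chart c"
    by (rule cone_chart_at[OF rpos z])
  let ?y = "chart_map c z" and ?f = "\<lambda>z. u (r, z)"
  have y: "?y \<in> chart_img c" by (rule chart_map_img[OF c(1,2)])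
  have s: "sinh r > 0" using rpos by simp
  note B = metric_bilinear[OF c(1) y]
  have f1: "C1_M ?f" by (rule Ck_end_slice[OF u r])
  note fd = C1_differentiable[OF f1 c(1) y]
  have "grad_inner ?f ?f z = chart_metric c ?y (chart_grad c ?f ?y) (chart_grad c ?f ?y)"
    unfolding grad_inner_eq[OF f1 f1 c(1,2)] by (rule chart_inner_metric[OF c(1) y fd fd])
  then show ?thesis
    using s
    by (simp add: grad_norm_def Let_def c(3) hyp_cone_chart_simps cone_chart_grad[OF u r0 c(1) r y]
        chart_inv_map[OF c(1,2)] bilinear_lmul[OF B] bilinear_rmul[OF B] power2_eq_square)
qed

end

section \<open>The Carleman inequality in the radial variable\<close>

text \<open>Here \<open>I\<close> is integration over the section, \<open>ur\<close> and \<open>urr\<close> are radial derivatives of \<open>u\<close>, \<open>Lu\<close> is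
  the Laplacian of the section applied to \<open>u\<close>, \<open>G\<close> the squared norm of the gradient along the
  section, and \<open>m\<close> the dimension of the section.\<close>

locale carleman =
  fixes N :: "'a::topological_space set" and I :: "('a \<Rightarrow> real) \<Rightarrow> real" and r0 m C \<kappa> :: real
    and u ur urr Lu G :: "real \<Rightarrow> 'a \<Rightarrow> real" and q1 q2 \<phi> p p' p'' :: "real \<Rightarrow> real"
  assumes I_linear: "\<And>F G a b. continuous_on N F \<Longrightarrow> continuous_on N G \<Longrightarrow>
      I (\<lambda>z. a * F z + b * G z) = a * I F + b * I G"
    and I_nonneg: "\<And>F. continuous_on N F \<Longrightarrow> (\<And>z. z \<in> N \<Longrightarrow> F z \<ge> 0) \<Longrightarrow> I F \<ge> 0"
    and r0: "r0 \<ge> 0" and m: "m \<ge> 0" and C: "C \<ge> 0"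
    and cont: "\<And>r. r > r0 \<Longrightarrow> continuous_on N (u r)" "\<And>r. r > r0 \<Longrightarrow> continuous_on N (ur r)"
      "\<And>r. r > r0 \<Longrightarrow> continuous_on N (urr r)" "\<And>r. r > r0 \<Longrightarrow> continuous_on N (Lu r)"
      "\<And>r. r > r0 \<Longrightarrow> continuous_on N (G r)"
    and D_a: "\<And>r. r > r0 \<Longrightarrow> ((\<lambda>r. I (\<lambda>z. (u r z)\<^sup>2)) has_real_derivative 2 * I (\<lambda>z. u r z * ur r z)) (at r)"
    and D_b: "\<And>r. r > r0 \<Longrightarrow> ((\<lambda>r. I (\<lambda>z. u r z * ur r z)) has_real_derivative
        I (\<lambda>z. (ur r z)\<^sup>2) + I (\<lambda>z. u r z * urr r z)) (at r)"
    and D_c: "\<And>r. r > r0 \<Longrightarrow> ((\<lambda>r. I (\<lambda>z. (ur r z)\<^sup>2)) has_real_derivative 2 * I (\<lambda>z. ur r z * urr r z)) (at r)"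
    and D_G: "\<And>r. r > r0 \<Longrightarrow> ((\<lambda>r. I (G r)) has_real_derivative - 2 * I (\<lambda>z. ur r z * Lu r z)) (at r)"
    and green: "\<And>r. r > r0 \<Longrightarrow> I (\<lambda>z. u r z * Lu r z) = - I (G r)"
    and G_nonneg: "\<And>r z. r > r0 \<Longrightarrow> z \<in> N \<Longrightarrow> G r z \<ge> 0"
    and ineq: "\<And>r z. r > r0 \<Longrightarrow> z \<in> N \<Longrightarrow>
        \<bar>urr r z + m * (cosh r / sinh r) * ur r z + Lu r z / (sinh r)\<^sup>2\<bar> \<le>
        q1 r * \<bar>u r z\<bar> + q2 r * sqrt ((ur r z)\<^sup>2 + G r z / (sinh r)\<^sup>2)"
    and q1: "\<And>r. r > r0 \<Longrightarrow> (q1 r)\<^sup>2 \<le> C * (p r) ^ 3"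
    and q2: "\<And>r. r > r0 \<Longrightarrow> (q2 r)\<^sup>2 \<le> C * p r"
    and D_\<phi>: "\<And>r. r > r0 \<Longrightarrow> (\<phi> has_real_derivative p r) (at r)"
    and D_p: "\<And>r. r > r0 \<Longrightarrow> (p has_real_derivative p' r) (at r)"
    and D_p': "\<And>r. r > r0 \<Longrightarrow> (p' has_real_derivative p'' r) (at r)"
    and p: "\<And>r. r > r0 \<Longrightarrow> p r \<ge> 1" "\<And>r. r > r0 \<Longrightarrow> 0 \<le> p' r" "\<And>r. r > r0 \<Longrightarrow> p' r \<le> p r / 2"
      "\<And>r. r > r0 \<Longrightarrow> \<bar>p'' r\<bar> \<le> p r" "\<And>r. r > r0 \<Longrightarrow> p r \<le> exp (\<kappa> * \<phi> r)"
    and \<phi>: "\<And>r. r > r0 \<Longrightarrow> r \<le> \<phi> r"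
    and decay: "\<And>\<sigma>. ((\<lambda>r. exp (\<sigma> * \<phi> r) * I (\<lambda>z. (u r z)\<^sup>2)) \<longlongrightarrow> 0) at_top"
begin

definition "a r = I (\<lambda>z. (u r z)\<^sup>2)"
definition "b r = I (\<lambda>z. u r z * ur r z)"
definition "c r = I (\<lambda>z. (ur r z)\<^sup>2)"
definition "E r = I (G r)"
definition "k r = cosh r / sinh (r::real)"
definition "S r = 1 / (sinh (r::real))\<^sup>2"
text \<open>The Laplacian of the cone applied to \<open>u\<close>; \<open>m * k r\<close> is the
  mean curvature of the slice at radius \<open>r\<close>.\<close>

definition "F r z = urr r z + m * k r * ur r z + S r * Lu r z"
text \<open>For \<open>w = sinh r powr (m / 2) * exp (\<tau> * \<phi> r) * u\<close> the radial derivative of \<open>w\<close> is the same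
  multiple of \<open>ur + lam * u\<close>, and \<open>\<Omega>\<close> is the square of the factor. \<open>B\<close> collects the boundary terms
  of the integration by parts of \<open>2 * P1 * P2\<close>, and \<open>Q\<close> is the quadratic form left over.\<close>

definition "lam \<tau> r = \<tau> * p r + m / 2 * k r"
definition "bt \<tau> r = - 2 * \<tau> * p r * (c r + 2 * lam \<tau> r * b r + (lam \<tau> r)\<^sup>2 * a r)
    + 2 * \<tau> * p r * (b r + lam \<tau> r * a r) - (\<tau> * p' r + 2 * \<tau> ^ 3 * (p r) ^ 3) * a r
    + 2 * \<tau> * p r * S r * E r"
definition "\<Omega> \<tau> r = exp (2 * \<tau> * \<phi> r + m * ln (sinh r))"
definition "B \<tau> r = \<Omega> \<tau> r * bt \<tau> r"

text \<open>The two parts act on \<open>w\<close>, but are divided by its scalar factor and written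
  in terms of \<open>u\<close>. The summands
  \<open>(lam \<tau> r)\<^sup>2 + (\<tau> * p' r - m / 2 * S r)\<close> come from the second radial
  derivative of \<open>w\<close>, the bracket being the derivative of
  \<open>lam \<tau>\<close>.\<close>

definition "P1 \<tau> r z = urr r z + 2 * lam \<tau> r * ur r z
    + ((lam \<tau> r)\<^sup>2 + (\<tau> * p' r - m / 2 * S r) + \<tau>\<^sup>2 * (p r)\<^sup>2) * u r z + S r * Lu r z"
definition "P2 \<tau> r z = - 2 * \<tau> * p r * (ur r z + lam \<tau> r * u r z) + \<tau> * p r * u r z"
definition "Q \<tau> r z = 2 * \<tau> * (p' r - p r) * (ur r z + lam \<tau> r * u r z)\<^sup>2
    + (2 * \<tau> ^ 3 * (p r) ^ 3 + 6 * \<tau> ^ 3 * (p r)\<^sup>2 * p' r + \<tau> * p'' r) * (u r z)\<^sup>2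
    + 2 * \<tau> * (2 * k r * p r - p r - p' r) * S r * G r z"
text \<open>Its integral times \<open>\<Omega>\<close> is exactly the derivative of
  \<open>B\<close>, so that every estimate of \<open>B\<close> becomes a pointwise estimate of
  \<open>X\<close>.\<close>

definition "X \<tau> r z = 2 * P1 \<tau> r z * P2 \<tau> r z - Q \<tau> r z"

section \<open>Radial derivatives of the weights and of \<open>B\<close>\<close>

lemma rpos: "r > r0 \<Longrightarrow> r > 0" using r0 by simp

lemma sinh_pos: "r > r0 \<Longrightarrow> sinh r > 0" using rpos[of r] by simp

lemma k_sq: "r > r0 \<Longrightarrow> (k r)\<^sup>2 = 1 + S r"
  using sinh_pos[of r] cosh_square_eq[of r] by (simp add: k_def S_def field_simps power_divide)

lemma S_pos: "r > r0 \<Longrightarrow> S r > 0"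
  using sinh_pos[of r] by (simp add: S_def)

lemma k_ge_1: "r > r0 \<Longrightarrow> k r \<ge> 1"
proof -
  assume r: "r > r0"
  have "k r > 0" using sinh_pos[OF r] by (simp add: k_def)
  moreover have "(k r)\<^sup>2 \<ge> 1\<^sup>2" using k_sq[OF r] S_pos[OF r] by simp
  ultimately show "k r \<ge> 1" by (metis less_imp_le power2_le_imp_le)
qed

lemma D_k: "r > r0 \<Longrightarrow> (k has_real_derivative - S r) (at r)"
  unfolding k_def[abs_def] S_def using sinh_pos[of r] cosh_square_eq[of r]
  by (auto intro!: derivative_eq_intros simp: field_simps power2_eq_square)

lemma D_S: "r > r0 \<Longrightarrow> (S has_real_derivative - 2 * k r * S r) (at r)"
  unfolding k_def S_def[abs_def] using sinh_pos[of r]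
  by (auto intro!: derivative_eq_intros simp: field_simps power2_eq_square power4_eq_xxxx)

lemma D_lam: "r > r0 \<Longrightarrow> (lam \<tau> has_real_derivative \<tau> * p' r - m / 2 * S r) (at r)"
  unfolding lam_def[abs_def]
  by (auto intro!: derivative_eq_intros D_p D_k)

lemma D_\<Omega>: "r > r0 \<Longrightarrow> (\<Omega> \<tau> has_real_derivative 2 * lam \<tau> r * \<Omega> \<tau> r) (at r)"
  unfolding \<Omega>_def[abs_def] lam_def k_def using sinh_pos[of r]
  by (auto intro!: derivative_eq_intros D_\<phi> simp: field_simps)

text \<open>The identities between integrals below involve only these eight products, so each
  reduces to a comparison of coefficients. Green's formula enters through the coefficient
  \<open>x6\<close>.\<close>

lemma I_sum8:
  assumes r: "r > r0"
  shows "I (\<lambda>z. x1 * (u r z)\<^sup>2 + x2 * (u r z * ur r z) + x3 * (ur r z)\<^sup>2 + x4 * (u r z * urr r z)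
      + x5 * (ur r z * urr r z) + x6 * (u r z * Lu r z) + x7 * (ur r z * Lu r z) + x8 * G r z) =
    x1 * a r + x2 * b r + x3 * c r + x4 * I (\<lambda>z. u r z * urr r z) + x5 * I (\<lambda>z. ur r z * urr r z)
      + x6 * (- E r) + x7 * I (\<lambda>z. ur r z * Lu r z) + x8 * E r"
proof -
  have add: "I (\<lambda>z. F z + y * H z) = I F + y * I H" if "continuous_on N F" "continuous_on N H" for F H y
    using I_linear[OF that, of 1 y] by simp
  have mul: "I (\<lambda>z. y * H z) = y * I H" if "continuous_on N H" for H y
    using I_linear[OF that that, of y 0] by simp
  show ?thesis
    unfolding a_def b_def c_def E_def green[OF r, symmetric]
    by (simp add: add mul continuous_intros cont[OF r])
qed

lemma I_X:
  assumes r: "r > r0"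
  shows "I (X \<tau> r) =
      (2 * ((lam \<tau> r)\<^sup>2 + (\<tau> * p' r - m / 2 * S r) + \<tau>\<^sup>2 * (p r)\<^sup>2) * (\<tau> * p r - 2 * \<tau> * p r * lam \<tau> r)
        - 2 * \<tau> * (p' r - p r) * (lam \<tau> r)\<^sup>2
        - (2 * \<tau> ^ 3 * (p r) ^ 3 + 6 * \<tau> ^ 3 * (p r)\<^sup>2 * p' r + \<tau> * p'' r)) * a r
    + (4 * lam \<tau> r * (\<tau> * p r - 2 * \<tau> * p r * lam \<tau> r)
        - 4 * \<tau> * p r * ((lam \<tau> r)\<^sup>2 + (\<tau> * p' r - m / 2 * S r) + \<tau>\<^sup>2 * (p r)\<^sup>2)
        - 4 * \<tau> * (p' r - p r) * lam \<tau> r) * b r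
    + (- 8 * lam \<tau> r * \<tau> * p r - 2 * \<tau> * (p' r - p r)) * c r
    + 2 * (\<tau> * p r - 2 * \<tau> * p r * lam \<tau> r) * I (\<lambda>z. u r z * urr r z)
    + (- 4 * \<tau> * p r) * I (\<lambda>z. ur r z * urr r z)
    + 2 * S r * (\<tau> * p r - 2 * \<tau> * p r * lam \<tau> r) * (- E r)
    + (- 4 * \<tau> * p r * S r) * I (\<lambda>z. ur r z * Lu r z)
    + (- 2 * \<tau> * (2 * k r * p r - p r - p' r) * S r) * E r"
  unfolding I_sum8[OF r, symmetric]
  by (rule arg_cong[of _ _ I], rule ext)
    (simp add: X_def P1_def P2_def Q_def, algebra)

text \<open>Integration by parts read backwards: in the derivative of \<open>bt\<close> the products
  with \<open>urr\<close> and \<open>Lu\<close> are those of \<open>2 * P1 * P2\<close>, and what is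
  left over is \<open>Q\<close>.\<close>

lemma D_B:
  assumes r: "r > r0"
  shows "(B \<tau> has_real_derivative \<Omega> \<tau> r * I (X \<tau> r)) (at r)"
proof -
  note d = D_a[OF r, folded a_def b_def] D_b[OF r, folded b_def c_def] D_c[OF r, folded c_def]
    D_G[OF r, folded E_def] D_p[OF r] D_p'[OF r] D_S[OF r] D_lam[OF r] D_\<Omega>[OF r]
  show ?thesis
    unfolding B_def[abs_def] bt_def I_X[OF r]
    by (rule derivative_eq_intros d refl)+
      (simp add: algebra_simps power2_eq_square power3_eq_cube)
qed

section \<open>Absorption of the right-hand side for large \<open>\<tau>\<close>\<close>

lemma X_continuous: "r > r0 \<Longrightarrow> continuous_on N (X \<tau> r)"
  unfolding X_def[abs_def] P1_def P2_def Q_def by (intro continuous_intros cont)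

lemma I_mono:
  assumes "continuous_on N f" "continuous_on N h" "\<And>z. z \<in> N \<Longrightarrow> f z \<le> h z"
  shows "I f \<le> I h"
proof -
  have "I (\<lambda>z. 1 * h z + (-1) * f z) \<ge> 0"
    using assms by (intro I_nonneg continuous_intros) auto
  then show ?thesis using I_linear[OF assms(2,1), of 1 "-1"] by simp
qed

lemma I_cmult: "continuous_on N H \<Longrightarrow> I (\<lambda>z. y * H z) = y * I H"
  using I_linear[of H H y 0] by simp

lemma a_nonneg: "r > r0 \<Longrightarrow> a r \<ge> 0"
  and E_nonneg: "r > r0 \<Longrightarrow> E r \<ge> 0"
  unfolding a_def E_def by (auto intro!: I_nonneg continuous_intros cont G_nonneg)

text \<open>The differential inequality in squared form, with the coefficients measured in powers of
  \<open>p\<close> so that they can be set against the terms of \<open>Q\<close>.\<close>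

lemma F_sq:
  assumes r: "r > r0" and z: "z \<in> N"
  shows "(F r z)\<^sup>2 \<le> 2 * C * (p r) ^ 3 * (u r z)\<^sup>2 + 2 * C * p r * ((ur r z)\<^sup>2 + S r * G r z)"
proof -
  let ?s = "(ur r z)\<^sup>2 + S r * G r z"
  have s: "?s \<ge> 0" using S_pos[OF r] G_nonneg[OF r z] by simp
  have "\<bar>F r z\<bar> \<le> q1 r * \<bar>u r z\<bar> + q2 r * sqrt ?s"
    using ineq[OF r z] by (simp add: F_def k_def S_def)
  then have "(F r z)\<^sup>2 \<le> (q1 r * \<bar>u r z\<bar> + q2 r * sqrt ?s)\<^sup>2"
    by (metis abs_ge_zero power2_abs power_mono)
  also have "\<dots> \<le> 2 * (q1 r * \<bar>u r z\<bar>)\<^sup>2 + 2 * (q2 r * sqrt ?s)\<^sup>2"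
    using sum_squares_bound[of "q1 r * \<bar>u r z\<bar>" "q2 r * sqrt ?s"] by (simp add: power2_sum)
  also have "\<dots> = 2 * ((q1 r)\<^sup>2 * (u r z)\<^sup>2) + 2 * ((q2 r)\<^sup>2 * ?s)"
    using s by (simp add: power_mult_distrib)
  also have "\<dots> \<le> 2 * (C * (p r) ^ 3 * (u r z)\<^sup>2) + 2 * (C * p r * ?s)"
    using q1[OF r] q2[OF r] s by (intro add_mono mult_left_mono mult_right_mono) auto
  finally show ?thesis by (simp add: mult.assoc)
qed

text \<open>Since \<open>lam \<tau> r - \<tau> * p r = m / 2 * k r\<close>, the first-order term of
  the sum is that of the Laplacian; only a zeroth-order error remains.\<close>

lemma P1_plus_P2: "P1 \<tau> r z + P2 \<tau> r z = F r z + (m\<^sup>2 / 4 * (k r)\<^sup>2 + \<tau> * p' r - m / 2 * S r + \<tau> * p r) * u r z"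
  by (simp add: P1_def P2_def F_def lam_def algebra_simps power2_eq_square)

text \<open>Of the bound \<open>2 \<tau> p\<close> on the error coefficient, the geometric terms
  take at most \<open>\<tau> p / 2\<close>, the term with \<open>p'\<close> at most as much again,
  and the term \<open>\<tau> p\<close> the rest.\<close>

lemma E_coefficient:
  assumes r: "r > r0" and k: "k r \<le> K" and t: "\<tau> \<ge> 0" "2 * (m\<^sup>2 / 4 + m / 2) * K\<^sup>2 \<le> \<tau>"
  shows "(m\<^sup>2 / 4 * (k r)\<^sup>2 + \<tau> * p' r - m / 2 * S r + \<tau> * p r)\<^sup>2 \<le> 4 * \<tau>\<^sup>2 * (p r)\<^sup>2"
proof -
  have k2: "(k r)\<^sup>2 \<le> K\<^sup>2" using k k_ge_1[OF r] by (intro power_mono) auto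
  have S: "0 \<le> S r" "S r \<le> K\<^sup>2" using S_pos[OF r] k_sq[OF r] k2 by auto
  have b1: "m\<^sup>2 / 4 * (k r)\<^sup>2 \<le> m\<^sup>2 / 4 * K\<^sup>2" "0 \<le> m\<^sup>2 / 4 * (k r)\<^sup>2"
    using k2 by (auto intro!: mult_left_mono)
  have b2: "0 \<le> m / 2 * S r" "m / 2 * S r \<le> m / 2 * K\<^sup>2"
    using m S by (auto intro!: mult_left_mono)
  have b3: "0 \<le> \<tau> * p' r" "\<tau> * p' r \<le> \<tau> * (p r / 2)"
    using t p(2)[OF r] mult_left_mono[OF p(3)[OF r] t(1)] by auto
  have b4: "\<tau> \<le> \<tau> * p r" using t(1) p(1)[OF r] mult_left_mono[of 1 "p r" \<tau>] by simp
  have b5: "0 \<le> m / 2 * K\<^sup>2" "0 \<le> m\<^sup>2 / 4 * K\<^sup>2" using m by auto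
  have t2: "2 * (m\<^sup>2 / 4 * K\<^sup>2) + 2 * (m / 2 * K\<^sup>2) \<le> \<tau>" using t(2) by (simp add: algebra_simps)
  have "\<bar>m\<^sup>2 / 4 * (k r)\<^sup>2 + \<tau> * p' r - m / 2 * S r + \<tau> * p r\<bar> \<le> 2 * (\<tau> * p r)"
    using b1 b2 b3 b4 b5 t2 by linarith
  then have "(m\<^sup>2 / 4 * (k r)\<^sup>2 + \<tau> * p' r - m / 2 * S r + \<tau> * p r)\<^sup>2 \<le> (2 * (\<tau> * p r))\<^sup>2"
    by (metis abs_ge_zero power2_abs power_mono)
  then show ?thesis by (simp add: power_mult_distrib)
qed

lemma lam_sq:
  assumes r: "r > r0" and k: "k r \<le> K" and t: "\<tau> \<ge> 0" "m * K \<le> \<tau>"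
  shows "0 \<le> lam \<tau> r" "lam \<tau> r \<le> 2 * \<tau> * p r" "(lam \<tau> r)\<^sup>2 \<le> 4 * \<tau>\<^sup>2 * (p r)\<^sup>2"
proof -
  have a: "0 \<le> m / 2 * k r" "m / 2 * k r \<le> m / 2 * K"
    using m k k_ge_1[OF r] by (auto intro!: mult_left_mono)
  have b: "\<tau> \<le> \<tau> * p r" using t(1) p(1)[OF r] mult_left_mono[of 1 "p r" \<tau>] by simp
  show l0: "0 \<le> lam \<tau> r" using a b t unfolding lam_def by linarith
  show l1: "lam \<tau> r \<le> 2 * \<tau> * p r" using a b t unfolding lam_def by simp
  show "(lam \<tau> r)\<^sup>2 \<le> 4 * \<tau>\<^sup>2 * (p r)\<^sup>2"
    using power_mono[OF l1 l0, of 2] by (simp add: power_mult_distrib)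
qed

text \<open>The conjugated operator splits as \<open>P1 + P2\<close>. Radial derivatives are controlled by
  \<open>P2\<^sup>2\<close>, angular ones by the curvature term \<open>2 k p - p - p'\<close>, which is positive even when
  \<open>\<phi>\<close> is linear.\<close>

lemma X_le:
  assumes r: "r > r0" and z: "z \<in> N" and k: "k r \<le> K"
    and t: "\<tau> \<ge> 10 + 36 * C" "2 * (m\<^sup>2 / 4 + m / 2) * K\<^sup>2 \<le> \<tau>" "m * K \<le> \<tau>"
  shows "X \<tau> r z \<le> - (\<tau> ^ 3 * (p r) ^ 3 * (u r z)\<^sup>2)"
proof -
  define e where "e = m\<^sup>2 / 4 * (k r)\<^sup>2 + \<tau> * p' r - m / 2 * S r + \<tau> * p r"
  define v where "v = ur r z + lam \<tau> r * u r z"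
  define U where "U = (u r z)\<^sup>2"
  define V where "V = v\<^sup>2"
  define g where "g = S r * G r z"
  define q where "q = p r"
  have t1: "\<tau> \<ge> 1" "\<tau> \<ge> 0" using t(1) C by auto
  have q: "q \<ge> 1" using p(1)[OF r] by (simp add: q_def)
  have nn: "U \<ge> 0" "V \<ge> 0" "g \<ge> 0"
    using S_pos[OF r] G_nonneg[OF r z] by (auto simp: U_def V_def g_def)
  have e2: "e\<^sup>2 \<le> 4 * \<tau>\<^sup>2 * q\<^sup>2" unfolding e_def q_def by (rule E_coefficient[OF r k t1(2) t(2)])
  have l2: "(lam \<tau> r)\<^sup>2 \<le> 4 * \<tau>\<^sup>2 * q\<^sup>2" unfolding q_def by (rule lam_sq(3)[OF r k t1(2) t(3)])
  have "(ur r z)\<^sup>2 = (v - lam \<tau> r * u r z)\<^sup>2" by (simp add: v_def)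
  also have "\<dots> \<le> 2 * V + 2 * ((lam \<tau> r)\<^sup>2 * U)"
    using sum_squares_bound[of v "- (lam \<tau> r * u r z)"]
    by (simp add: power2_diff V_def U_def power_mult_distrib mult.commute)
  also have "\<dots> \<le> 2 * V + 2 * (4 * \<tau>\<^sup>2 * q\<^sup>2 * U)"
    using l2 nn by (intro add_left_mono mult_left_mono mult_right_mono) auto
  finally have ur2: "(ur r z)\<^sup>2 \<le> 2 * V + 8 * \<tau>\<^sup>2 * q\<^sup>2 * U" by simp
  have "(F r z)\<^sup>2 \<le> 2 * C * q ^ 3 * U + 2 * C * q * ((ur r z)\<^sup>2 + g)"
    using F_sq[OF r z] by (simp add: q_def U_def g_def)
  also have "\<dots> \<le> 2 * C * q ^ 3 * U + 2 * C * q * ((2 * V + 8 * \<tau>\<^sup>2 * q\<^sup>2 * U) + g)"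
    using ur2 C q by (intro add_left_mono mult_left_mono add_right_mono) auto
  finally have F2: "(F r z)\<^sup>2 \<le> 2 * C * q ^ 3 * U + 2 * C * q * ((2 * V + 8 * \<tau>\<^sup>2 * q\<^sup>2 * U) + g)" .
  have sum: "(P1 \<tau> r z + P2 \<tau> r z)\<^sup>2 \<le> 2 * (F r z)\<^sup>2 + 2 * (4 * \<tau>\<^sup>2 * q\<^sup>2 * U)"
  proof -
    have "(P1 \<tau> r z + P2 \<tau> r z)\<^sup>2 = (F r z + e * u r z)\<^sup>2"
      by (simp add: P1_plus_P2 e_def)
    also have "\<dots> \<le> 2 * (F r z)\<^sup>2 + 2 * (e\<^sup>2 * U)"
      using sum_squares_bound[of "F r z" "e * u r z"] by (simp add: power2_sum U_def power_mult_distrib)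
    also have "\<dots> \<le> 2 * (F r z)\<^sup>2 + 2 * (4 * \<tau>\<^sup>2 * q\<^sup>2 * U)"
      using e2 nn by (intro add_left_mono mult_left_mono mult_right_mono) auto
    finally show ?thesis .
  qed
  \<comment> \<open>Half of this inequality trades the square of \<open>P2\<close> for
    \<open>2 \<tau>\<^sup>2 q\<^sup>2 V\<close>, at the price of one of the nine
    \<open>\<tau>\<^sup>2 q\<^sup>2 U\<close> in \<open>main\<close>; the other eight come from the
    square of \<open>e\<close>.\<close>
  have P2: "4 * \<tau>\<^sup>2 * q\<^sup>2 * V \<le> 2 * (P2 \<tau> r z)\<^sup>2 + 2 * \<tau>\<^sup>2 * q\<^sup>2 * U"
  proof -
    have "4 * \<tau>\<^sup>2 * q\<^sup>2 * V = (\<tau> * q * u r z - P2 \<tau> r z)\<^sup>2"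
      by (simp add: P2_def V_def v_def[symmetric] q_def power_mult_distrib)
    also have "\<dots> \<le> 2 * (P2 \<tau> r z)\<^sup>2 + 2 * (\<tau> * q * u r z)\<^sup>2"
      using sum_squares_bound[of "\<tau> * q * u r z" "- P2 \<tau> r z"] by (simp add: power2_diff)
    finally show ?thesis by (simp add: power_mult_distrib U_def)
  qed
  have Q: "Q \<tau> r z = 2 * \<tau> * (p' r - q) * V + (2 * \<tau> ^ 3 * q ^ 3 + 6 * \<tau> ^ 3 * q\<^sup>2 * p' r + \<tau> * p'' r) * U
      + 2 * \<tau> * (2 * k r * q - q - p' r) * g"
    by (simp add: Q_def V_def v_def q_def U_def g_def)
  \<comment> \<open>Here \<open>2 P1 P2\<close> is
    \<open>(P1 + P2)\<^sup>2 - P1\<^sup>2 - P2\<^sup>2\<close>, and the square of \<open>P1\<close>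
    is dropped.\<close>
  have XP: "X \<tau> r z \<le> (P1 \<tau> r z + P2 \<tau> r z)\<^sup>2 - (P2 \<tau> r z)\<^sup>2 - Q \<tau> r z"
    unfolding X_def by (simp add: power2_sum)
  have main: "X \<tau> r z \<le> 4 * C * q ^ 3 * U + 4 * C * q * ((2 * V + 8 * \<tau>\<^sup>2 * q\<^sup>2 * U) + g)
      + 9 * \<tau>\<^sup>2 * q\<^sup>2 * U - 2 * \<tau>\<^sup>2 * q\<^sup>2 * V - Q \<tau> r z"
    using XP sum F2 P2 by linarith
  have V1: "8 * C * q * V - 2 * \<tau>\<^sup>2 * q\<^sup>2 * V - 2 * \<tau> * (p' r - q) * V \<le> 0"
  proof -
    have "\<tau> * (1 + 4 * C) \<le> \<tau> * \<tau>" using t(1) C t1 by (intro mult_left_mono) auto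
    moreover have "4 * C \<le> \<tau> * (4 * C)" using C t1 mult_right_mono[of 1 \<tau> "4 * C"] by simp
    ultimately have "4 * C + \<tau> \<le> \<tau>\<^sup>2" by (simp add: power2_eq_square algebra_simps)
    then have "(4 * C + \<tau>) * q \<le> \<tau>\<^sup>2 * q" using q by (intro mult_right_mono) auto
    also have "\<dots> \<le> \<tau>\<^sup>2 * (q * q)" using q mult_left_mono[of 1 q q] by (intro mult_left_mono) auto
    finally have "8 * C * q - 2 * \<tau>\<^sup>2 * q\<^sup>2 + 2 * \<tau> * q \<le> 0" by (simp add: power2_eq_square algebra_simps)
    moreover have "\<tau> * p' r \<ge> 0" using t1 p(2)[OF r] by simp
    ultimately have "8 * C * q - 2 * \<tau>\<^sup>2 * q\<^sup>2 - 2 * \<tau> * (p' r - q) \<le> 0"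
      by (simp add: algebra_simps)
    then have "(8 * C * q - 2 * \<tau>\<^sup>2 * q\<^sup>2 - 2 * \<tau> * (p' r - q)) * V \<le> 0"
      using nn by (intro mult_nonpos_nonneg)
    then show ?thesis by (simp add: algebra_simps)
  qed
  \<comment> \<open>With \<open>k \<ge> 1\<close> and \<open>p' \<le> p / 2\<close> the angular
    coefficient of \<open>Q\<close> is at least \<open>\<tau> q\<close>, enough for the gradient
    term of the equation.\<close>
  have g1: "4 * C * q * g - 2 * \<tau> * (2 * k r * q - q - p' r) * g \<le> 0"
  proof -
    have "q \<le> k r * q" using k_ge_1[OF r] q mult_right_mono[of 1 "k r" q] by simp
    then have "q / 2 \<le> 2 * k r * q - q - p' r" using p(3)[OF r] by (simp add: q_def)
    then have "2 * \<tau> * (q / 2) \<le> 2 * \<tau> * (2 * k r * q - q - p' r)"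
      using t1 by (intro mult_left_mono) auto
    moreover have "4 * C * q \<le> \<tau> * q" using t(1) C q by (intro mult_right_mono) auto
    ultimately have "(4 * C * q - 2 * \<tau> * (2 * k r * q - q - p' r)) * g \<le> 0"
      using nn by (intro mult_nonpos_nonneg) auto
    then show ?thesis by (simp add: left_diff_distrib)
  qed
  \<comment> \<open>The threshold \<open>10 + 36 * C\<close> adds up the coefficients of
    \<open>\<tau>\<^sup>2 q^3\<close>: \<open>4 C\<close> and \<open>32 C\<close> from the equation,
    9 from \<open>main\<close>, 1 from \<open>p''\<close>. One of the two copies of
    \<open>\<tau>^3 q^3\<close> pays for them.\<close>
  have U1: "4 * C * q ^ 3 + 32 * C * \<tau>\<^sup>2 * q ^ 3 + 9 * \<tau>\<^sup>2 * q\<^sup>2 - 2 * \<tau> ^ 3 * q ^ 3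
      - 6 * \<tau> ^ 3 * q\<^sup>2 * p' r - \<tau> * p'' r \<le> - (\<tau> ^ 3 * q ^ 3)"
  proof -
    have t2: "1 \<le> \<tau>\<^sup>2" "\<tau> \<le> \<tau>\<^sup>2" using t1 self_le_power[of \<tau> 2] one_le_power[of \<tau> 2] by auto
    have q3: "q\<^sup>2 \<le> q ^ 3" "q \<le> q ^ 3" "0 \<le> q ^ 3"
      using q power_increasing[of 2 3 q] self_le_power[of q 3] by auto
    have "4 * C * q ^ 3 \<le> \<tau>\<^sup>2 * (4 * C * q ^ 3)" using mult_right_mono[OF t2(1), of "4 * C * q ^ 3"] C q3 by simp
    moreover have "9 * \<tau>\<^sup>2 * q\<^sup>2 \<le> 9 * \<tau>\<^sup>2 * q ^ 3" using q3 by (intro mult_left_mono) auto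
    moreover have "- (\<tau> * p'' r) \<le> \<tau>\<^sup>2 * q ^ 3"
    proof -
      have "- (\<tau> * p'' r) \<le> \<tau> * q" using p(4)[OF r] t1 mult_left_mono[of "- p'' r" q \<tau>] by (simp add: q_def)
      also have "\<dots> \<le> \<tau>\<^sup>2 * q ^ 3" using t2 q3 q t1 by (intro mult_mono) auto
      finally show ?thesis .
    qed
    moreover have "0 \<le> 6 * \<tau> ^ 3 * q\<^sup>2 * p' r" using t1 p(2)[OF r] by simp
    moreover have "(10 + 36 * C) * (\<tau>\<^sup>2 * q ^ 3) \<le> \<tau> * (\<tau>\<^sup>2 * q ^ 3)"
      using t(1) q3 by (intro mult_right_mono) auto
    ultimately show ?thesis by (simp add: algebra_simps power2_eq_square power3_eq_cube)
  qed
  have "(4 * C * q ^ 3 + 32 * C * \<tau>\<^sup>2 * q ^ 3 + 9 * \<tau>\<^sup>2 * q\<^sup>2 - 2 * \<tau> ^ 3 * q ^ 3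
      - 6 * \<tau> ^ 3 * q\<^sup>2 * p' r - \<tau> * p'' r) * U \<le> - (\<tau> ^ 3 * q ^ 3) * U"
    using nn by (intro mult_right_mono[OF U1])
  then have "X \<tau> r z \<le> - (\<tau> ^ 3 * q ^ 3) * U"
    using main V1 g1 unfolding Q by (simp add: algebra_simps power2_eq_square power3_eq_cube)
  then show ?thesis by (simp add: q_def U_def)
qed

lemma I_X_le:
  assumes r: "r > r0" and k: "k r \<le> K"
    and t: "\<tau> \<ge> 10 + 36 * C" "2 * (m\<^sup>2 / 4 + m / 2) * K\<^sup>2 \<le> \<tau>" "m * K \<le> \<tau>"
  shows "I (X \<tau> r) \<le> - (\<tau> ^ 3 * (p r) ^ 3 * a r)"
proof -
  have "I (X \<tau> r) \<le> I (\<lambda>z. - (\<tau> ^ 3 * (p r) ^ 3) * (u r z)\<^sup>2)"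
    using X_le[OF r _ k t] by (intro I_mono X_continuous r continuous_intros cont) auto
  also have "\<dots> = - (\<tau> ^ 3 * (p r) ^ 3) * a r"
    unfolding a_def by (intro I_cmult continuous_intros cont r)
  finally show ?thesis by simp
qed

lemma k_mono:
  assumes "r0 < R" "R \<le> r"
  shows "k r \<le> k R"
proof (rule DERIV_nonpos_imp_nonincreasing[OF assms(2)])
  fix x assume "R \<le> x" "x \<le> r"
  then have "x > r0" using assms by simp
  then show "\<exists>y. (k has_real_derivative y) (at x) \<and> y \<le> 0"
    using D_k S_pos by (intro exI[of _ "- S x"]) (auto intro: less_imp_le)
qed

text \<open>\<open>k\<close> is decreasing, so thresholds met at \<open>R\<close> are met at all
  larger radii.\<close>

definition large :: "real \<Rightarrow> real \<Rightarrow> bool" where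
  "large R \<tau> \<longleftrightarrow> \<tau> \<ge> 10 + 36 * C \<and> 2 * (m\<^sup>2 / 4 + m / 2) * (k R)\<^sup>2 \<le> \<tau> \<and> m * k R \<le> \<tau>"

lemma D_B_le:
  assumes R: "R > r0" and t: "large R \<tau>" and r: "r \<ge> R"
  shows "\<Omega> \<tau> r * I (X \<tau> r) \<le> - (\<Omega> \<tau> r * a r)" "\<Omega> \<tau> r * a r \<ge> 0"
proof -
  have rr: "r > r0" using R r by simp
  have t1: "\<tau> \<ge> 1" using t C by (auto simp: large_def)
  have "1 \<le> \<tau> ^ 3 * (p r) ^ 3"
    using t1 p(1)[OF rr] mult_mono[of 1 "\<tau> ^ 3" 1 "(p r) ^ 3"] by (simp add: one_le_power)
  then have "a r \<le> \<tau> ^ 3 * (p r) ^ 3 * a r"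
    using a_nonneg[OF rr] mult_right_mono[of 1 "\<tau> ^ 3 * (p r) ^ 3" "a r"] by simp
  then have "I (X \<tau> r) \<le> - a r"
    using I_X_le[OF rr k_mono[OF R r], of \<tau>] t by (simp add: large_def)
  then have "\<Omega> \<tau> r * I (X \<tau> r) \<le> \<Omega> \<tau> r * (- a r)"
    by (intro mult_left_mono) (auto simp: \<Omega>_def)
  then show "\<Omega> \<tau> r * I (X \<tau> r) \<le> - (\<Omega> \<tau> r * a r)" by simp
  show "\<Omega> \<tau> r * a r \<ge> 0" using a_nonneg[OF rr] by (simp add: \<Omega>_def)
qed

section \<open>Monotonicity and sign of \<open>B\<close>\<close>

lemma B_decreasing:
  assumes R: "R > r0" and t: "large R \<tau>" and r: "R \<le> s" "s \<le> r"
  shows "B \<tau> r \<le> B \<tau> s"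
proof (rule DERIV_nonpos_imp_nonincreasing[OF r(2)])
  fix x assume "s \<le> x" "x \<le> r"
  then have x: "x > r0" "x \<ge> R" using R r by auto
  show "\<exists>y. (B \<tau> has_real_derivative y) (at x) \<and> y \<le> 0"
    using D_B[OF x(1), of \<tau>] D_B_le[OF R t x(2)] by (intro exI[of _ "\<Omega> \<tau> x * I (X \<tau> x)"]) auto
qed

text \<open>Every factor except \<open>a\<close> is at most an exponential of a multiple of
  \<open>\<phi>\<close>: \<open>sinh r \<le> exp r \<le> exp (\<phi> r)\<close> and
  \<open>p r \<le> exp (\<kappa> * \<phi> r)\<close>. The decay of \<open>a\<close> beats all of
  these.\<close>

lemma \<Omega>_decay:
  assumes "\<tau> \<ge> 0"
  shows "((\<lambda>r. \<Omega> \<tau> r * (p r) ^ j * a r) \<longlongrightarrow> 0) at_top"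
proof (rule Lim_null_comparison)
  show "((\<lambda>r. exp ((2 * \<tau> + m + real j * \<kappa>) * \<phi> r) * a r) \<longlongrightarrow> 0) at_top"
    using decay unfolding a_def by blast
  show "\<forall>\<^sub>F r in at_top. norm (\<Omega> \<tau> r * (p r) ^ j * a r) \<le> exp ((2 * \<tau> + m + real j * \<kappa>) * \<phi> r) * a r"
    using eventually_gt_at_top[of r0]
  proof eventually_elim
    case (elim r)
    have "sinh r \<le> exp r" by (simp add: sinh_def field_simps)
    then have "ln (sinh r) \<le> r" using sinh_pos[OF elim] ln_le_cancel_iff[of "sinh r" "exp r"] by simp
    then have "ln (sinh r) \<le> \<phi> r" using \<phi>[OF elim] by simp
    then have "m * ln (sinh r) \<le> m * \<phi> r" using m by (intro mult_left_mono)
    then have "\<Omega> \<tau> r \<le> exp ((2 * \<tau> + m) * \<phi> r)" by (simp add: \<Omega>_def algebra_simps)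
    moreover have "(p r) ^ j \<le> exp (\<kappa> * \<phi> r) ^ j"
      using p(1,5)[OF elim] by (intro power_mono) auto
    then have "(p r) ^ j \<le> exp (real j * \<kappa> * \<phi> r)" by (simp add: exp_of_nat_mult[symmetric] mult.assoc)
    ultimately have "\<Omega> \<tau> r * (p r) ^ j \<le> exp ((2 * \<tau> + m) * \<phi> r) * exp (real j * \<kappa> * \<phi> r)"
      using p(1)[OF elim] by (intro mult_mono) auto
    then have "\<Omega> \<tau> r * (p r) ^ j \<le> exp ((2 * \<tau> + m + real j * \<kappa>) * \<phi> r)"
      by (simp add: exp_add[symmetric] algebra_simps)
    then have "\<Omega> \<tau> r * (p r) ^ j * a r \<le> exp ((2 * \<tau> + m + real j * \<kappa>) * \<phi> r) * a r"
      using a_nonneg[OF elim] by (rule mult_right_mono)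
    moreover have "\<Omega> \<tau> r * (p r) ^ j * a r \<ge> 0"
      using a_nonneg[OF elim] p(1)[OF elim] by (simp add: \<Omega>_def)
    ultimately show ?case by simp
  qed
qed

text \<open>Nonnegativity for suitable \<open>x\<close> and \<open>y\<close> stands in for the
  Cauchy-Schwarz inequality between \<open>a\<close>, \<open>b\<close> and \<open>c\<close>.\<close>

lemma I_quadratic:
  assumes r: "r > r0"
  shows "I (\<lambda>z. (x * ur r z + y * u r z)\<^sup>2) = x\<^sup>2 * c r + 2 * x * y * b r + y\<^sup>2 * a r"
    and "x\<^sup>2 * c r + 2 * x * y * b r + y\<^sup>2 * a r \<ge> 0"
proof -
  have "I (\<lambda>z. (x * ur r z + y * u r z)\<^sup>2) = I (\<lambda>z. y\<^sup>2 * (u r z)\<^sup>2 + (2 * x * y) * (u r z * ur r z) + x\<^sup>2 * (ur r z)\<^sup>2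
      + 0 * (u r z * urr r z) + 0 * (ur r z * urr r z) + 0 * (u r z * Lu r z) + 0 * (ur r z * Lu r z) + 0 * G r z)"
    by (rule arg_cong[of _ _ I], rule ext) (simp add: power2_sum power_mult_distrib algebra_simps)
  then show *: "I (\<lambda>z. (x * ur r z + y * u r z)\<^sup>2) = x\<^sup>2 * c r + 2 * x * y * b r + y\<^sup>2 * a r"
    unfolding I_sum8[OF r] by simp
  show "x\<^sup>2 * c r + 2 * x * y * b r + y\<^sup>2 * a r \<ge> 0"
    unfolding *[symmetric] by (intro I_nonneg continuous_intros cont r) auto
qed

text \<open>A negative \<open>B\<close> has to be paid for by the radial energy \<open>c\<close>:
  the other contribution is a multiple of \<open>a\<close>, which decays, and the angular term of
  \<open>bt\<close> has the favourable sign.\<close>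

lemma bt_lower:
  assumes R: "R > r0" and t: "large R \<tau>" and r: "r \<ge> R"
  shows "- bt \<tau> r \<le> 6 * \<tau> * p r * c r + 28 * \<tau> ^ 3 * (p r) ^ 3 * a r"
proof -
  have rr: "r > r0" using R r by simp
  have t1: "\<tau> \<ge> 1" using t C by (auto simp: large_def)
  define q where "q = p r"
  define l where "l = lam \<tau> r"
  have q: "q \<ge> 1" using p(1)[OF rr] by (simp add: q_def)
  have l2: "l\<^sup>2 \<le> 4 * \<tau>\<^sup>2 * q\<^sup>2"
    unfolding l_def q_def using lam_sq(3)[OF rr k_mono[OF R r], of \<tau>] t t1 by (simp add: large_def)
  define V where "V = c r + 2 * l * b r + l\<^sup>2 * a r"
  define W where "W = b r + l * a r"
  have an: "a r \<ge> 0" by (rule a_nonneg[OF rr])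
  have "V \<le> 2 * c r + 2 * (l\<^sup>2 * a r)"
    using I_quadratic(2)[OF rr, of 1 "- l"] by (simp add: V_def mult.commute)
  also have "\<dots> \<le> 2 * c r + 2 * (4 * \<tau>\<^sup>2 * q\<^sup>2 * a r)"
    using l2 an by (intro add_left_mono mult_left_mono mult_right_mono) auto
  finally have V: "V \<le> 2 * c r + 8 * \<tau>\<^sup>2 * q\<^sup>2 * a r" by simp
  \<comment> \<open>Up to the weight, this is nonnegativity of the integral of the square of
    \<open>w' + w\<close>.\<close>
  have W: "- (2 * W) \<le> a r + V"
    using I_quadratic(2)[OF rr, of 1 "l + 1"] by (simp add: V_def W_def algebra_simps power2_eq_square)
  have tq: "\<tau> * q \<ge> 0" using t1 q by simp
  have e: "\<tau> * q * (S r * E r) \<ge> 0" using tq S_pos[OF rr] E_nonneg[OF rr] by simp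
  have "- bt \<tau> r = 2 * (\<tau> * q * V) + \<tau> * q * (- (2 * W)) + \<tau> * p' r * a r + 2 * \<tau> ^ 3 * q ^ 3 * a r
      - 2 * (\<tau> * q * (S r * E r))"
    by (simp add: bt_def V_def W_def l_def q_def algebra_simps)
  also have "\<dots> \<le> 2 * (\<tau> * q * V) + \<tau> * q * (a r + V) + \<tau> * q * a r + 2 * \<tau> ^ 3 * q ^ 3 * a r"
  proof -
    have "\<tau> * q * (- (2 * W)) \<le> \<tau> * q * (a r + V)" by (rule mult_left_mono[OF W tq])
    moreover have "\<tau> * p' r * a r \<le> \<tau> * q * a r"
      using p(3)[OF rr] q t1 an by (intro mult_right_mono mult_left_mono) (auto simp: q_def)
    ultimately show ?thesis using e by linarith
  qed
  also have "\<dots> = 3 * (\<tau> * q * V) + 2 * (\<tau> * q * a r) + 2 * \<tau> ^ 3 * q ^ 3 * a r"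
    by (simp add: algebra_simps)
  also have "\<dots> \<le> 3 * (\<tau> * q * (2 * c r + 8 * \<tau>\<^sup>2 * q\<^sup>2 * a r)) + 2 * (\<tau> ^ 3 * q ^ 3 * a r) + 2 * \<tau> ^ 3 * q ^ 3 * a r"
  proof -
    have "\<tau> * q \<le> \<tau> ^ 3 * q ^ 3"
      using t1 q self_le_power[of \<tau> 3] self_le_power[of q 3] by (intro mult_mono) auto
    then have "\<tau> * q * a r \<le> \<tau> ^ 3 * q ^ 3 * a r" using an by (rule mult_right_mono)
    moreover have "\<tau> * q * V \<le> \<tau> * q * (2 * c r + 8 * \<tau>\<^sup>2 * q\<^sup>2 * a r)" by (rule mult_left_mono[OF V tq])
    ultimately show ?thesis by linarith
  qed
  also have "\<dots> = 6 * \<tau> * q * c r + 28 * \<tau> ^ 3 * q ^ 3 * a r"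
    by (simp add: algebra_simps power2_eq_square power3_eq_cube)
  finally show ?thesis by (simp add: q_def)
qed

text \<open>The factor \<open>p\<close> matches the weight with which \<open>c\<close> occurs in
  \<open>bt_lower\<close>. The product of \<open>u\<close> and \<open>urr\<close> is eliminated by
  the equation; two applications of Young's inequality cost a quarter of \<open>c\<close> each, so
  half of it survives.\<close>

lemma D_flux:
  assumes r: "r > r0" and t: "\<tau> \<ge> 1"
  shows "\<exists>y. ((\<lambda>r. \<Omega> \<tau> r * p r * b r) has_real_derivative y) (at r) \<and>
    y \<ge> \<Omega> \<tau> r * p r * (c r / 2 - (2 * C + 2 + 9 * \<tau>\<^sup>2) * (p r) ^ 3 * a r)"
proof -
  define q where "q = p r"
  have q: "q \<ge> 1" using p(1)[OF r] by (simp add: q_def)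
  define x where "x = 2 * \<tau> * q + p' r / q"
  \<comment> \<open>The two terms with \<open>S r\<close> cancel after integration, by Green's
    formula. Pointwise the first completes the product of \<open>u\<close> and \<open>F\<close>, and
    the second is a nonnegative reserve for the gradient part of \<open>F\<close>.\<close>
  define W where "W z = 0 * (u r z)\<^sup>2 + (m * k r + x) * (u r z * ur r z) + 1 * (ur r z)\<^sup>2 + 1 * (u r z * urr r z)
      + 0 * (ur r z * urr r z) + S r * (u r z * Lu r z) + 0 * (ur r z * Lu r z) + S r * G r z" for z
  have IW: "I W = c r + I (\<lambda>z. u r z * urr r z) + (2 * \<tau> * q + m * k r + p' r / q) * b r"
    unfolding W_def I_sum8[OF r] by (simp add: x_def algebra_simps)
  have W_ge: "W z \<ge> 1 / 2 * (ur r z)\<^sup>2 + (- ((2 * C + 2 + 9 * \<tau>\<^sup>2) * q ^ 3)) * (u r z)\<^sup>2" if z: "z \<in> N" for z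
  proof -
    define U where "U = (u r z)\<^sup>2"
    define V where "V = (ur r z)\<^sup>2"
    define g where "g = S r * G r z"
    \<comment> \<open>The parameter of Young's inequality for the product of \<open>u\<close> and
      \<open>F\<close>; the summand 1 keeps it positive when \<open>C = 0\<close>.\<close>
    define y where "y = 2 * C * q + 1"
    have nn: "U \<ge> 0" "V \<ge> 0" "g \<ge> 0"
      using S_pos[OF r] G_nonneg[OF r z] by (auto simp: U_def V_def g_def)
    have y1: "y \<ge> 1" using C q by (simp add: y_def)
    have W: "W z = V + g + u r z * F r z + x * (u r z * ur r z)"
      by (simp add: W_def F_def V_def g_def algebra_simps power2_eq_square)
    have "(F r z)\<^sup>2 \<le> 2 * C * q * (q\<^sup>2 * U + V + g)"
      using F_sq[OF r z] by (simp add: q_def U_def V_def g_def algebra_simps power2_eq_square power3_eq_cube)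
    also have "\<dots> \<le> y * (q\<^sup>2 * U + V + g)"
      using nn by (intro mult_right_mono) (auto simp: y_def)
    finally have F2: "(F r z)\<^sup>2 \<le> y * (q\<^sup>2 * U + V + g)" .
    have "0 \<le> (2 * y * u r z + F r z)\<^sup>2" by simp
    also have "\<dots> = 4 * y * (y * U + u r z * F r z) + (F r z)\<^sup>2"
      by (simp add: U_def algebra_simps power2_eq_square)
    also have "\<dots> \<le> 4 * y * (y * U + u r z * F r z) + y * (q\<^sup>2 * U + V + g)" using F2 by simp
    also have "\<dots> = y * (4 * (y * U + u r z * F r z) + (q\<^sup>2 * U + V + g))" by (simp add: algebra_simps)
    finally have "0 \<le> 4 * (y * U + u r z * F r z) + (q\<^sup>2 * U + V + g)"
      using y1 zero_le_mult_iff[of y] by fastforce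
    then have 1: "u r z * F r z \<ge> - (y * U) - q\<^sup>2 * U / 4 - V / 4 - g / 4" by (simp add: algebra_simps)
    have pq: "p' r / q \<le> 1" "0 \<le> p' r / q" using p(2,3)[OF r] q by (auto simp: q_def field_simps)
    have tq: "1 \<le> \<tau> * q" using t q mult_mono[of 1 \<tau> 1 q] by simp
    have "x \<le> 3 * (\<tau> * q)" "0 \<le> x" using pq tq by (auto simp: x_def)
    then have "x\<^sup>2 \<le> (3 * (\<tau> * q))\<^sup>2" by (intro power_mono)
    then have x2: "x\<^sup>2 * U \<le> 9 * \<tau>\<^sup>2 * q\<^sup>2 * U" using nn by (intro mult_right_mono) (auto simp: power_mult_distrib)
    have "0 \<le> (ur r z / 2 + x * u r z)\<^sup>2" by simp
    also have "\<dots> = V / 4 + x * (u r z * ur r z) + x\<^sup>2 * U"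
      by (simp add: V_def U_def algebra_simps power2_eq_square)
    finally have 2: "x * (u r z * ur r z) \<ge> - (V / 4) - 9 * \<tau>\<^sup>2 * q\<^sup>2 * U" using x2 by linarith
    have q3: "q\<^sup>2 \<le> q ^ 3" "q \<le> q ^ 3" "1 \<le> q ^ 3"
      using q power_increasing[of 2 3 q] self_le_power[of q 3] one_le_power[of q 3] by auto
    have "y * U + q\<^sup>2 * U / 4 + 9 * \<tau>\<^sup>2 * q\<^sup>2 * U = (2 * C * q + 1 + q\<^sup>2 / 4 + 9 * \<tau>\<^sup>2 * q\<^sup>2) * U"
      by (simp add: y_def algebra_simps)
    also have "\<dots> \<le> (2 * C * q ^ 3 + q ^ 3 + q ^ 3 + 9 * \<tau>\<^sup>2 * q ^ 3) * U"
      using q3 C nn by (intro mult_right_mono add_mono mult_left_mono) auto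
    finally have "y * U + q\<^sup>2 * U / 4 + 9 * \<tau>\<^sup>2 * q\<^sup>2 * U \<le> (2 * C + 2 + 9 * \<tau>\<^sup>2) * q ^ 3 * U"
      by (simp add: algebra_simps)
    then have "V / 2 - (2 * C + 2 + 9 * \<tau>\<^sup>2) * q ^ 3 * U \<le> W z"
      using 1 2 nn unfolding W by linarith
    then show ?thesis by (simp add: U_def V_def)
  qed
  have "1 / 2 * c r + (- ((2 * C + 2 + 9 * \<tau>\<^sup>2) * q ^ 3)) * a r =
      I (\<lambda>z. 1 / 2 * (ur r z)\<^sup>2 + (- ((2 * C + 2 + 9 * \<tau>\<^sup>2) * q ^ 3)) * (u r z)\<^sup>2)"
    unfolding a_def c_def by (intro I_linear[symmetric] continuous_intros cont r)
  also have "\<dots> \<le> I W"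
  proof (rule I_mono)
    show "continuous_on N W" unfolding W_def[abs_def] by (intro continuous_intros cont r)
  qed (auto intro!: continuous_intros cont r simp del: times_divide_eq_left dest: W_ge)
  finally have IW2: "c r / 2 - (2 * C + 2 + 9 * \<tau>\<^sup>2) * q ^ 3 * a r \<le> I W" by simp
  have "((\<lambda>r. \<Omega> \<tau> r * p r * b r) has_real_derivative \<Omega> \<tau> r * q * I W) (at r)"
    unfolding IW using q
    by (auto intro!: derivative_eq_intros D_\<Omega>[OF r] D_p[OF r] D_b[OF r, folded b_def c_def]
        simp: lam_def q_def field_simps)
  moreover have "\<Omega> \<tau> r * q * (c r / 2 - (2 * C + 2 + 9 * \<tau>\<^sup>2) * q ^ 3 * a r) \<le> \<Omega> \<tau> r * q * I W"
    using IW2 q by (intro mult_left_mono) (auto simp: \<Omega>_def)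
  ultimately show ?thesis by (auto simp: q_def)
qed

text \<open>If \<open>B\<close> were negative somewhere, the radial energy \<open>c\<close> could not decay, so the flux
  \<open>\<Omega> * p * b\<close> would grow at least linearly. Then \<open>b > 0\<close> eventually and \<open>a\<close> increases,
  against the decay of \<open>u\<close>.\<close>

lemma B_nonneg:
  assumes R: "R > r0" and t: "large R \<tau>" and r: "r \<ge> R"
  shows "B \<tau> r \<ge> 0"
proof (rule ccontr)
  assume "\<not> B \<tau> r \<ge> 0"
  define \<delta> where "\<delta> = - B \<tau> r"
  have \<delta>: "\<delta> > 0" using \<open>\<not> B \<tau> r \<ge> 0\<close> by (simp add: \<delta>_def)
  have t1: "\<tau> \<ge> 1" using t C by (auto simp: large_def)
  have \<Omega>: "\<Omega> \<tau> s > 0" for s by (simp add: \<Omega>_def)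
  define C' where "C' = 2 * C + 2 + 9 * \<tau>\<^sup>2"
  have C': "C' > 0" using C by (simp add: C'_def add_pos_nonneg)
  \<comment> \<open>Below, the term with \<open>a\<close> in \<open>bt_lower\<close> is made at most
    \<open>\<delta> / 2\<close>, so \<open>6 \<tau> \<Omega> p c \<ge> \<delta> / 2\<close>, which
    reads \<open>\<Omega> p c \<ge> 4 \<eta>\<close>. Half of this enters the derivative of the
    flux, and the error term takes at most \<open>\<eta>\<close> away.\<close>
  define \<eta> where "\<eta> = \<delta> / (48 * \<tau>)"
  have \<eta>: "\<eta> > 0" using \<delta> t1 by (simp add: \<eta>_def)
  have "\<forall>\<^sub>F s in at_top. \<Omega> \<tau> s * (p s) ^ 3 * a s < \<delta> / (56 * \<tau> ^ 3)"
    using \<Omega>_decay[of \<tau> 3] \<delta> t1 by (intro order_tendstoD) auto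
  moreover have "\<forall>\<^sub>F s in at_top. \<Omega> \<tau> s * (p s) ^ 4 * a s < \<eta> / C'"
    using \<Omega>_decay[of \<tau> 4] \<eta> C' t1 by (intro order_tendstoD) auto
  ultimately have "\<forall>\<^sub>F s in at_top. \<Omega> \<tau> s * (p s) ^ 3 * a s < \<delta> / (56 * \<tau> ^ 3) \<and>
      \<Omega> \<tau> s * (p s) ^ 4 * a s < \<eta> / C' \<and> s \<ge> r"
    using eventually_ge_at_top[of r] by eventually_elim auto
  then obtain T where T: "\<And>s. s \<ge> T \<Longrightarrow> \<Omega> \<tau> s * (p s) ^ 3 * a s < \<delta> / (56 * \<tau> ^ 3) \<and>
      \<Omega> \<tau> s * (p s) ^ 4 * a s < \<eta> / C' \<and> s \<ge> r"
    unfolding eventually_at_top_linorder by blast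
  define f where "f s = \<Omega> \<tau> s * p s * b s" for s
  have D: "\<exists>y. (f has_real_derivative y) (at s) \<and> y \<ge> \<eta>" if s: "s \<ge> T" for s
  proof -
    have sr: "s > r0" "s \<ge> R" "r \<le> s" using T[OF s] r R by auto
    have "\<delta> \<le> \<Omega> \<tau> s * (- bt \<tau> s)"
      using B_decreasing[OF R t r sr(3)] by (simp add: \<delta>_def B_def)
    also have "\<dots> \<le> \<Omega> \<tau> s * (6 * \<tau> * p s * c s + 28 * \<tau> ^ 3 * (p s) ^ 3 * a s)"
      using bt_lower[OF R t sr(2)] \<Omega>[of s] by (intro mult_left_mono) auto
    also have "\<dots> = 6 * \<tau> * (\<Omega> \<tau> s * p s * c s) + 28 * \<tau> ^ 3 * (\<Omega> \<tau> s * (p s) ^ 3 * a s)"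
      by (simp add: algebra_simps)
    also have "28 * \<tau> ^ 3 * (\<Omega> \<tau> s * (p s) ^ 3 * a s) \<le> 28 * \<tau> ^ 3 * (\<delta> / (56 * \<tau> ^ 3))"
      using T[OF s] t1 by (intro mult_left_mono) auto
    also have "28 * \<tau> ^ 3 * (\<delta> / (56 * \<tau> ^ 3)) = \<delta> / 2" using t1 by simp
    finally have 1: "\<Omega> \<tau> s * p s * c s \<ge> 4 * \<eta>" using t1 by (simp add: \<eta>_def field_simps)
    have 2: "C' * (\<Omega> \<tau> s * (p s) ^ 4 * a s) \<le> \<eta>" using T[OF s] C' by (simp add: field_simps)
    obtain y where y: "(f has_real_derivative y) (at s)"
      "y \<ge> \<Omega> \<tau> s * p s * (c s / 2 - C' * (p s) ^ 3 * a s)"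
      using D_flux[OF sr(1) t1] unfolding f_def[abs_def] C'_def by blast
    have "\<Omega> \<tau> s * p s * (c s / 2 - C' * (p s) ^ 3 * a s) =
        \<Omega> \<tau> s * p s * c s / 2 - C' * (\<Omega> \<tau> s * (p s) ^ 4 * a s)"
      by (simp add: algebra_simps power3_eq_cube power4_eq_xxxx)
    then have "y \<ge> \<eta>" using y(2) 1 2 by linarith
    with y(1) show ?thesis by blast
  qed
  have f_ge: "f T + \<eta> * (s - T) \<le> f s" if "s \<ge> T" for s
  proof -
    have "f T - \<eta> * T \<le> f s - \<eta> * s"
    proof (rule DERIV_nonneg_imp_nondecreasing[OF that])
      fix x assume "T \<le> x" "x \<le> s"
      then obtain y where y: "(f has_real_derivative y) (at x)" "y \<ge> \<eta>" using D by blast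
      have "((\<lambda>s. f s - \<eta> * s) has_real_derivative (y - \<eta>)) (at x)"
        by (rule derivative_eq_intros y refl)+ simp
      then show "\<exists>y. ((\<lambda>s. f s - \<eta> * s) has_real_derivative y) (at x) \<and> y \<ge> 0"
        using y(2) by (intro exI[of _ "y - \<eta>"]) auto
    qed
    then show ?thesis by (simp add: algebra_simps)
  qed
  \<comment> \<open>From this radius on the linear lower bound for \<open>f\<close> is
    positive.\<close>
  define T2 where "T2 = T + (\<bar>f T\<bar> + 1) / \<eta>"
  have T2: "T2 \<ge> T" using \<eta> by (simp add: T2_def)
  have b_pos: "b s > 0" if s: "s \<ge> T2" for s
  proof -
    have "\<eta> * ((\<bar>f T\<bar> + 1) / \<eta>) \<le> \<eta> * (s - T)"
      using s \<eta> by (intro mult_left_mono) (auto simp: T2_def)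
    then have "f s > 0" using f_ge[of s] s T2 \<eta> by simp
    moreover have "p s \<ge> 1" using p(1)[of s] T[of s] s T2 r R by simp
    then have "\<Omega> \<tau> s * p s > 0" using \<Omega>[of s] by simp
    ultimately show ?thesis unfolding f_def by (metis zero_less_mult_pos)
  qed
  have Da: "(a has_real_derivative 2 * b s) (at s)" if "s \<ge> T2" for s
    using D_a[of s] T[of s] that T2 r R by (simp add: a_def[abs_def] b_def)
  have "a T2 < a (T2 + 1)"
  proof (rule DERIV_pos_imp_increasing[of T2 "T2 + 1" a])
    fix x assume "T2 \<le> x" "x \<le> T2 + 1"
    then show "\<exists>y. (a has_real_derivative y) (at x) \<and> y > 0"
      using Da[of x] b_pos[of x] by (intro exI[of _ "2 * b x"]) auto
  qed simp
  moreover have mono: "a (T2 + 1) \<le> a s" if "s \<ge> T2 + 1" for s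
  proof (rule DERIV_nonneg_imp_nondecreasing[of "T2 + 1" s a, OF that])
    fix x assume "T2 + 1 \<le> x" "x \<le> s"
    then show "\<exists>y. (a has_real_derivative y) (at x) \<and> y \<ge> 0"
      using Da[of x] b_pos[of x] by (intro exI[of _ "2 * b x"]) auto
  qed
  moreover have "a T2 \<ge> 0" using a_nonneg[of T2] T[of T2] T2 r R by simp
  ultimately have pos: "a (T2 + 1) > 0" by linarith
  have "(a \<longlongrightarrow> 0) at_top"
    using decay[of 0] by (simp add: a_def[abs_def])
  from order_tendstoD(2)[OF this pos] have "\<forall>\<^sub>F s in at_top. a s < a (T2 + 1)" .
  then obtain s0 where "\<And>s. s \<ge> s0 \<Longrightarrow> a s < a (T2 + 1)"
    unfolding eventually_at_top_linorder by blast
  then have "a (max s0 (T2 + 1)) < a (T2 + 1)" by simp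
  moreover have "a (T2 + 1) \<le> a (max s0 (T2 + 1))"
    by (rule mono) simp
  ultimately show False by simp
qed

text \<open>The cubic power of \<open>\<tau>\<close> and the square of \<open>w'\<close> enter with
  a negative sign and are discarded. By \<open>lam \<le> 2 \<tau> p\<close> the rest is at most
  quadratic in \<open>\<tau>\<close>, with a bracket independent of \<open>\<tau>\<close>.\<close>

lemma bt_upper:
  assumes R: "R > r0" and t: "large R \<tau>"
  shows "bt \<tau> R \<le> \<tau>\<^sup>2 * (2 * p R * (\<bar>b R\<bar> + 2 * p R * a R + S R * E R))"
proof -
  have t1: "\<tau> \<ge> 1" using t C by (auto simp: large_def)
  define q where "q = p R"
  have q: "q \<ge> 1" using p(1)[OF R] by (simp add: q_def)
  define l where "l = lam \<tau> R"
  have l: "l \<le> 2 * \<tau> * q"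
    unfolding l_def q_def using lam_sq(2)[OF R order_refl, of \<tau>] t t1 by (simp add: large_def)
  have an: "a R \<ge> 0" by (rule a_nonneg[OF R])
  have e: "S R * E R \<ge> 0" using S_pos[OF R] E_nonneg[OF R] by simp
  have V: "0 \<le> \<tau> * q * (c R + 2 * l * b R + l\<^sup>2 * a R)"
    using I_quadratic(2)[OF R, of 1 l] t1 q by simp
  have n: "0 \<le> (\<tau> * p' R + 2 * \<tau> ^ 3 * q ^ 3) * a R"
    using t1 q an p(2)[OF R] by simp
  have tq: "0 \<le> \<tau> * q" using t1 q by simp
  have "bt \<tau> R \<le> 2 * (\<tau> * q * (b R + l * a R + S R * E R))"
    using V n by (simp add: bt_def l_def q_def algebra_simps)
  also have "\<tau> * q * (b R + l * a R + S R * E R) \<le> \<tau> * q * (\<bar>b R\<bar> + 2 * \<tau> * q * a R + S R * E R)"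
    using mult_right_mono[OF l an] tq by (intro mult_left_mono) auto
  also have "\<dots> \<le> \<tau> * q * (\<tau> * \<bar>b R\<bar> + \<tau> * (2 * q * a R) + \<tau> * (S R * E R))"
    using t1 tq e mult_right_mono[of 1 \<tau> "\<bar>b R\<bar>"] mult_right_mono[of 1 \<tau> "S R * E R"]
    by (intro mult_left_mono add_mono) auto
  finally show ?thesis by (simp add: q_def algebra_simps power2_eq_square)
qed

text \<open>\<open>B\<close> drops by at most \<open>B \<tau> R1\<close> between \<open>R\<close>
  and \<open>R2\<close>, being decreasing and nonnegative. After division by
  \<open>exp (2 * \<tau> * \<phi> R)\<close> the upper bound carries the factor
  \<open>\<tau>\<^sup>2 * exp (- (2 * e * \<tau>))\<close>, whereas the lower bound does not depend
  on \<open>\<tau>\<close>.\<close>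

lemma a_eq_0:
  assumes R: "R > r0"
  shows "a R = 0"
proof (rule ccontr)
  assume "a R \<noteq> 0"
  then have aR: "a R > 0" using a_nonneg[OF R] by simp
  \<comment> \<open>Any radius strictly between \<open>r0\<close> and \<open>R\<close> would do; the
    gap makes \<open>\<phi> R1 < \<phi> R\<close>, hence \<open>e > 0\<close>.\<close>
  define R1 where "R1 = (r0 + R) / 2"
  have R1: "r0 < R1" "R1 < R" using R by (auto simp: R1_def)
  have cont_a: "isCont a r" if "r > r0" for r
    using DERIV_isCont[OF D_a[OF that]] by (simp add: a_def[abs_def])
  have "(a \<longlongrightarrow> a R) (at R)" using cont_a[OF R] by (simp add: isCont_def)
  then have "\<forall>\<^sub>F r in at R. a r > a R / 2" by (rule order_tendstoD) (use aR in simp)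
  then obtain d where d: "d > 0" "\<And>r. r \<noteq> R \<Longrightarrow> dist r R < d \<Longrightarrow> a r > a R / 2"
    unfolding eventually_at by auto
  define R2 where "R2 = R + d / 2"
  have R2: "R < R2" using d by (simp add: R2_def)
  have a_ge: "a r \<ge> a R / 2" if "R \<le> r" "r \<le> R2" for r
    using d(2)[of r] that aR d(1) by (cases "r = R") (auto simp: R2_def dist_real_def)
  define D where "D = 2 * p R1 * (\<bar>b R1\<bar> + 2 * p R1 * a R1 + S R1 * E R1)"
  define e where "e = \<phi> R - \<phi> R1"
  have "\<phi> R1 < \<phi> R"
  proof (rule DERIV_pos_imp_increasing[OF R1(2)])
    fix x assume "R1 \<le> x" "x \<le> R"
    then have "x > r0" using R1 by simp
    then show "\<exists>y. (\<phi> has_real_derivative y) (at x) \<and> y > 0"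
      using D_\<phi> p(1)[of x] by (intro exI[of _ "p x"]) auto
  qed
  then have e: "e > 0" by (simp add: e_def)
  define \<omega> where "\<omega> r = exp (m * ln (sinh r))" for r
  have \<Omega>: "\<Omega> \<tau> r = exp (2 * \<tau> * \<phi> r) * \<omega> r" for \<tau> r
    by (simp add: \<Omega>_def \<omega>_def exp_add)
  have key: "(R2 - R) * \<omega> R * (a R / 2) \<le> \<omega> R1 * D * (\<tau>\<^sup>2 * exp (- (2 * e * \<tau>)))" if t: "large R1 \<tau>" for \<tau>
  proof -
    have t1: "\<tau> \<ge> 1" using t C by (auto simp: large_def)
    \<comment> \<open>A mean value point stands in for the integral of the derivative; there
      \<open>\<Omega>\<close> and \<open>a\<close> are at least \<open>\<Omega> \<tau> R\<close> and
      \<open>a R / 2\<close>.\<close>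
    obtain \<xi> where \<xi>: "R < \<xi>" "\<xi> < R2" "B \<tau> R2 - B \<tau> R = (R2 - R) * (\<Omega> \<tau> \<xi> * I (X \<tau> \<xi>))"
      using MVT2[OF R2, of "B \<tau>" "\<lambda>r. \<Omega> \<tau> r * I (X \<tau> r)"] D_B R by fastforce
    have "\<phi> R \<le> \<phi> \<xi>"
    proof (rule DERIV_nonneg_imp_nondecreasing[of R \<xi> \<phi>])
      fix x assume "R \<le> x" "x \<le> \<xi>"
      then have "x > r0" using R by simp
      then show "\<exists>y. (\<phi> has_real_derivative y) (at x) \<and> y \<ge> 0"
        using D_\<phi> p(1)[of x] by (intro exI[of _ "p x"]) auto
    qed (use \<xi> in simp)
    moreover have "\<omega> R \<le> \<omega> \<xi>"
      using \<xi> m sinh_pos[OF R] sinh_pos[of \<xi>] R unfolding \<omega>_def by (auto intro!: mult_left_mono)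
    ultimately have \<Omega>_ge: "\<Omega> \<tau> R \<le> \<Omega> \<tau> \<xi>"
      unfolding \<Omega> using t1 by (intro mult_mono) (auto simp: \<omega>_def)
    have "(R2 - R) * (\<Omega> \<tau> R * (a R / 2)) \<le> (R2 - R) * (\<Omega> \<tau> \<xi> * a \<xi>)"
      using R2 \<Omega>_ge a_ge[of \<xi>] \<xi> aR by (intro mult_left_mono mult_mono) (auto simp: \<Omega>_def)
    also have "\<dots> \<le> (R2 - R) * (- (\<Omega> \<tau> \<xi> * I (X \<tau> \<xi>)))"
      using D_B_le(1)[OF R1(1) t, of \<xi>] \<xi> R1 R2 by (intro mult_left_mono) auto
    also have "\<dots> = B \<tau> R - B \<tau> R2" using \<xi>(3) by simp
    also have "\<dots> \<le> B \<tau> R1"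
      using B_nonneg[OF R1(1) t, of R2] B_decreasing[OF R1(1) t, of R1 R] R1 R2 by simp
    also have "\<dots> \<le> \<Omega> \<tau> R1 * (\<tau>\<^sup>2 * D)"
      unfolding B_def D_def by (intro mult_left_mono bt_upper R1 t) (simp add: \<Omega>_def)
    finally have "(R2 - R) * (\<Omega> \<tau> R * (a R / 2)) * exp (- (2 * \<tau> * \<phi> R)) \<le>
        \<Omega> \<tau> R1 * (\<tau>\<^sup>2 * D) * exp (- (2 * \<tau> * \<phi> R))"
      by (rule mult_right_mono) simp
    then have "(R2 - R) * (\<Omega> \<tau> R * exp (- (2 * \<tau> * \<phi> R))) * (a R / 2) \<le>
        \<Omega> \<tau> R1 * exp (- (2 * \<tau> * \<phi> R)) * (D * \<tau>\<^sup>2)"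
      by (simp only: ac_simps)
    moreover have "\<Omega> \<tau> R * exp (- (2 * \<tau> * \<phi> R)) = \<omega> R"
      by (simp add: \<Omega> exp_minus)
    moreover have "\<Omega> \<tau> R1 * exp (- (2 * \<tau> * \<phi> R)) = \<omega> R1 * exp (- (2 * e * \<tau>))"
      by (simp add: \<Omega> e_def exp_add[symmetric] algebra_simps)
    ultimately have "(R2 - R) * \<omega> R * (a R / 2) \<le> \<omega> R1 * exp (- (2 * e * \<tau>)) * (D * \<tau>\<^sup>2)" by simp
    then show ?thesis by (simp only: ac_simps)
  qed
  have "((\<lambda>x. x ^ 2 / exp x) \<longlongrightarrow> (0::real)) at_top" by (rule tendsto_power_div_exp_0)
  moreover have "filterlim (\<lambda>\<tau>. 2 * e * \<tau>) at_top at_top"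
    by (rule filterlim_tendsto_pos_mult_at_top[OF tendsto_const _ filterlim_ident]) (use e in simp)
  ultimately have "((\<lambda>\<tau>. (2 * e * \<tau>) ^ 2 / exp (2 * e * \<tau>)) \<longlongrightarrow> 0) at_top"
    by (rule filterlim_compose)
  then have "((\<lambda>\<tau>. \<omega> R1 * D / (4 * e\<^sup>2) * ((2 * e * \<tau>) ^ 2 / exp (2 * e * \<tau>))) \<longlongrightarrow> 0) at_top"
    by (rule tendsto_mult_right_zero)
  moreover have "(\<lambda>\<tau>. \<omega> R1 * D / (4 * e\<^sup>2) * ((2 * e * \<tau>) ^ 2 / exp (2 * e * \<tau>))) =
      (\<lambda>\<tau>. \<omega> R1 * D * (\<tau>\<^sup>2 * exp (- (2 * e * \<tau>))))"
    using e by (auto simp: fun_eq_iff field_simps exp_minus power_mult_distrib)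
  ultimately have lim: "((\<lambda>\<tau>. \<omega> R1 * D * (\<tau>\<^sup>2 * exp (- (2 * e * \<tau>)))) \<longlongrightarrow> 0) at_top" by simp
  have pos: "(R2 - R) * \<omega> R * (a R / 2) > 0" using R2 aR by (simp add: \<omega>_def)
  from order_tendstoD(2)[OF lim pos]
  have "\<forall>\<^sub>F \<tau> in at_top. \<not> large R1 \<tau>" by eventually_elim (use key in force)
  moreover have "\<forall>\<^sub>F \<tau> in at_top. large R1 \<tau>"
    unfolding large_def by (intro eventually_conj eventually_ge_at_top)
  ultimately have "\<forall>\<^sub>F \<tau> in (at_top :: real filter). False" by eventually_elim simp
  then show False by simp
qed

end

section \<open>Vanishing of the solution\<close>

text \<open>A real number strictly above the upper limit eventually bounds the supremum, hence all
  points of the section at once.\<close>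

lemma bigo_endD:
  assumes "bigo_end N v f"
  obtains B where "\<forall>\<^sub>F r in at_top. \<forall>x\<in>N. \<bar>v (r, x) / f r\<bar> \<le> B"
proof -
  obtain B where B: "Limsup at_top (\<lambda>r. SUP x\<in>N. ereal \<bar>v (r, x) / f r\<bar>) < ereal B"
    using assms ereal_dense2 unfolding bigo_end_def by blast
  have "\<forall>\<^sub>F r in at_top. \<forall>x\<in>N. \<bar>v (r, x) / f r\<bar> \<le> B"
    using Limsup_lessD[OF B]
  proof eventually_elim
    case (elim r)
    show ?case
    proof
      fix x assume "x \<in> N"
      then have "ereal \<bar>v (r, x) / f r\<bar> < ereal B" by (rule SUP_lessD[OF elim])
      then show "\<bar>v (r, x) / f r\<bar> \<le> B" by simp
    qed
  qed
  then show thesis by (rule that)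
qed

context riemannian_manifold
begin

lemma exists_riemannian_partition:
  assumes "compact M"
  shows "\<exists>P pc \<rho> K. riemannian_partition M A P pc \<rho> K"
proof (rule partition_of_unity[OF assms])
  fix P :: "'a set" and pc :: "'a \<Rightarrow> ('a, 'b) rchart" and \<rho> K
  assume part: "finite P" "\<And>i. i \<in> P \<Longrightarrow> pc i \<in> A"
    "\<And>i. i \<in> P \<Longrightarrow> C1_M (\<rho> i)"
    "\<And>i z. i \<in> P \<Longrightarrow> z \<in> M \<Longrightarrow> \<rho> i z \<ge> 0" "\<And>i. i \<in> P \<Longrightarrow> compact (K i)"
    "\<And>i. i \<in> P \<Longrightarrow> K i \<subseteq> chart_dom (pc i)"
    "\<And>i z. i \<in> P \<Longrightarrow> z \<notin> K i \<Longrightarrow> \<rho> i z = 0" "\<And>z. z \<in> M \<Longrightarrow> (\<Sum>i\<in>P. \<rho> i z) = 1"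
  have "riemannian_partition M A P pc \<rho> K"
    by unfold_locales (fact part)+
  then show ?thesis by blast
qed

lemma grad_inner_nonneg:
  assumes f: "C1_M f" and z: "z \<in> M"
  shows "grad_inner f f z \<ge> 0"
proof -
  obtain c where c: "c \<in> A" "z \<in> chart_dom c" using z cover by auto
  have y: "chart_map c z \<in> chart_img c" by (rule chart_map_img[OF c])
  let ?w = "chart_grad c f (chart_map c z)"
  have "chart_metric c (chart_map c z) ?w ?w \<ge> 0"
    using metric_pos[OF c(1) y, of ?w] bilinear_lzero[OF metric_bilinear[OF c(1) y], of 0]
    by (cases "?w = 0") (auto intro: less_imp_le)
  then show ?thesis
    unfolding grad_inner_eq[OF f f c]
      chart_inner_metric[OF c(1) y C1_differentiable[OF f c(1) y] C1_differentiable[OF f c(1) y]] .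
qed

end

context riemannian_partition
begin

text \<open>Serves for the products of \<open>u\<close> and its radial derivative with themselves
  and with each other. The factors are asked to be C1 only, because the radial derivative of a C2
  function is no better.\<close>

lemma D_integ_mult:
  assumes f: "Ck_end r0 (Suc 0) f" and g: "Ck_end r0 (Suc 0) g" and r: "r > r0"
  shows "((\<lambda>r. integ (\<lambda>z. f r z * g r z)) has_real_derivative
    integ (\<lambda>z. f r z * radial g r z) + integ (\<lambda>z. radial f r z * g r z)) (at r)"
proof -
  have c: "continuous_on M (f r)" "continuous_on M (g r)" "continuous_on M (radial f r)"
    "continuous_on M (radial g r)" if "r > r0" for r
    using Ck_end_0_slice[OF Ck_end_Suc_D[OF f] that] Ck_end_0_slice[OF Ck_end_Suc_D[OF g] that]
      Ck_end_0_slice[OF Ck_end_radial[OF f] that] Ck_end_0_slice[OF Ck_end_radial[OF g] that] by auto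
  have "((\<lambda>r. integ (\<lambda>z. f r z * g r z)) has_real_derivative
      integ (\<lambda>z. f r z * radial g r z + radial f r z * g r z)) (at r)"
  proof (rule integ_has_derivative[OF _ _ _ r, where F = "\<lambda>r z. f r z * g r z"
        and F' = "\<lambda>r z. f r z * radial g r z + radial f r z * g r z"])
    show "((\<lambda>r. f r z * g r z) has_real_derivative f r z * radial g r z + radial f r z * g r z) (at r)"
      if "r > r0" "z \<in> M" for r z
      by (rule DERIV_mult'[OF radial_derivative[OF f that] radial_derivative[OF g that]])
    show "continuous_on M (\<lambda>z. f r z * g r z)" if "r > r0" for r
      by (intro continuous_on_mult c that)
    show "continuous_on ({r0<..} \<times> chart_img c) (\<lambda>(r, y). f r (chart_inv c y) * radial g r (chart_inv c y)
        + radial f r (chart_inv c y) * g r (chart_inv c y))" if "c \<in> A" for c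
      unfolding case_prod_beta
      by (intro continuous_on_add continuous_on_mult Ck_end_continuous[OF f that] Ck_end_continuous[OF g that]
          Ck_end_continuous[OF Ck_end_radial[OF f] that] Ck_end_continuous[OF Ck_end_radial[OF g] that])
  qed
  then show ?thesis by (simp add: integ_add continuous_on_mult c[OF r])
qed

text \<open>After differentiation the gradient of \<open>f\<close> is paired with that of
  \<open>radial f\<close>; Green's formula takes \<open>radial f\<close>, which is only C1, as the
  test function.\<close>

lemma D_integ_grad:
  assumes f: "Ck_end r0 (Suc (Suc 0)) f" and r: "r > r0"
  shows "((\<lambda>r. integ (grad_inner (f r) (f r))) has_real_derivative
    - 2 * integ (\<lambda>z. radial f r z * laplacian A (f r) z)) (at r)"
proof -
  have f1: "Ck_end r0 (Suc 0) f" and g1: "Ck_end r0 (Suc 0) (radial f)"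
    using Ck_end_Suc_D[OF f] Ck_end_radial[OF f] by auto
  have "((\<lambda>r. integ (grad_inner (f r) (f r))) has_real_derivative
      integ (\<lambda>z. 2 * grad_inner (f r) (radial f r) z)) (at r)"
  proof (rule integ_has_derivative[OF D_grad_inner[OF f] _ _ r])
    show "continuous_on M (grad_inner (f r) (f r))" if "r > r0" for r
      by (rule grad_inner_continuous; rule Ck_end_slice[OF f1 that])
    show "continuous_on ({r0<..} \<times> chart_img c) (\<lambda>(r, y). 2 * grad_inner (f r) (radial f r) (chart_inv c y))"
      if "c \<in> A" for c
      unfolding case_prod_beta
      by (intro continuous_on_mult continuous_on_const grad_inner_end_continuous[OF f1 g1 that])
  qed
  also have "integ (\<lambda>z. 2 * grad_inner (f r) (radial f r) z) = 2 * integ (grad_inner (f r) (radial f r))"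
    by (rule integ_cmult) (rule grad_inner_continuous; rule Ck_end_slice[OF _ r], rule f1 g1)
  also have "\<dots> = - 2 * integ (\<lambda>z. radial f r z * laplacian A (f r) z)"
    using integ_green[OF Ck_end_slice[OF f r] Ck_end_slice[OF g1 r]] by simp
  finally show ?thesis .
qed

text \<open>For \<open>r > 2 * \<beta>\<close> the shifted weight is at most
  \<open>2 powr \<beta> * r powr \<beta>\<close>, so any rate \<open>\<tau>\<close> of decay with
  \<open>\<tau> \<ge> \<bar>\<sigma>\<bar> * 2 powr \<beta> + 1\<close> beats it with room for
  \<open>exp (- r)\<close>. Such rates exist because all large ones are available.\<close>

lemma weight_decay:
  assumes \<beta>: "\<beta> \<ge> 1" and u: "\<And>r. r > r0 \<Longrightarrow> continuous_on M (\<lambda>z. u (r, z))"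
    and decay: "\<forall>\<^sub>F \<tau> in at_top. bigo_end M u (\<lambda>r. exp (- \<tau> * r powr \<beta>))"
  shows "((\<lambda>r. exp (\<sigma> * (r + 2 * \<beta>) powr \<beta>) * integ (\<lambda>z. (u (r, z))\<^sup>2)) \<longlongrightarrow> 0) at_top"
proof -
  have "\<forall>\<^sub>F \<tau> in at_top. bigo_end M u (\<lambda>r. exp (- \<tau> * r powr \<beta>)) \<and> \<tau> \<ge> \<bar>\<sigma>\<bar> * 2 powr \<beta> + 1"
    using decay eventually_ge_at_top by (rule eventually_conj)
  then obtain \<tau> where t: "bigo_end M u (\<lambda>r. exp (- \<tau> * r powr \<beta>))" "\<tau> \<ge> \<bar>\<sigma>\<bar> * 2 powr \<beta> + 1"
    using eventually_happens'[OF trivial_limit_at_top_linorder] by blast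
  obtain B where B: "\<forall>\<^sub>F r in at_top. \<forall>x\<in>M. \<bar>u (r, x) / exp (- \<tau> * r powr \<beta>)\<bar> \<le> B"
    using bigo_endD[OF t(1)] .
  let ?I1 = "integ (\<lambda>z. 1)"
  have I1: "?I1 \<ge> 0" by (rule integ_nonneg) auto
  show ?thesis
  proof (rule Lim_null_comparison)
    show "\<forall>\<^sub>F r in at_top. norm (exp (\<sigma> * (r + 2 * \<beta>) powr \<beta>) * integ (\<lambda>z. (u (r, z))\<^sup>2))
        \<le> B\<^sup>2 * ?I1 * exp (- r)"
      using B eventually_gt_at_top[of "max r0 (2 * \<beta>)"]
    proof eventually_elim
      case (elim r)
      have r: "r > r0" "r > 2 * \<beta>" "r \<ge> 1" using elim(2) \<beta> by auto
      have "r powr 1 \<le> r powr \<beta>" using r \<beta> by (intro powr_mono) auto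
      then have rb: "r \<le> r powr \<beta>" using r by simp
      have "(r + 2 * \<beta>) powr \<beta> \<le> (2 * r) powr \<beta>" using r \<beta> by (intro powr_mono2) auto
      also have "\<dots> = 2 powr \<beta> * r powr \<beta>" using r by (simp add: powr_mult)
      finally have ph: "(r + 2 * \<beta>) powr \<beta> \<le> 2 powr \<beta> * r powr \<beta>" .
      have "\<sigma> * (r + 2 * \<beta>) powr \<beta> \<le> \<bar>\<sigma>\<bar> * (2 powr \<beta> * r powr \<beta>)"
        using ph by (intro mult_mono) auto
      also have "\<dots> \<le> (\<tau> - 1) * r powr \<beta>"
        using t(2) mult_right_mono[of "\<bar>\<sigma>\<bar> * 2 powr \<beta>" "\<tau> - 1" "r powr \<beta>"] by (simp add: mult.assoc)
      finally have s: "\<sigma> * (r + 2 * \<beta>) powr \<beta> \<le> (\<tau> - 1) * r powr \<beta>" .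
      have t1: "\<tau> \<ge> 1" using t(2) by (smt (verit) mult_nonneg_nonneg powr_ge_zero abs_ge_zero)
      have u2: "(u (r, z))\<^sup>2 \<le> B\<^sup>2 * exp (- 2 * \<tau> * r powr \<beta>)" if z: "z \<in> M" for z
      proof -
        have "\<bar>u (r, z)\<bar> \<le> B * exp (- \<tau> * r powr \<beta>)"
          using elim(1) z by (auto simp: abs_divide divide_le_eq)
        then have "\<bar>u (r, z)\<bar>\<^sup>2 \<le> (B * exp (- \<tau> * r powr \<beta>))\<^sup>2" by (intro power_mono) auto
        also have "\<dots> = B\<^sup>2 * exp (- 2 * \<tau> * r powr \<beta>)"
          by (simp add: power_mult_distrib exp_double[symmetric] mult.assoc)
        finally show ?thesis by simp
      qed
      have cu: "continuous_on M (\<lambda>z. (u (r, z))\<^sup>2)" by (intro continuous_intros u r)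
      have "integ (\<lambda>z. (u (r, z))\<^sup>2) \<le> integ (\<lambda>z. B\<^sup>2 * exp (- 2 * \<tau> * r powr \<beta>) * 1)"
        by (rule integ_mono[OF cu]) (use u2 in auto)
      also have "\<dots> = B\<^sup>2 * exp (- 2 * \<tau> * r powr \<beta>) * ?I1" by (rule integ_cmult) auto
      finally have I: "integ (\<lambda>z. (u (r, z))\<^sup>2) \<le> B\<^sup>2 * exp (- 2 * \<tau> * r powr \<beta>) * ?I1" .
      have I0: "integ (\<lambda>z. (u (r, z))\<^sup>2) \<ge> 0" by (rule integ_nonneg[OF cu]) auto
      have "exp (\<sigma> * (r + 2 * \<beta>) powr \<beta>) * integ (\<lambda>z. (u (r, z))\<^sup>2)
          \<le> exp (\<sigma> * (r + 2 * \<beta>) powr \<beta>) * (B\<^sup>2 * exp (- 2 * \<tau> * r powr \<beta>) * ?I1)"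
        using I by (intro mult_left_mono) auto
      also have "\<dots> = B\<^sup>2 * ?I1 * exp (\<sigma> * (r + 2 * \<beta>) powr \<beta> - 2 * \<tau> * r powr \<beta>)"
        by (simp add: exp_diff exp_minus field_simps)
      also have "\<dots> \<le> B\<^sup>2 * ?I1 * exp (- r)"
      proof -
        have "\<sigma> * (r + 2 * \<beta>) powr \<beta> - 2 * \<tau> * r powr \<beta> \<le> - ((\<tau> + 1) * r powr \<beta>)"
          using s by (simp add: algebra_simps)
        also have "\<dots> \<le> - r"
          using rb t1 mult_right_mono[of 1 "\<tau> + 1" "r powr \<beta>"] by simp
        finally show ?thesis using I1 by (intro mult_left_mono) auto
      qed
      finally show ?case using I0 by simp
    qed
    have "((\<lambda>r::real. exp (- r)) \<longlongrightarrow> 0) at_top"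
      by (rule filterlim_compose[OF exp_at_bot filterlim_uminus_at_bot_at_top])
    then show "((\<lambda>r. B\<^sup>2 * ?I1 * exp (- r)) \<longlongrightarrow> 0) at_top"
      by (rule tendsto_mult_right_zero)
  qed
qed

text \<open>Everything specific to powers of \<open>r\<close> is confined here:
  \<open>carleman\<close> knows the weight only through \<open>\<phi>\<close>, its first three
  derivatives and the constant \<open>\<kappa>\<close>, which is \<open>\<beta>\<close>
  here.\<close>

lemma vanishing:
  assumes r0: "0 \<le> r0" and u: "Ck_end r0 (Suc (Suc 0)) (\<lambda>r z. u (r, z))"
    and ineq: "\<And>r z. r > r0 \<Longrightarrow> z \<in> M \<Longrightarrow> \<bar>laplacian (hyp_cone_atlas A) u (r, z)\<bar>
       \<le> C1 * r powr ((3 * \<beta> - 3) / 2) * \<bar>u (r, z)\<bar>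
         + C2 * r powr ((\<beta> - 1) / 2) * grad_norm (hyp_cone_atlas A) u (r, z)"
    and C: "0 \<le> C1" "0 \<le> C2" and \<beta>: "1 \<le> \<beta>"
    and decay: "\<forall>\<^sub>F \<tau> in at_top. bigo_end M u (\<lambda>r. exp (- \<tau> * r powr \<beta>))"
    and r: "r > r0" and z: "z \<in> M"
  shows "u (r, z) = 0"
proof -
  let ?f = "\<lambda>r z. u (r, z)"
  have f1: "Ck_end r0 (Suc 0) ?f" by (rule Ck_end_Suc_D[OF u])
  have f0: "Ck_end r0 0 ?f" by (rule Ck_end_Suc_D[OF f1])
  have g1: "Ck_end r0 (Suc 0) (radial ?f)" by (rule Ck_end_radial[OF u])
  have g0: "Ck_end r0 0 (radial ?f)" by (rule Ck_end_Suc_D[OF g1])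
  have h0: "Ck_end r0 0 (radial (radial ?f))" by (rule Ck_end_radial[OF g1])
  \<comment> \<open>The shift by \<open>2 * \<beta>\<close> makes \<open>\<phi>'' \<le> \<phi>' / 2\<close> hold down to \<open>r = 0\<close>.\<close>
  define x where "x r = r + 2 * \<beta>" for r
  have x: "x r \<ge> 2 * \<beta>" "x r \<ge> 1" "x r > 0" "r \<le> x r" "r > 0" if "r > r0" for r
    using that r0 \<beta> by (auto simp: x_def)
  have xp: "x r powr (\<beta> - 1) \<ge> 1" if "r > r0" for r
    using x[OF that] \<beta> by (intro ge_one_powr_ge_zero) auto
  have shift: "x r powr (s - 1) = x r powr s / x r" if "r > r0" for r s
    using x[OF that] by (simp add: powr_diff)
  interpret carleman M integ r0 "real DIM('b)" "C1\<^sup>2 + C2\<^sup>2" \<beta> ?f "radial ?f" "radial (radial ?f)"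
    "\<lambda>r. laplacian A (?f r)" "\<lambda>r. grad_inner (?f r) (?f r)"
    "\<lambda>r. C1 * r powr ((3 * \<beta> - 3) / 2)" "\<lambda>r. C2 * r powr ((\<beta> - 1) / 2)"
    "\<lambda>r. x r powr \<beta>" "\<lambda>r. \<beta> * x r powr (\<beta> - 1)" "\<lambda>r. \<beta> * (\<beta> - 1) * x r powr (\<beta> - 2)"
    "\<lambda>r. \<beta> * (\<beta> - 1) * (\<beta> - 2) * x r powr (\<beta> - 3)"
  proof (unfold_locales)
    show "integ (\<lambda>z. a * F z + b * G z) = a * integ F + b * integ G"
      if "continuous_on M F" "continuous_on M G" for F G a b by (rule integ_linear[OF that])
    show "0 \<le> integ F" if "continuous_on M F" "\<And>z. z \<in> M \<Longrightarrow> 0 \<le> F z" for F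
      by (rule integ_nonneg[OF that])
    show "0 \<le> r0" "0 \<le> real DIM('b)" "0 \<le> C1\<^sup>2 + C2\<^sup>2" using r0 by auto
  next
    fix r assume r: "r > r0"
    show "continuous_on M (?f r)" "continuous_on M (radial ?f r)" "continuous_on M (radial (radial ?f) r)"
      using Ck_end_0_slice[OF f0 r] Ck_end_0_slice[OF g0 r] Ck_end_0_slice[OF h0 r] by auto
    show "continuous_on M (laplacian A (?f r))" by (rule laplacian_continuous[OF Ck_end_slice[OF u r]])
    show "continuous_on M (grad_inner (?f r) (?f r))"
      by (rule grad_inner_continuous; rule Ck_end_slice[OF f1 r])
    show "((\<lambda>r. integ (\<lambda>z. (?f r z)\<^sup>2)) has_real_derivative 2 * integ (\<lambda>z. ?f r z * radial ?f r z)) (at r)"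
      using D_integ_mult[OF f1 f1 r] by (simp add: power2_eq_square mult.commute)
    show "((\<lambda>r. integ (\<lambda>z. ?f r z * radial ?f r z)) has_real_derivative
        integ (\<lambda>z. (radial ?f r z)\<^sup>2) + integ (\<lambda>z. ?f r z * radial (radial ?f) r z)) (at r)"
      using D_integ_mult[OF f1 g1 r] by (simp add: power2_eq_square add.commute)
    show "((\<lambda>r. integ (\<lambda>z. (radial ?f r z)\<^sup>2)) has_real_derivative
        2 * integ (\<lambda>z. radial ?f r z * radial (radial ?f) r z)) (at r)"
      using D_integ_mult[OF g1 g1 r] by (simp add: power2_eq_square mult.commute)
    show "((\<lambda>r. integ (grad_inner (?f r) (?f r))) has_real_derivative
        - 2 * integ (\<lambda>z. radial ?f r z * laplacian A (?f r) z)) (at r)"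
      by (rule D_integ_grad[OF u r])
    show "integ (\<lambda>z. ?f r z * laplacian A (?f r) z) = - integ (grad_inner (?f r) (?f r))"
      by (rule integ_green[OF Ck_end_slice[OF u r] Ck_end_slice[OF f1 r]])
    have p1: "x r powr (\<beta> - 1) \<le> \<beta> * x r powr (\<beta> - 1)"
      using \<beta> mult_right_mono[of 1 \<beta> "x r powr (\<beta> - 1)"] by simp
    show pge: "1 \<le> \<beta> * x r powr (\<beta> - 1)" using p1 xp[OF r] by simp
    have rx: "r powr (\<beta> - 1) \<le> x r powr (\<beta> - 1)" using x[OF r] \<beta> by (intro powr_mono2) auto
    have rp: "r powr (\<beta> - 1) \<le> \<beta> * x r powr (\<beta> - 1)" using rx p1 by simp
    \<comment> \<open>The exponents in the coefficients are \<open>3 / 2\<close> and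
      \<open>1 / 2\<close> of \<open>\<beta> - 1\<close>, the order of \<open>p\<close>; squaring
      gives the powers 3 and 1 of \<open>p\<close>.\<close>
    have "(r powr ((3 * \<beta> - 3) / 2))\<^sup>2 = (r powr (\<beta> - 1)) ^ 3"
    proof -
      have "(3 * \<beta> - 3) / 2 + (3 * \<beta> - 3) / 2 = (\<beta> - 1) + (\<beta> - 1) + (\<beta> - 1)" by simp
      then show ?thesis
        by (simp only: power2_eq_square power3_eq_cube powr_add[symmetric])
    qed
    also have "\<dots> \<le> (\<beta> * x r powr (\<beta> - 1)) ^ 3" using rp by (intro power_mono) auto
    finally have "C1\<^sup>2 * (r powr ((3 * \<beta> - 3) / 2))\<^sup>2 \<le> (C1\<^sup>2 + C2\<^sup>2) * (\<beta> * x r powr (\<beta> - 1)) ^ 3"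
      by (intro mult_mono) auto
    then show "(C1 * r powr ((3 * \<beta> - 3) / 2))\<^sup>2 \<le> (C1\<^sup>2 + C2\<^sup>2) * (\<beta> * x r powr (\<beta> - 1)) ^ 3"
      by (simp add: power_mult_distrib)
    have "(r powr ((\<beta> - 1) / 2))\<^sup>2 = r powr (\<beta> - 1)"
    proof -
      have "(\<beta> - 1) / 2 + (\<beta> - 1) / 2 = \<beta> - 1" by simp
      then show ?thesis by (simp only: power2_eq_square powr_add[symmetric])
    qed
    then have "C2\<^sup>2 * (r powr ((\<beta> - 1) / 2))\<^sup>2 \<le> (C1\<^sup>2 + C2\<^sup>2) * (\<beta> * x r powr (\<beta> - 1))"
      using rp by (intro mult_mono) auto
    then show "(C2 * r powr ((\<beta> - 1) / 2))\<^sup>2 \<le> (C1\<^sup>2 + C2\<^sup>2) * (\<beta> * x r powr (\<beta> - 1))"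
      by (simp add: power_mult_distrib)
    have D: "((\<lambda>r. x r powr s) has_real_derivative s * x r powr (s - 1)) (at r)" for s
      using x[OF r] unfolding x_def by (auto intro!: derivative_eq_intros)
    show "((\<lambda>r. x r powr \<beta>) has_real_derivative \<beta> * x r powr (\<beta> - 1)) (at r)" by (rule D)
    show "((\<lambda>r. \<beta> * x r powr (\<beta> - 1)) has_real_derivative \<beta> * (\<beta> - 1) * x r powr (\<beta> - 2)) (at r)"
      using DERIV_cmult[OF D[of "\<beta> - 1"], of \<beta>] by (simp add: mult.assoc)
    show "((\<lambda>r. \<beta> * (\<beta> - 1) * x r powr (\<beta> - 2)) has_real_derivative
        \<beta> * (\<beta> - 1) * (\<beta> - 2) * x r powr (\<beta> - 3)) (at r)"
      using DERIV_cmult[OF D[of "\<beta> - 2"], of "\<beta> * (\<beta> - 1)"] by (simp add: mult.assoc)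
    have s2: "x r powr (\<beta> - 2) = x r powr (\<beta> - 1) / x r" using shift[OF r, of "\<beta> - 1"] by simp
    have s3: "x r powr (\<beta> - 3) = x r powr (\<beta> - 1) / (x r)\<^sup>2"
      using shift[OF r, of "\<beta> - 2"] s2 by (simp add: power2_eq_square)
    show "0 \<le> \<beta> * (\<beta> - 1) * x r powr (\<beta> - 2)" using \<beta> by simp
    have q: "(\<beta> - 1) / x r \<le> 1 / 2" using x[OF r] \<beta> by (simp add: field_simps)
    have "\<beta> * x r powr (\<beta> - 1) * ((\<beta> - 1) / x r) \<le> \<beta> * x r powr (\<beta> - 1) * (1 / 2)"
      using q \<beta> by (intro mult_left_mono) auto
    then show "\<beta> * (\<beta> - 1) * x r powr (\<beta> - 2) \<le> \<beta> * x r powr (\<beta> - 1) / 2"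
      by (simp add: s2 algebra_simps)
    have "(\<beta> - 1) * \<bar>\<beta> - 2\<bar> \<le> x r * x r" using x[OF r] \<beta> by (intro mult_mono) auto
    then have "(\<beta> - 1) * \<bar>\<beta> - 2\<bar> / (x r)\<^sup>2 \<le> 1" using x[OF r] by (simp add: power2_eq_square)
    then have "\<beta> * x r powr (\<beta> - 1) * ((\<beta> - 1) * \<bar>\<beta> - 2\<bar> / (x r)\<^sup>2) \<le> \<beta> * x r powr (\<beta> - 1) * 1"
      using \<beta> by (intro mult_left_mono) auto
    moreover have "\<bar>\<beta> * (\<beta> - 1) * (\<beta> - 2) * x r powr (\<beta> - 3)\<bar> =
        \<beta> * (\<beta> - 1) * \<bar>\<beta> - 2\<bar> * x r powr (\<beta> - 3)"
      using \<beta> by (simp add: abs_mult)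
    moreover have "\<dots> = \<beta> * x r powr (\<beta> - 1) * ((\<beta> - 1) * \<bar>\<beta> - 2\<bar> / (x r)\<^sup>2)"
      by (simp only: s3 times_divide_eq_right times_divide_eq_left mult_ac)
    ultimately show "\<bar>\<beta> * (\<beta> - 1) * (\<beta> - 2) * x r powr (\<beta> - 3)\<bar> \<le> \<beta> * x r powr (\<beta> - 1)"
      by linarith
    have "x r powr (\<beta> - 1) \<le> x r powr \<beta>" using x[OF r] by (intro powr_mono) auto
    then have "\<beta> * x r powr (\<beta> - 1) \<le> \<beta> * x r powr \<beta>" using \<beta> by (intro mult_left_mono) auto
    also have "\<dots> \<le> exp (\<beta> * x r powr \<beta>)" using exp_ge_add_one_self[of "\<beta> * x r powr \<beta>"] by linarith
    finally show "\<beta> * x r powr (\<beta> - 1) \<le> exp (\<beta> * x r powr \<beta>)" .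
    have "x r powr 1 \<le> x r powr \<beta>" using x[OF r] \<beta> by (intro powr_mono) auto
    then show "r \<le> x r powr \<beta>" using x[OF r] by simp
  next
    fix r z assume r: "r > r0" and z: "z \<in> M"
    show "0 \<le> grad_inner (?f r) (?f r) z" by (rule grad_inner_nonneg[OF Ck_end_slice[OF f1 r] z])
    show "\<bar>radial (radial ?f) r z + real DIM('b) * (cosh r / sinh r) * radial ?f r z + laplacian A (?f r) z / (sinh r)\<^sup>2\<bar>
        \<le> C1 * r powr ((3 * \<beta> - 3) / 2) * \<bar>?f r z\<bar> + C2 * r powr ((\<beta> - 1) / 2) *
          sqrt ((radial ?f r z)\<^sup>2 + grad_inner (?f r) (?f r) z / (sinh r)\<^sup>2)"
      using ineq[OF r z] by (simp add: cone_laplacian[OF u r0 r z] cone_grad_norm[OF f1 r0 r z])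
  next
    show "((\<lambda>r. exp (\<sigma> * x r powr \<beta>) * integ (\<lambda>z. (?f r z)\<^sup>2)) \<longlongrightarrow> 0) at_top" for \<sigma>
      unfolding x_def by (rule weight_decay[OF \<beta> _ decay]) (rule Ck_end_0_slice[OF f0])
  qed
  have I0: "integ (\<lambda>z. (?f r z)\<^sup>2) = 0" using a_eq_0[OF r] by (simp add: a_def)
  have cont: "continuous_on M (\<lambda>z. (?f r z)\<^sup>2)"
    by (intro continuous_intros Ck_end_0_slice[OF f0 r])
  have "(?f r z)\<^sup>2 = 0"
    by (rule integ_eq_0D[OF cont _ I0 z]) simp
  then show ?thesis by simp
qed

end

theorem corollary11:
  fixes N :: "'a::t2_space set"
    and A :: "('a, 'b::euclidean_space) rchart set"
    and r0 C1 C2 \<beta> :: real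
    and u q1 q2 :: "real \<times> 'a \<Rightarrow> real"
  assumes N: "riemannian_manifold N A" "compact N"
    and r0: "0 \<le> r0"
    and u: "Ck_on_manifold 2 (hyp_cone_atlas A) (conical_end N r0) u"
    and q1: "continuous_on (conical_end N r0) q1" "\<And>z. z \<in> conical_end N r0 \<Longrightarrow> 0 \<le> q1 z"
    and q2: "continuous_on (conical_end N r0) q2" "\<And>z. z \<in> conical_end N r0 \<Longrightarrow> 0 \<le> q2 z"
    and ineq: "\<And>z. z \<in> conical_end N r0 \<Longrightarrow>
       \<bar>laplacian (hyp_cone_atlas A) u z\<bar>
         \<le> q1 z * \<bar>u z\<bar> + q2 z * grad_norm (hyp_cone_atlas A) u z"
    and C: "0 \<le> C1" "0 \<le> C2"
    and cases:
      "((\<forall>(r, x)\<in>conical_end N r0. q1 (r, x) = C1 * r powr ((3 * \<beta> - 3) / 2)) \<and>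
        (\<forall>(r, x)\<in>conical_end N r0. q2 (r, x) = C2 * r powr ((\<beta> - 1) / 2)) \<and>
        1 \<le> \<beta> \<and> \<beta> \<le> 2 \<and>
        (\<forall>\<^sub>F \<tau> in at_top. bigo_end N u (\<lambda>r. exp (- \<tau> * r powr \<beta>))))
       \<or>
       ((\<forall>(r, x)\<in>conical_end N r0. q1 (r, x) = C1 * r powr ((3 * \<beta> - 3) / 2)) \<and>
        (\<forall>(r, x)\<in>conical_end N r0. q2 (r, x) = C2 * r powr ((\<beta> - 1) / 2)) \<and>
        \<beta> > 2 \<and>
        (\<forall>\<^sub>F \<tau> in at_top. bigo_end N u (\<lambda>r. exp (- \<tau> * r powr \<beta>))) \<and>
        (\<forall>\<^sub>F \<tau> in at_top.
           ((\<lambda>R. (\<integral>\<^sup>+z\<in>conical_end N r0 - conical_end N (2 * R).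
                    ennreal ((grad_norm (hyp_cone_atlas A) u z)\<^sup>2 * exp (2 * \<tau> * fst z powr \<beta>))
                    \<partial>riemannian_measure (hyp_cone N) (hyp_cone_atlas A))
                 / ennreal (R\<^sup>2)) \<longlongrightarrow> 0) at_top))"
  shows "\<forall>z\<in>conical_end N r0. u z = 0"
proof
  fix p assume p: "p \<in> conical_end N r0"
  interpret riemannian_manifold N A by (rule N(1))
  \<comment> \<open>Compactness of the section enters through the finite partition of unity.\<close>
  obtain P pc \<rho> K where part: "riemannian_partition N A P pc \<rho> K"
    using exists_riemannian_partition[OF N(2)] by blast
  interpret riemannian_partition N A P pc \<rho> K by (rule part)
  obtain r z where rz: "p = (r, z)" "r > r0" "z \<in> N" using p by (auto simp: conical_end_def)
  have "u (r, z) = 0"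
  proof (rule vanishing[OF r0 _ _ C _ _ rz(2,3), where \<beta> = \<beta>])
    show "Ck_end r0 (Suc (Suc 0)) (\<lambda>r z. u (r, z))"
      by (rule Ck_end_of_cone[OF r0]) (use u in \<open>simp add: numeral_2_eq_2\<close>)
    show "\<bar>laplacian (hyp_cone_atlas A) u (r, z)\<bar> \<le> C1 * r powr ((3 * \<beta> - 3) / 2) * \<bar>u (r, z)\<bar>
        + C2 * r powr ((\<beta> - 1) / 2) * grad_norm (hyp_cone_atlas A) u (r, z)"
      if "r > r0" "z \<in> N" for r z
      using ineq[of "(r, z)"] cases that by (auto simp: conical_end_def)
    show "1 \<le> \<beta>" using cases by auto
    show "\<forall>\<^sub>F \<tau> in at_top. bigo_end N u (\<lambda>r. exp (- \<tau> * r powr \<beta>))" using cases by blast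
  qed
  then show "u p = 0" by (simp add: rz)
qed

end
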